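(* Let $n\ge2$ and let $\mathbf e_1\in T_{\mathbf 0}\mathbb{H}^n$ be a unit vector. For $R>0$ put $P(t)=\exp_{\mathbf 0}\big(-Rt(1-t)\mathbf e_1\big)$, $t\in[0,1]$. Then for any $\varepsilon>0$, $\mu>0$, any $h=h(x,t)\in C_0^\infty(\mathbb{H}^n\times[0,1])$ and any $R>4\mu\varepsilon^{-1/2}\mathfrak{C}_n$, $$ \frac{R}{4}\sqrt{\frac{\varepsilon}{\mu}}\,\Big\|e^{\mu d(x,P(t))^2-\frac{(1+\varepsilon)R^2t(1-t)}{16\mu}}\,h\Big\|_{L^2(\mathbb{H}^n\times[0,1])}\le \Big\|e^{\mu d(x,P(t))^2-\frac{(1+\varepsilon)R^2t(1-t)}{16\mu}}\,(\partial_t-i\Delta_g)h\Big\|_{L^2(\mathbb{H}^n\times[0,1])}. $$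
   Context: $\mathbb{H}^n$ is hyperbolic space of constant curvature $-1$ with metric $g$, origin $\mathbf 0$, geodesic distance $d$, exponential map $\exp$, and Laplace–Beltrami operator $\Delta_g$. $\mathfrak{C}_n>0$ is a fixed constant depending only on $n$ such that $|\Delta_g^2(\rho^2)|\le\mathfrak{C}_n$ on $\mathbb{H}^n$, where $\rho$ is the geodesic distance to a fixed point (such a constant exists). $C_0^\infty(\mathbb{H}^n\times[0,1])$ denotes smooth complex-valued functions with compact support contained in $\mathbb{H}^n\times(0,1)$. *)

theory Defs
  imports "HOL-Analysis.Analysis"
begin

section \<open>Riemannian geometry in a global chart\<close>

text \<open>
  A Riemannian manifold covered by one chart is given by an open set \<open>U\<close> of coordinates and
  the matrix \<open>g x\<close> of the metric tensor at each \<open>x \<in> U\<close>; tangent vectors are identified with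
  their coordinate vectors.
\<close>

type_synonym 'n metric_tensor = "real ^ 'n \<Rightarrow> real ^ 'n ^ 'n"

definition riem_inner :: "'n::finite metric_tensor \<Rightarrow> real ^ 'n \<Rightarrow> real ^ 'n \<Rightarrow> real ^ 'n \<Rightarrow> real" where
  "riem_inner g x u v = u \<bullet> (g x *v v)"

definition riem_norm :: "'n::finite metric_tensor \<Rightarrow> real ^ 'n \<Rightarrow> real ^ 'n \<Rightarrow> real" where
  "riem_norm g x v = sqrt (riem_inner g x v v)"

definition partial :: "'n::finite \<Rightarrow> (real ^ 'n \<Rightarrow> 'b::real_normed_vector) \<Rightarrow> real ^ 'n \<Rightarrow> 'b" where
  "partial i f x = frechet_derivative f (at x) (axis i 1)"

text \<open>
  The Laplace--Beltrami operator, with the sign for which it is nonpositive: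
  \<open>\<Delta>\<^sub>g f = (det g)\<^sup>-\<^sup>1\<^sup>/\<^sup>2 \<Sum>\<^sub>i \<partial>\<^sub>i ((det g)\<^sup>1\<^sup>/\<^sup>2 \<Sum>\<^sub>j g\<^sup>i\<^sup>j \<partial>\<^sub>j f)\<close>.
\<close>

definition laplace_beltrami ::
    "'n::finite metric_tensor \<Rightarrow> (real ^ 'n \<Rightarrow> 'b::real_normed_vector) \<Rightarrow> real ^ 'n \<Rightarrow> 'b" where
  "laplace_beltrami g f x =
     (1 / sqrt (det (g x))) *\<^sub>R
       (\<Sum>i\<in>UNIV. partial i
          (\<lambda>y. sqrt (det (g y)) *\<^sub>R (\<Sum>j\<in>UNIV. (matrix_inv (g y) $ i $ j) *\<^sub>R partial j f y)) x)"

definition riem_volume :: "(real ^ 'n::finite) set \<Rightarrow> 'n metric_tensor \<Rightarrow> (real ^ 'n) measure" where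
  "riem_volume U g = density (restrict_space lborel U) (\<lambda>x. ennreal (sqrt (det (g x))))"

text \<open>
  The geodesic distance is the infimum of the lengths of piecewise \<open>C\<^sup>1\<close> curves.  Because
  \<^const>\<open>valid_path\<close> does not bound the velocity near the exceptional points, a curve may have
  infinite length; stating the length with \<^const>\<open>has_integral\<close> discards such curves (the
  function \<^const>\<open>integral\<close> would give them length \<open>0\<close>).
\<close>

definition riem_dist ::
    "(real ^ 'n::finite) set \<Rightarrow> 'n metric_tensor \<Rightarrow> real ^ 'n \<Rightarrow> real ^ 'n \<Rightarrow> real" where
  "riem_dist U g x y = Inf {L. \<exists>\<gamma>. valid_path \<gamma> \<and> path_image \<gamma> \<subseteq> U \<and>
     pathstart \<gamma> = x \<and> pathfinish \<gamma> = y \<and>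
     ((\<lambda>s. riem_norm g (\<gamma> s) (vector_derivative \<gamma> (at s))) has_integral L) {0..1}}"

text \<open>The Christoffel symbol \<open>\<Gamma>\<^sup>k\<^sub>i\<^sub>j\<close> of the Levi-Civita connection.\<close>

definition christoffel :: "'n::finite metric_tensor \<Rightarrow> real ^ 'n \<Rightarrow> 'n \<Rightarrow> 'n \<Rightarrow> 'n \<Rightarrow> real" where
  "christoffel g x k i j =
     (1/2) * (\<Sum>l\<in>UNIV. matrix_inv (g x) $ k $ l *
        (partial i (\<lambda>y. g y $ j $ l) x + partial j (\<lambda>y. g y $ i $ l) x
          - partial l (\<lambda>y. g y $ i $ j) x))"

text \<open>\<open>\<gamma>\<close> is an affinely parametrised geodesic on the parameter set \<open>S\<close>, with velocity \<open>v\<close>.\<close>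

definition geodesic_on ::
    "(real ^ 'n::finite) set \<Rightarrow> 'n metric_tensor \<Rightarrow> real set \<Rightarrow>
     (real \<Rightarrow> real ^ 'n) \<Rightarrow> (real \<Rightarrow> real ^ 'n) \<Rightarrow> bool" where
  "geodesic_on U g S \<gamma> v \<longleftrightarrow> (\<forall>s\<in>S.
     \<gamma> s \<in> U \<and>
     (\<gamma> has_vector_derivative v s) (at s within S) \<and>
     (v has_vector_derivative
        (\<chi> k. - (\<Sum>i\<in>UNIV. \<Sum>j\<in>UNIV. christoffel g (\<gamma> s) k i j * v s $ i * v s $ j)))
       (at s within S))"

definition riem_exp ::
    "(real ^ 'n::finite) set \<Rightarrow> 'n metric_tensor \<Rightarrow> real ^ 'n \<Rightarrow> real ^ 'n \<Rightarrow> real ^ 'n" where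
  "riem_exp U g p w =
     (THE q. \<exists>\<gamma> v. geodesic_on U g {0..1} \<gamma> v \<and> \<gamma> 0 = p \<and> v 0 = w \<and> \<gamma> 1 = q)"

section \<open>Hyperbolic space\<close>

text \<open>
  The Poincare ball model: the open unit ball with \<open>4 |dx|\<^sup>2 / (1 - |x|\<^sup>2)\<^sup>2\<close>, of constant curvature
  \<open>-1\<close>.  The origin of hyperbolic space is the centre \<open>0\<close>; the metric there is \<open>4 |dx|\<^sup>2\<close>,
  so \<open>g\<close>-unit vectors at \<open>0\<close> have Euclidean norm \<open>1/2\<close>.
\<close>

definition hyp_space :: "(real ^ 'n::finite) set" where
  "hyp_space = ball 0 1"

definition hyp_metric :: "'n::finite metric_tensor" where
  "hyp_metric x = (4 / (1 - (norm x)\<^sup>2)\<^sup>2) *\<^sub>R mat 1"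

definition hyp_dist :: "real ^ 'n::finite \<Rightarrow> real ^ 'n \<Rightarrow> real" where
  "hyp_dist = riem_dist hyp_space hyp_metric"

definition hyp_exp :: "real ^ 'n::finite \<Rightarrow> real ^ 'n \<Rightarrow> real ^ 'n" where
  "hyp_exp = riem_exp hyp_space hyp_metric"

definition hyp_laplacian ::
    "(real ^ 'n::finite \<Rightarrow> 'b::real_normed_vector) \<Rightarrow> real ^ 'n \<Rightarrow> 'b" where
  "hyp_laplacian = laplace_beltrami hyp_metric"

definition hyp_volume :: "(real ^ 'n::finite) measure" where
  "hyp_volume = riem_volume hyp_space hyp_metric"

section \<open>Function spaces\<close>

text \<open>Both notions below are meant for open sets \<open>S\<close>.\<close>

primrec Ck_on ::
    "nat \<Rightarrow> 'a set \<Rightarrow> ('a::euclidean_space \<Rightarrow> 'b::real_normed_vector) \<Rightarrow> bool" where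
  "Ck_on 0 S f \<longleftrightarrow> continuous_on S f"
| "Ck_on (Suc k) S f \<longleftrightarrow> (\<forall>x\<in>S. f differentiable (at x)) \<and>
     (\<forall>v. Ck_on k S (\<lambda>x. frechet_derivative f (at x) v))"

definition smooth_on :: "'a set \<Rightarrow> ('a::euclidean_space \<Rightarrow> 'b::real_normed_vector) \<Rightarrow> bool" where
  "smooth_on S f \<longleftrightarrow> (\<forall>k. Ck_on k S f)"

text \<open>Elements of \<open>C\<^sub>0\<^sup>\<infinity>(S)\<close> are represented by their extension by zero to the whole space.\<close>

definition test_functions :: "'a set \<Rightarrow> ('a::euclidean_space \<Rightarrow> 'b::real_normed_vector) set" where
  "test_functions S = {f. smooth_on S f \<and>
     compact (closure {z. f z \<noteq> 0}) \<and> closure {z. f z \<noteq> 0} \<subseteq> S}"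

definition spacetime_measure :: "((real ^ 'n::finite) \<times> real) measure" where
  "spacetime_measure = hyp_volume \<Otimes>\<^sub>M restrict_space lborel {0..1}"

text \<open>Meaningful for square-integrable \<open>f\<close> only, as the Bochner integral defaults to \<open>0\<close>.\<close>

definition L2norm :: "'a measure \<Rightarrow> ('a \<Rightarrow> complex) \<Rightarrow> real" where
  "L2norm M f = sqrt (LINT z|M. (cmod (f z))\<^sup>2)"

definition schroedinger ::
    "((real ^ 'n::finite) \<times> real \<Rightarrow> complex) \<Rightarrow> (real ^ 'n) \<times> real \<Rightarrow> complex" where
  "schroedinger h = (\<lambda>(x, t). vector_derivative (\<lambda>s. h (x, s)) (at t)
     - \<i> * hyp_laplacian (\<lambda>y. h (y, t)) x)"

end

theory Submission
  imports Defs
begin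

text \<open>
  Put \<open>\<phi> = \<mu> d(x, P(t))\<^sup>2 - (1 + \<epsilon>) R\<^sup>2 t (1 - t) / (16 \<mu>)\<close> and \<open>f = e\<^sup>\<phi> h\<close>.  Conjugation by the weight turns
  \<open>\<partial>\<^sub>t - i \<Delta>\<close> into \<open>(\<partial>\<^sub>t - \<A>) - \<S>\<close> with a symmetric \<open>\<S>\<close> and an antisymmetric \<open>\<A>\<close>, so the squared
  norm of the right-hand side is at least \<open>\<langle>(\<S>\<^sub>t + [\<S>, \<A>]) f, f\<rangle>\<close>, that is, the integral of
  \<open>4 D\<^sup>2\<phi>(\<nabla>f, \<nabla>f) + 4 Im (f \<nabla>\<phi>\<^sub>t \<cdot> \<nabla>f) + \<phi>\<^sub>t\<^sub>t |f|\<^sup>2 + 4 D\<^sup>2\<phi>(\<nabla>\<phi>, \<nabla>\<phi>) |f|\<^sup>2 - \<Delta>\<^sup>2\<phi> |f|\<^sup>2\<close>.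
  The terms with derivatives of \<open>f\<close>, together with the part of \<open>\<phi>\<^sub>t\<^sub>t\<close> quadratic in the speed of \<open>P\<close>, are
  nonnegative because \<open>d(x, \<gamma>(s))\<^sup>2\<close> is jointly convex in \<open>(x, s)\<close> along a geodesic \<open>\<gamma>\<close>.  The eikonal
  equation \<open>|\<nabla>d\<^sup>2|\<^sup>2 = 4 d\<^sup>2\<close> turns the rest into
  \<open>32 \<mu>\<^sup>3 (d - R / (16 \<mu>\<^sup>2))\<^sup>2 + \<epsilon> R\<^sup>2 / (8 \<mu>) - \<mu> C\<close> or more, times \<open>|f|\<^sup>2\<close>; since \<open>\<Delta>\<^sup>2 d\<^sup>2 \<ge> 8/3\<close> at the centre
  forces \<open>C \<ge> 1\<close>, the lower bound on \<open>R\<close> absorbs \<open>\<mu> C\<close>.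

  Everything is reduced to \<open>Z = cosh d\<close>, the restriction of a linear function to the hyperboloid:
  \<open>D\<^sup>2Z = Z g\<close>, \<open>|\<nabla>Z|\<^sup>2 = Z\<^sup>2 - 1\<close>, and \<open>d\<^sup>2 = G(Z)\<close> with \<open>G = arcosh\<^sup>2\<close> smooth across \<open>1\<close>.
\<close>

text \<open>The constants balance as follows. The second time derivative of the phase contributes (1
  + \<epsilon>) R^2 / (8 \<mu>). The acceleration of \<open>P\<close> costs at most 4 \<mu> R d, and
  the cubic term 32 \<mu>^3 d^2 compensates this together with exactly R^2 / (8 \<mu>), by
  completing the square. The surplus \<epsilon> R^2 / (8 \<mu>) is split in halves: one pays for the
  bilaplacian, the other is the square of the constant R / 4 sqrt (\<epsilon> / \<mu>).

  The obstacle is that d is not smooth at d = 0 and that covariant Hessians would call for tensor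
  calculus in the chart. Hence d is never differentiated, and the work is done in a commutative ring
  of smooth functions with derivations, where the Hessian is encoded by gradient products. Operator
  identities become normalisation in a ring, and convexity becomes an inequality between real
  numbers whose main geometric input is the nonnegative Gram form of three gradients. Distance and
  exponential map, as defined by curves, enter only to identify d^2 with the composition of G and
  Z.\<close>

section \<open>Calculus of \<open>Ck_on\<close> and \<open>smooth_on\<close>\<close>

lemma Ck_on_cong:
  assumes "open S" "\<And>x. x \<in> S \<Longrightarrow> f x = g x"
  shows "Ck_on k S f \<longleftrightarrow> Ck_on k S g"
proof -
  have *: "Ck_on k S f" if "\<And>x. x \<in> S \<Longrightarrow> f x = g x" "Ck_on k S g" for f g
    using that
  proof (induction k arbitrary: f g)
    case 0
    then show ?case by (simp cong: continuous_on_cong)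
  next
    case (Suc k)
    have d: "f differentiable at x \<and> frechet_derivative f (at x) = frechet_derivative g (at x)"
      if "x \<in> S" for x
    proof -
      have "(g has_derivative frechet_derivative g (at x)) (at x)"
        using Suc.prems that frechet_derivative_works by auto
      then have "(f has_derivative frechet_derivative g (at x)) (at x)"
        by (rule has_derivative_transform_within_open[OF _ assms(1) that]) (simp add: Suc.prems)
      then show ?thesis
        using frechet_derivative_at differentiable_def by metis
    qed
    show ?case
      using d Suc.IH[of "\<lambda>x. frechet_derivative f (at x) v" "\<lambda>x. frechet_derivative g (at x) v" for v]
        Suc.prems(2) by simp
  qed
  show ?thesis using *[of f g] *[of g f] assms(2) by metis
qed

lemma Ck_on_subset: "Ck_on k S f \<Longrightarrow> T \<subseteq> S \<Longrightarrow> Ck_on k T f"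
  by (induction k arbitrary: f) (auto intro: continuous_on_subset)

lemma Ck_on_mono_Suc: "Ck_on (Suc k) S f \<Longrightarrow> Ck_on k S f"
proof (induction k arbitrary: f)
  case 0
  then show ?case
    by (auto intro!: differentiable_imp_continuous_on differentiable_at_imp_differentiable_on)
next
  case (Suc k)
  then show ?case
    unfolding Ck_on.simps(2)[of "Suc k"] Ck_on.simps(2)[of k S f] using Suc.IH by blast
qed

lemma Ck_on_const: "Ck_on k S (\<lambda>x. c)"
  by (induction k arbitrary: c) auto

text \<open>Lets smoothness proofs use the derivative that the differentiation rules produce; on the
  open set it agrees with the one chosen by \<open>frechet_derivative\<close>.\<close>

lemma Ck_on_derivI:
  assumes "open S" "\<And>x. x \<in> S \<Longrightarrow> (f has_derivative f' x) (at x)"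
    and "\<And>v. Ck_on k S (\<lambda>x. f' x v)"
  shows "Ck_on (Suc k) S f"
proof -
  have "frechet_derivative f (at x) = f' x" if "x \<in> S" for x
    using assms(2)[OF that] frechet_derivative_at by metis
  then have "Ck_on k S (\<lambda>x. frechet_derivative f (at x) v)" for v
    using assms(3)[of v] by (subst Ck_on_cong[OF assms(1)]) auto
  then show ?thesis
    using assms(2) by (auto simp: differentiable_def)
qed

lemma Ck_on_has_derivative:
  "Ck_on (Suc k) S f \<Longrightarrow> x \<in> S \<Longrightarrow> (f has_derivative frechet_derivative f (at x)) (at x)"
  using frechet_derivative_works by auto

lemma Ck_on_linear_comp:
  assumes "open S" "bounded_linear L" "Ck_on k S f"
  shows "Ck_on k S (\<lambda>x. L (f x))"
  using assms(3)
proof (induction k arbitrary: f)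
  case 0
  then show ?case using assms(2) by (auto intro: bounded_linear.continuous_on)
next
  case (Suc k)
  show ?case
    by (rule Ck_on_derivI[OF assms(1)
          bounded_linear.has_derivative[OF assms(2) Ck_on_has_derivative[OF Suc.prems]]])
      (use Suc in auto)
qed

lemma Ck_on_linear:
  assumes "open S" "bounded_linear L"
  shows "Ck_on k S L"
proof (cases k)
  case 0
  then show ?thesis using assms(2) by (simp add: linear_continuous_on)
next
  case (Suc j)
  show ?thesis unfolding Suc
    by (rule Ck_on_derivI[OF assms(1) bounded_linear_imp_has_derivative[OF assms(2)] Ck_on_const])
qed

lemma Ck_on_add:
  assumes "open S" "Ck_on k S f" "Ck_on k S g"
  shows "Ck_on k S (\<lambda>x. f x + g x)"
  using assms(2,3)
proof (induction k arbitrary: f g)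
  case 0
  then show ?case by (auto intro: continuous_on_add)
next
  case (Suc k)
  show ?case
    by (rule Ck_on_derivI[OF assms(1) has_derivative_add[OF Ck_on_has_derivative[OF Suc.prems(1)]
            Ck_on_has_derivative[OF Suc.prems(2)]]])
      (use Suc in auto)
qed

lemma Ck_on_mult:
  fixes f g :: "'a::euclidean_space \<Rightarrow> real"
  assumes "open S" "Ck_on k S f" "Ck_on k S g"
  shows "Ck_on k S (\<lambda>x. f x * g x)"
  using assms(2,3)
proof (induction k arbitrary: f g)
  case 0
  then show ?case by (auto intro: continuous_on_mult)
next
  case (Suc k)
  show ?case
    by (rule Ck_on_derivI[OF assms(1) has_derivative_mult[OF Ck_on_has_derivative[OF Suc.prems(1)]
            Ck_on_has_derivative[OF Suc.prems(2)]]])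
      (use Suc.prems in \<open>auto intro!: Ck_on_add[OF assms(1)] Suc.IH
        Ck_on_mono_Suc[OF Suc.prems(1)] Ck_on_mono_Suc[OF Suc.prems(2)]\<close>)
qed

text \<open>Since g acts on real numbers, the chain rule is a product of the derivative of g along f
  with that of f. The induction runs over all g, because the derivative of g takes its place in the
  next step.\<close>

lemma Ck_on_compose:
  fixes g :: "real \<Rightarrow> real"
  assumes "open S" "open U" "smooth_on U g" "Ck_on k S f" "f ` S \<subseteq> U"
  shows "Ck_on k S (\<lambda>x. g (f x))"
  using assms(3,4)
proof (induction k arbitrary: g)
  case 0
  then have "Ck_on 0 U g" by (simp only: smooth_on_def)
  then show ?case using 0 assms(5) by (auto intro!: continuous_on_compose2[of U g])
next
  case (Suc k)
  have g1: "Ck_on (Suc 0) U g" using Suc.prems(1) by (simp only: smooth_on_def)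
  have d: "((\<lambda>x. g (f x)) has_derivative
      (\<lambda>v. frechet_derivative g (at (f x)) 1 * frechet_derivative f (at x) v)) (at x)"
    if "x \<in> S" for x
  proof -
    have gd: "(g has_derivative frechet_derivative g (at (f x))) (at (f x))"
      using Ck_on_has_derivative[OF g1] that assms(5) by blast
    have "linear (frechet_derivative g (at (f x)))"
      using gd has_derivative_linear by blast
    then have l: "frechet_derivative g (at (f x)) y = frechet_derivative g (at (f x)) 1 * y" for y
      using linear_scale[of "frechet_derivative g (at (f x))" y 1] by (simp add: mult.commute)
    show ?thesis
      using has_derivative_compose[OF Ck_on_has_derivative[OF Suc.prems(2) that] gd] l
      by (subst l[symmetric])
  qed
  have "Ck_on j U (\<lambda>x. frechet_derivative g (at x) 1)" for j
    using Suc.prems(1) unfolding smooth_on_def by (metis Ck_on.simps(2))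
  then have sm: "smooth_on U (\<lambda>x. frechet_derivative g (at x) 1)"
    by (simp add: smooth_on_def)
  show ?case
    by (rule Ck_on_derivI[OF assms(1) d])
      (use Suc sm Ck_on_mono_Suc[OF Suc.prems(2)] in \<open>auto intro!: Ck_on_mult[OF assms(1)] Suc.IH\<close>)
qed

lemma smooth_onD: "smooth_on S f \<Longrightarrow> Ck_on k S f"
  by (simp add: smooth_on_def)

lemma smooth_on_frechet:
  "smooth_on S f \<Longrightarrow> smooth_on S (\<lambda>x. frechet_derivative f (at x) v)"
  unfolding smooth_on_def by (metis Ck_on.simps(2))

lemma smooth_on_has_derivative:
  "smooth_on S f \<Longrightarrow> x \<in> S \<Longrightarrow> (f has_derivative frechet_derivative f (at x)) (at x)"
  using Ck_on_has_derivative smooth_onD by blast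

lemma smooth_on_continuous_on: "smooth_on S f \<Longrightarrow> continuous_on S f"
  using smooth_onD[of S f 0] by simp

text \<open>A family closed under differentiation consists of smooth functions; this covers exp, the
  alternating pair cosh and sinh, and the series \<open>cosh_sqrt k\<close>.\<close>

lemma smooth_on_real_sequence:
  fixes g :: "nat \<Rightarrow> real \<Rightarrow> real"
  assumes "open U" "\<And>k x. x \<in> U \<Longrightarrow> (g k has_real_derivative g (Suc k) x) (at x)"
  shows "smooth_on U (g j)"
proof -
  have "Ck_on k U (g j)" for k
  proof (induction k arbitrary: j)
    case 0
    show ?case using assms(2)[of _ j]
      by (auto intro!: DERIV_atLeastAtMost_imp_continuous_on continuous_at_imp_continuous_on
          DERIV_isCont)
  next
    case (Suc k)
    show ?case
      by (rule Ck_on_derivI[OF assms(1) assms(2)[unfolded has_field_derivative_def]])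
        (auto intro!: Ck_on_mult[OF assms(1)] Ck_on_const Suc.IH)
  qed
  then show ?thesis by (simp add: smooth_on_def)
qed

text \<open>Equality of mixed partial derivatives: both are the limit of the second difference
  \<open>f (x + s v + s w) - f (x + s v) - f (x + s w) + f x\<close> divided by \<open>s\<^sup>2\<close>.\<close>

lemma second_difference_mean_value:
  fixes f :: "'a::euclidean_space \<Rightarrow> real"
  assumes "smooth_on (ball x r) f" "r > 0" "s > 0" "s * (norm v + norm w) < r"
  obtains a b where "0 < a" "a < s" "0 < b" "b < s"
    "f (x + s *\<^sub>R v + s *\<^sub>R w) - f (x + s *\<^sub>R v) - f (x + s *\<^sub>R w) + f x =
      s\<^sup>2 * frechet_derivative (\<lambda>y. frechet_derivative f (at y) v) (at (x + a *\<^sub>R v + b *\<^sub>R w)) w"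
proof -
  define D where "D = (\<lambda>y. frechet_derivative f (at y) v)"
  have inb: "x + a *\<^sub>R v + b *\<^sub>R w \<in> ball x r" if "0 \<le> a" "a \<le> s" "0 \<le> b" "b \<le> s" for a b
  proof -
    have "norm (a *\<^sub>R v + b *\<^sub>R w) \<le> a * norm v + b * norm w"
      using norm_triangle_ineq[of "a *\<^sub>R v" "b *\<^sub>R w"] that by simp
    also have "\<dots> \<le> s * norm v + s * norm w"
      using that by (intro add_mono mult_right_mono) auto
    also have "\<dots> < r" using assms by (simp add: algebra_simps)
    finally have "dist (x + a *\<^sub>R v + b *\<^sub>R w) x < r" by (simp add: dist_norm add.assoc)
    then show ?thesis by (simp only: mem_ball dist_commute)
  qed
  have f': "((\<lambda>a. f (x + a *\<^sub>R v + b *\<^sub>R w)) has_real_derivative D (x + a *\<^sub>R v + b *\<^sub>R w)) (at a)"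
    if "0 \<le> a" "a \<le> s" "0 \<le> b" "b \<le> s" for a b
  proof -
    have *: "((\<lambda>a. x + a *\<^sub>R v + b *\<^sub>R w) has_derivative (\<lambda>h. h *\<^sub>R v)) (at a)"
      by (auto intro!: derivative_eq_intros)
    note fd = smooth_on_has_derivative[OF assms(1) inb[OF that]]
    have "linear (frechet_derivative f (at (x + a *\<^sub>R v + b *\<^sub>R w)))"
      using fd has_derivative_linear by blast
    then have "frechet_derivative f (at (x + a *\<^sub>R v + b *\<^sub>R w)) (h *\<^sub>R v) = D (x + a *\<^sub>R v + b *\<^sub>R w) * h" for h
      by (simp add: linear_scale D_def)
    then show ?thesis
      using has_derivative_compose[OF * fd] by (simp add: has_field_derivative_def)
  qed
  have D': "((\<lambda>b. D (x + a *\<^sub>R v + b *\<^sub>R w)) has_real_derivative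
      frechet_derivative D (at (x + a *\<^sub>R v + b *\<^sub>R w)) w) (at b)"
    if "0 \<le> a" "a \<le> s" "0 \<le> b" "b \<le> s" for a b
  proof -
    have *: "((\<lambda>b. x + a *\<^sub>R v + b *\<^sub>R w) has_derivative (\<lambda>h. h *\<^sub>R w)) (at b)"
      by (auto intro!: derivative_eq_intros)
    have "smooth_on (ball x r) D" unfolding D_def by (rule smooth_on_frechet[OF assms(1)])
    note fd = smooth_on_has_derivative[OF this inb[OF that]]
    have "linear (frechet_derivative D (at (x + a *\<^sub>R v + b *\<^sub>R w)))"
      using fd has_derivative_linear by blast
    then have "frechet_derivative D (at (x + a *\<^sub>R v + b *\<^sub>R w)) (h *\<^sub>R w)
        = frechet_derivative D (at (x + a *\<^sub>R v + b *\<^sub>R w)) w * h" for h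
      by (simp add: linear_scale)
    then show ?thesis
      using has_derivative_compose[OF * fd] by (simp add: has_field_derivative_def)
  qed
  \<comment> \<open>Mean value theorem along v for the increment along w; the next application
    treats the increment of \<open>D\<close> along w. The zero multiples keep both ends in the form
    of \<open>f'\<close>.\<close>
  have "\<exists>a. 0 < a \<and> a < s \<and>
      (f (x + s *\<^sub>R v + s *\<^sub>R w) - f (x + s *\<^sub>R v + 0 *\<^sub>R w)) - (f (x + 0 *\<^sub>R v + s *\<^sub>R w) - f (x + 0 *\<^sub>R v + 0 *\<^sub>R w))
      = (s - 0) * (D (x + a *\<^sub>R v + s *\<^sub>R w) - D (x + a *\<^sub>R v + 0 *\<^sub>R w))"
    by (rule MVT2[OF assms(3)]) (intro DERIV_diff f'; use assms(3) in linarith)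
  then obtain a where a: "0 < a" "a < s"
      "f (x + s *\<^sub>R v + s *\<^sub>R w) - f (x + s *\<^sub>R v) - f (x + s *\<^sub>R w) + f x
      = s * (D (x + a *\<^sub>R v + s *\<^sub>R w) - D (x + a *\<^sub>R v))"
    by auto
  have "\<exists>b. 0 < b \<and> b < s \<and> D (x + a *\<^sub>R v + s *\<^sub>R w) - D (x + a *\<^sub>R v + 0 *\<^sub>R w)
      = (s - 0) * frechet_derivative D (at (x + a *\<^sub>R v + b *\<^sub>R w)) w"
    by (rule MVT2[OF assms(3)]) (use a in \<open>auto intro!: D'\<close>)
  then obtain b where "0 < b" "b < s" "D (x + a *\<^sub>R v + s *\<^sub>R w) - D (x + a *\<^sub>R v)
      = s * frechet_derivative D (at (x + a *\<^sub>R v + b *\<^sub>R w)) w"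
    by auto
  then show thesis using that[of a b] a by (simp add: D_def power2_eq_square)
qed

lemma frechet_derivative_commute:
  fixes f :: "'a::euclidean_space \<Rightarrow> real"
  assumes "open S" "smooth_on S f" "x \<in> S"
  shows "frechet_derivative (\<lambda>y. frechet_derivative f (at y) v) (at x) w =
    frechet_derivative (\<lambda>y. frechet_derivative f (at y) w) (at x) v"
proof -
  obtain r where r: "r > 0" "ball x r \<subseteq> S" using assms openE by blast
  have sm: "smooth_on (ball x r) f"
    using assms(2) r(2) Ck_on_subset unfolding smooth_on_def by blast
  define Q where "Q = (\<lambda>s. f (x + s *\<^sub>R v + s *\<^sub>R w) - f (x + s *\<^sub>R v) - f (x + s *\<^sub>R w) + f x)"
  have lim: "((\<lambda>s. Q s / s\<^sup>2) \<longlongrightarrow> frechet_derivative (\<lambda>y. frechet_derivative f (at y) v) (at x) w)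
      (at_right 0)"
    if Q: "\<And>s. Q s = f (x + s *\<^sub>R v + s *\<^sub>R w) - f (x + s *\<^sub>R v) - f (x + s *\<^sub>R w) + f x" for v w
  proof (rule tendstoI)
    fix e :: real assume e: "e > 0"
    define E where "E = (\<lambda>y. frechet_derivative (\<lambda>y. frechet_derivative f (at y) v) (at y) w)"
    have "continuous_on (ball x r) E"
      unfolding E_def by (intro smooth_on_continuous_on smooth_on_frechet sm)
    then have "isCont E x" using r by (simp add: continuous_on_eq_continuous_at)
    then obtain d where d: "d > 0" "\<And>y. dist y x < d \<Longrightarrow> dist (E y) (E x) < e"
      using e unfolding continuous_at_eps_delta by blast
    define K where "K = norm v + norm w + 1"
    have K: "K > 0" unfolding K_def by (simp add: add_nonneg_pos)
    have "dist (Q s / s\<^sup>2) (E x) < e" if s: "0 < s" "s < min d r / K" for s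
    proof -
      have sK: "s * K < d" "s * K < r" using s K by (simp_all add: field_simps)
      have "s * (norm v + norm w) < s * K" using s by (simp add: K_def)
      then have "s * (norm v + norm w) < r" using sK by linarith
      from second_difference_mean_value[OF sm r(1) s(1) this]
      obtain a b where ab: "0 < a" "a < s" "0 < b" "b < s" "Q s = s\<^sup>2 * E (x + a *\<^sub>R v + b *\<^sub>R w)"
        unfolding Q[symmetric] E_def by blast
      have "norm (a *\<^sub>R v + b *\<^sub>R w) \<le> a * norm v + b * norm w"
        using norm_triangle_ineq[of "a *\<^sub>R v" "b *\<^sub>R w"] ab by simp
      also have "\<dots> \<le> s * norm v + s * norm w"
        using ab by (intro add_mono mult_right_mono) auto
      also have "\<dots> < d" using sK(1) s by (simp add: K_def algebra_simps)
      finally have "dist (x + a *\<^sub>R v + b *\<^sub>R w) x < d" by (simp add: dist_norm add.assoc)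
      then show ?thesis using d(2) ab s by simp
    qed
    then show "\<forall>\<^sub>F s in at_right 0. dist (Q s / s\<^sup>2) (frechet_derivative (\<lambda>y. frechet_derivative f (at y) v) (at x) w) < e"
      using d(1) r(1) K unfolding eventually_at_right_field E_def
      by (intro exI[of _ "min d r / K"]) auto
  qed
  \<comment> \<open>\<open>Q\<close> is symmetric in v and w, so \<open>lim\<close> applies to it
    with v and w in either order.\<close>
  have "Q s = f (x + s *\<^sub>R w + s *\<^sub>R v) - f (x + s *\<^sub>R w) - f (x + s *\<^sub>R v) + f x" for s
    by (simp add: Q_def algebra_simps)
  from tendsto_unique[OF _ lim[OF Q_def[THEN fun_cong]] lim[OF this]] show ?thesis by simp
qed

section \<open>The ring of smooth functions on the cylinder\<close>

abbreviation hyp_cylinder :: "((real ^ 'n::finite) \<times> real) set" where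
  "hyp_cylinder \<equiv> hyp_space \<times> UNIV"

lemma open_hyp_cylinder: "open (hyp_cylinder :: ((real ^ 'n::finite) \<times> real) set)"
  by (simp add: hyp_space_def open_Times)

text \<open>Normalising functions to \<open>0\<close> off the cylinder turns equality there into equality of
  functions, so that the smooth functions form a ring type with derivations.\<close>

typedef ('n::finite) smooth_fun =
  "{f :: (real ^ 'n) \<times> real \<Rightarrow> real. smooth_on hyp_cylinder f \<and> (\<forall>z. z \<notin> hyp_cylinder \<longrightarrow> f z = 0)}"
  morphisms ev Abs_smooth_fun
  by (rule exI[of _ "\<lambda>_. 0"]) (simp add: smooth_on_def Ck_on_const)

definition restr :: "((real ^ 'n::finite) \<times> real \<Rightarrow> real) \<Rightarrow> 'n smooth_fun" where
  "restr f = Abs_smooth_fun (\<lambda>z. if z \<in> hyp_cylinder then f z else 0)"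

lemma smooth_ev: "smooth_on hyp_cylinder (ev f)"
  and ev_outside: "z \<notin> hyp_cylinder \<Longrightarrow> ev f z = 0"
  using ev[of f, unfolded mem_Collect_eq] by blast+

lemma ev_restr:
  assumes "smooth_on hyp_cylinder f"
  shows "ev (restr f) z = (if z \<in> hyp_cylinder then f z else 0)"
proof -
  have "smooth_on hyp_cylinder (\<lambda>z. if z \<in> hyp_cylinder then f z else 0)"
    using assms unfolding smooth_on_def
    by (subst Ck_on_cong[OF open_hyp_cylinder, where g=f]) auto
  then show ?thesis unfolding restr_def by (subst Abs_smooth_fun_inverse) auto
qed

lemma smooth_fun_eqI:
  assumes "\<And>z. z \<in> hyp_cylinder \<Longrightarrow> ev f z = ev g z"
  shows "f = g"
proof -
  have "ev f z = ev g z" for z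
    using assms ev_outside by metis
  then show ?thesis by (simp add: ev_inject[symmetric] ext)
qed

lemma smooth_on_const: "smooth_on S (\<lambda>x. c)"
  by (simp add: smooth_on_def Ck_on_const)

lemma smooth_on_add: "open S \<Longrightarrow> smooth_on S f \<Longrightarrow> smooth_on S g \<Longrightarrow> smooth_on S (\<lambda>x. f x + g x)"
  by (simp add: smooth_on_def Ck_on_add)

lemma smooth_on_mult:
  fixes f g :: "'a::euclidean_space \<Rightarrow> real"
  shows "open S \<Longrightarrow> smooth_on S f \<Longrightarrow> smooth_on S g \<Longrightarrow> smooth_on S (\<lambda>x. f x * g x)"
  by (simp add: smooth_on_def Ck_on_mult)

lemma smooth_on_linear: "open S \<Longrightarrow> bounded_linear L \<Longrightarrow> smooth_on S L"
  by (simp add: smooth_on_def Ck_on_linear)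

lemma smooth_on_linear_comp:
  "open S \<Longrightarrow> bounded_linear L \<Longrightarrow> smooth_on S f \<Longrightarrow> smooth_on S (\<lambda>x. L (f x))"
  by (simp add: smooth_on_def Ck_on_linear_comp)

lemma smooth_on_compose:
  fixes g :: "real \<Rightarrow> real"
  shows "open S \<Longrightarrow> open U \<Longrightarrow> smooth_on U g \<Longrightarrow> smooth_on S f \<Longrightarrow> f ` S \<subseteq> U \<Longrightarrow>
    smooth_on S (\<lambda>x. g (f x))"
  unfolding smooth_on_def[of S] using Ck_on_compose by blast

definition const :: "real \<Rightarrow> ('n::finite) smooth_fun" where
  "const c = restr (\<lambda>_. c)"

instantiation smooth_fun :: (finite) comm_ring_1
begin

definition "0 = const 0"
definition "1 = const 1"
definition "f + g = restr (\<lambda>z. ev f z + ev g z)"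
definition "f * g = restr (\<lambda>z. ev f z * ev g z)"
text \<open>The factor - 1 makes smoothness of negatives and differences an instance of closure
  under products.\<close>

definition "- f = restr (\<lambda>z. - 1 * ev f z)"
definition "f - g = restr (\<lambda>z. ev f z + - 1 * ev g z)" for f g :: "'a smooth_fun"

lemma ev_const': "ev (const c) z = (if z \<in> hyp_cylinder then c else 0)"
  by (simp add: const_def ev_restr smooth_on_const)

lemma ev_ring:
  "ev (f + g) z = ev f z + ev g z"
  "ev (f * g) z = ev f z * ev g z"
  "ev (- f) z = - ev f z"
  "ev (f - g) z = ev f z - ev g z"
  "ev 0 z = 0"
  "z \<in> hyp_cylinder \<Longrightarrow> ev 1 z = 1"
proof -
  note add = smooth_on_add[OF open_hyp_cylinder] and mult = smooth_on_mult[OF open_hyp_cylinder]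
  have minus: "smooth_on hyp_cylinder (\<lambda>z. - 1 * ev f z)" for f :: "'a smooth_fun"
    by (rule mult[OF smooth_on_const smooth_ev])
  show "ev (f + g) z = ev f z + ev g z"
    unfolding plus_smooth_fun_def ev_restr[OF add[OF smooth_ev smooth_ev]] by (simp add: ev_outside)
  show "ev (f * g) z = ev f z * ev g z"
    unfolding times_smooth_fun_def ev_restr[OF mult[OF smooth_ev smooth_ev]] by (simp add: ev_outside)
  show "ev (- f) z = - ev f z"
    unfolding uminus_smooth_fun_def ev_restr[OF minus] by (simp add: ev_outside)
  show "ev (f - g) z = ev f z - ev g z"
    unfolding minus_smooth_fun_def ev_restr[OF add[OF smooth_ev minus]] by (simp add: ev_outside)
  show "ev 0 z = 0" "z \<in> hyp_cylinder \<Longrightarrow> ev 1 z = 1"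
    by (simp_all add: zero_smooth_fun_def one_smooth_fun_def ev_const')
qed

instance
proof
  fix a b c :: "'a smooth_fun"
  show "a * b * c = a * (b * c)" "a * b = b * a" "1 * a = a" "a + b + c = a + (b + c)"
    "a + b = b + a" "0 + a = a" "- a + a = 0" "a - b = a + - b" "(a + b) * c = a * c + b * c"
    by (rule smooth_fun_eqI; simp add: ev_ring algebra_simps)+
  have "ev (1 :: 'a smooth_fun) (0, 0) \<noteq> ev (0 :: 'a smooth_fun) (0, 0)"
    by (simp add: ev_ring hyp_space_def)
  then show "(0 :: 'a smooth_fun) \<noteq> 1" by metis
qed

end

lemma ev_const: "z \<in> hyp_cylinder \<Longrightarrow> ev (const c) z = c"
  by (simp add: ev_const')

lemma ev_numeral: "z \<in> hyp_cylinder \<Longrightarrow> ev (numeral k) z = numeral k"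
proof -
  assume z: "z \<in> hyp_cylinder"
  have "ev (of_nat m) z = of_nat m" for m
    by (induction m) (simp_all add: ev_ring z)
  from this[of "numeral k"] show ?thesis by simp
qed

lemma ev_power: "z \<in> hyp_cylinder \<Longrightarrow> ev (f ^ k) z = ev f z ^ k"
  by (induction k) (simp_all add: ev_ring)

lemma ev_sum: "ev (\<Sum>i\<in>I. f i) z = (\<Sum>i\<in>I. ev (f i) z)"
  by (induction I rule: infinite_finite_induct) (simp_all add: ev_ring)

lemmas ev_simps = ev_ring ev_const ev_numeral ev_power ev_sum

lemma const_ring:
  "const (a + b) = const a + const b" "const (a * b) = const a * const b"
  "const (- a) = - const a" "const (a - b) = const a - const b"
  "const 0 = 0" "const 1 = 1" "const (numeral k) = numeral k"
  by (auto intro!: smooth_fun_eqI simp: ev_simps)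

definition dv :: "(real ^ 'n) \<times> real \<Rightarrow> 'n smooth_fun \<Rightarrow> ('n::finite) smooth_fun" where
  "dv v f = restr (\<lambda>z. frechet_derivative (ev f) (at z) v)"

lemma ev_dv: "z \<in> hyp_cylinder \<Longrightarrow> ev (dv v f) z = frechet_derivative (ev f) (at z) v"
  unfolding dv_def by (simp add: ev_restr smooth_on_frechet[OF smooth_ev])

lemma ev_has_derivative:
  assumes "z \<in> hyp_cylinder"
  shows "(ev f has_derivative (\<lambda>v. ev (dv v f) z)) (at z)"
  using smooth_on_has_derivative[OF smooth_ev assms] by (simp add: ev_dv[OF assms])

text \<open>The bridge from analysis to the ring. The derivative is given in all directions at once
  because uniqueness holds for it as a linear map.\<close>

lemma dv_eqI:
  assumes "\<And>z. z \<in> hyp_cylinder \<Longrightarrow> (g has_derivative (\<lambda>v. ev (f' v) z)) (at z)"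
    and "\<And>z. z \<in> hyp_cylinder \<Longrightarrow> ev f z = g z"
  shows "dv v f = f' v"
proof (rule smooth_fun_eqI)
  fix z :: "(real ^ 'a) \<times> real" assume z: "z \<in> hyp_cylinder"
  have "(ev f has_derivative (\<lambda>v. ev (f' v) z)) (at z)"
    by (rule has_derivative_transform_within_open[OF assms(1)[OF z] open_hyp_cylinder z])
      (simp only: assms(2))
  then show "ev (dv v f) z = ev (f' v) z"
    unfolding ev_dv[OF z] using frechet_derivative_at by metis
qed

lemma dv_add: "dv v (f + g) = dv v f + dv v g"
  by (rule dv_eqI[where f' = "\<lambda>v. dv v f + dv v g"])
    (auto simp: ev_ring intro!: has_derivative_add ev_has_derivative)

lemma dv_mult: "dv v (f * g) = dv v f * g + f * dv v g"
  by (rule dv_eqI[where f' = "\<lambda>v. dv v f * g + f * dv v g"])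
    (auto simp: ev_ring intro!: derivative_eq_intros ev_has_derivative)

lemma dv_const: "dv v (const c) = 0"
  by (rule dv_eqI[where f' = "\<lambda>v. 0" and g = "\<lambda>_. c"]) (simp_all add: ev_const ev_ring)

lemma dv_zero: "dv v 0 = 0" and dv_one: "dv v 1 = 0" and dv_numeral: "dv v (numeral k) = 0"
  using dv_const[of v 0] dv_const[of v 1] dv_const[of v "numeral k"] by (simp_all add: const_ring)

lemma dv_minus: "dv v (- f) = - dv v f"
  by (rule minus_unique[symmetric]) (simp add: dv_add[symmetric] dv_zero)

lemma dv_diff: "dv v (f - g) = dv v f - dv v g"
  using dv_add[of v f "- g"] by (simp add: dv_minus)

lemma dv_sum: "dv v (\<Sum>i\<in>I. f i) = (\<Sum>i\<in>I. dv v (f i))"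
  by (induction I rule: infinite_finite_induct) (simp_all add: dv_zero dv_add)

lemma dv_commute: "dv v (dv w f) = dv w (dv v f)"
proof (rule smooth_fun_eqI)
  fix z :: "(real ^ 'a) \<times> real" assume z: "z \<in> hyp_cylinder"
  have *: "ev (dv v (dv w f)) z =
      frechet_derivative (\<lambda>y. frechet_derivative (ev f) (at y) w) (at z) v" for v w
  proof -
    have "ev (dv w f) differentiable at z"
      using ev_has_derivative[OF z] by (rule differentiableI)
    from frechet_derivative_transform_within_open[OF this open_hyp_cylinder z ev_dv]
    show ?thesis unfolding ev_dv[OF z] by simp
  qed
  show "ev (dv v (dv w f)) z = ev (dv w (dv v f)) z"
    unfolding * by (rule frechet_derivative_commute[OF open_hyp_cylinder smooth_ev z])
qed

definition fcomp :: "(real \<Rightarrow> real) \<Rightarrow> ('n::finite) smooth_fun \<Rightarrow> 'n smooth_fun" where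
  "fcomp g f = restr (\<lambda>z. g (ev f z))"

lemma ev_fcomp:
  assumes "open U" "smooth_on U g" "\<And>z. z \<in> hyp_cylinder \<Longrightarrow> ev f z \<in> U" "z \<in> hyp_cylinder"
  shows "ev (fcomp g f) z = g (ev f z)"
proof -
  have "smooth_on hyp_cylinder (\<lambda>z. g (ev f z))"
    by (rule smooth_on_compose[OF open_hyp_cylinder assms(1,2) smooth_ev]) (use assms(3) in blast)
  then show ?thesis unfolding fcomp_def by (simp only: ev_restr assms(4) if_True)
qed

lemma dv_fcomp:
  assumes "open U" "smooth_on U g" "smooth_on U g'" "\<And>z. z \<in> hyp_cylinder \<Longrightarrow> ev f z \<in> U"
    and "\<And>x. x \<in> U \<Longrightarrow> (g has_real_derivative g' x) (at x)"
  shows "dv v (fcomp g f) = fcomp g' f * dv v f"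
proof (rule dv_eqI[where f' = "\<lambda>v. fcomp g' f * dv v f" and g = "\<lambda>z. g (ev f z)"])
  fix z :: "(real ^ 'a) \<times> real" assume z: "z \<in> hyp_cylinder"
  show "((\<lambda>z. g (ev f z)) has_derivative (\<lambda>v. ev (fcomp g' f * dv v f) z)) (at z)"
    using has_derivative_compose[OF ev_has_derivative[OF z]
        assms(5)[OF assms(4)[OF z], unfolded has_field_derivative_def]]
    by (simp add: ev_ring ev_fcomp[OF assms(1,3,4) z])
  show "ev (fcomp g f) z = g (ev f z)"
    by (rule ev_fcomp[OF assms(1,2,4) z])
qed

lemma dv_linear:
  assumes "bounded_linear L"
  shows "dv v (restr L) = const (L v)"
proof (rule dv_eqI[where f' = "\<lambda>v. const (L v)" and g = L])
  fix z :: "(real ^ 'a) \<times> real" assume z: "z \<in> hyp_cylinder"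
  show "(L has_derivative (\<lambda>v. ev (const (L v)) z)) (at z)"
    using bounded_linear_imp_has_derivative[OF assms] by (simp only: ev_const[OF z])
  show "ev (restr L) z = L z"
    by (simp only: ev_restr[OF smooth_on_linear[OF open_hyp_cylinder assms]] z if_True)
qed

definition coord :: "'n \<Rightarrow> ('n::finite) smooth_fun" where
  "coord i = restr (\<lambda>z. fst z $ i)"

definition time :: "('n::finite) smooth_fun" where
  "time = restr snd"

abbreviation di :: "'n \<Rightarrow> 'n smooth_fun \<Rightarrow> ('n::finite) smooth_fun" where
  "di i \<equiv> dv (axis i 1, 0)"

abbreviation dt :: "'n smooth_fun \<Rightarrow> ('n::finite) smooth_fun" where
  "dt \<equiv> dv (0, 1)"

lemma bounded_linear_coord: "bounded_linear (\<lambda>z :: (real ^ 'n::finite) \<times> real. fst z $ i)"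
  by (rule bounded_linear_compose[OF bounded_linear_vec_nth bounded_linear_fst])

lemma ev_coord: "z \<in> hyp_cylinder \<Longrightarrow> ev (coord i) z = fst z $ i"
  unfolding coord_def
  by (simp add: ev_restr smooth_on_linear[OF open_hyp_cylinder bounded_linear_coord])

lemma ev_time: "z \<in> hyp_cylinder \<Longrightarrow> ev time z = snd z"
  unfolding time_def
  by (simp add: ev_restr smooth_on_linear[OF open_hyp_cylinder bounded_linear_snd])

lemma dv_coord: "di i (coord j) = (if i = j then 1 else 0)" "dt (coord j) = 0"
  unfolding coord_def dv_linear[OF bounded_linear_coord] by (auto simp: const_ring axis_def)

lemma dv_time: "di i time = 0" "dt time = 1"
  unfolding time_def dv_linear[OF bounded_linear_snd] by (auto simp: const_ring)

lemmas dv_simps = dv_add dv_mult dv_diff dv_minus dv_sum dv_const dv_zero dv_one dv_numeral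
  dv_coord dv_time

section \<open>The conformal factor\<close>

definition hN :: "('n::finite) smooth_fun" where
  "hN = 1 - (\<Sum>i\<in>UNIV. coord i * coord i)"

definition hM :: "('n::finite) smooth_fun" where
  "hM = fcomp inverse hN"

text \<open>The coefficient of the inverse metric: g^ij is \<open>hb\<close> times the Kronecker
  delta.\<close>

definition hb :: "('n::finite) smooth_fun" where
  "hb = (const (1/2) * hN) * (const (1/2) * hN)"

lemma half_double: "const (1/2) + const (1/2) = (1 :: ('n::finite) smooth_fun)"
  by (rule smooth_fun_eqI) (simp add: ev_simps)

lemma ev_hN: "z \<in> hyp_cylinder \<Longrightarrow> ev hN z = 1 - (norm (fst z))\<^sup>2"
  by (simp add: hN_def ev_simps ev_coord power2_norm_eq_inner inner_vec_def)

lemma hN_pos: "z \<in> hyp_cylinder \<Longrightarrow> ev hN z > 0"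
  by (auto simp: ev_hN hyp_space_def abs_square_less_1)

lemma smooth_on_inverse: "smooth_on {0<..} (inverse :: real \<Rightarrow> real)"
proof -
  have "Ck_on k {0<..} (inverse :: real \<Rightarrow> real)" for k
  proof (induction k)
    case 0
    show ?case by (auto intro!: continuous_intros)
  next
    case (Suc k)
    show ?case
    proof (rule Ck_on_derivI)
      show "(inverse has_derivative (\<lambda>v. (- 1) * (inverse x * inverse x) * v)) (at x)"
        if "x \<in> {0<..}" for x :: real
        using that by (auto intro!: derivative_eq_intros)
      show "Ck_on k {0<..} (\<lambda>x. (- 1) * (inverse x * inverse x) * v)" for v :: real
        by (intro Ck_on_mult Ck_on_const Suc open_greaterThan)
    qed (rule open_greaterThan)
  qed
  then show ?thesis by (simp add: smooth_on_def)
qed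

lemma ev_hM: "z \<in> hyp_cylinder \<Longrightarrow> ev hM z = inverse (ev hN z)"
  unfolding hM_def by (rule ev_fcomp[OF open_greaterThan smooth_on_inverse]) (auto intro: hN_pos)

lemma hN_hM: "hN * hM = (1 :: ('n::finite) smooth_fun)"
proof (rule smooth_fun_eqI)
  fix z :: "(real ^ 'n) \<times> real" assume z: "z \<in> hyp_cylinder"
  show "ev (hN * hM) z = ev 1 z" using hN_pos[OF z] by (simp add: ev_ring ev_hM z)
qed

lemma di_hN: "di i hN = - 2 * coord i"
proof -
  have "(\<Sum>j\<in>UNIV. (if i = j then 1 else 0) * coord j + coord j * (if i = j then 1 else 0))
      = (\<Sum>j\<in>UNIV. if i = j then 2 * coord j else 0)"
    by (intro sum.cong) auto
  then show ?thesis by (simp add: hN_def dv_simps)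
qed

lemma dt_hN: "dt hN = 0"
  by (simp add: hN_def dv_simps)

lemma di_hM: "di i hM = 2 * hM * hM * coord i"
proof -
  have "di i (hN * hM) = 0" by (simp add: hN_hM dv_one)
  \<comment> \<open>The ring has no division, so the differentiated relation
    \<open>hN * hM = 1\<close> is multiplied by \<open>hM\<close> and solved for the
    derivative.\<close>
  then have "hM * (- 2 * coord i * hM + hN * di i hM) = 0" by (simp add: dv_mult di_hN)
  then have "- 2 * hM * hM * coord i + (hN * hM) * di i hM = 0" by (simp add: algebra_simps)
  then show ?thesis by (simp add: hN_hM)
qed

lemma dt_hM: "dt hM = 0"
proof -
  have "hM * dt (hN * hM) = 0" by (simp add: hN_hM dv_one)
  then have "(hN * hM) * dt hM = 0" by (simp add: dv_mult dt_hN algebra_simps)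
  then show ?thesis by (simp add: hN_hM)
qed

lemma di_hb: "di i hb = - hN * coord i"
proof -
  have "di i hb = (const (1/2) + const (1/2)) * (const (1/2) + const (1/2)) * (- hN * coord i)"
    unfolding hb_def by (simp add: dv_simps di_hN algebra_simps)
  then show ?thesis by (simp add: half_double)
qed

lemma dt_hb: "dt hb = 0"
  by (simp add: hb_def dv_simps dt_hN)

section \<open>Gradient product and Laplacian\<close>

text \<open>The radial field; it will turn out to be the gradient of \<open>hX0\<close>.\<close>

definition Eul :: "'n smooth_fun \<Rightarrow> ('n::finite) smooth_fun" where
  "Eul u = (\<Sum>i\<in>UNIV. coord i * di i u)"

text \<open>The product of gradients in the hyperbolic metric, the carre du champ of
  \<open>Lap\<close>.\<close>

definition Gam :: "'n smooth_fun \<Rightarrow> 'n smooth_fun \<Rightarrow> ('n::finite) smooth_fun" where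
  "Gam u v = hb * (\<Sum>i\<in>UNIV. di i u * di i v)"

text \<open>The Laplace-Beltrami operator in expanded form. Differentiating the weight sqrt (det g)
  g^ii = (2 / N)^(n - 2), with N = 1 - |x|^2, produces the first-order term.\<close>

definition Lap :: "'n smooth_fun \<Rightarrow> ('n::finite) smooth_fun" where
  "Lap u = hb * (\<Sum>i\<in>UNIV. di i (di i u)) + const ((real CARD('n) - 2) / 2) * hN * Eul u"

lemma Eul_derivation:
  "Eul (u + v) = Eul u + Eul v" "Eul (u - v) = Eul u - Eul v" "Eul (u * v) = Eul u * v + u * Eul v"
  "Eul (const c) = 0" "Eul 1 = 0" "Eul (numeral k) = 0" "Eul (- u) = - Eul u"
  by (simp_all add: Eul_def dv_simps algebra_simps sum.distrib sum_distrib_left sum_distrib_right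
      sum_subtractf sum_negf)

lemma Eul_sum: "Eul (\<Sum>i\<in>I. f i) = (\<Sum>i\<in>I. Eul (f i))"
  by (induction I rule: infinite_finite_induct)
    (simp_all add: Eul_derivation Eul_def[of 0] dv_zero)

lemma Gam_commute: "Gam u v = Gam v u"
  by (simp add: Gam_def mult.commute)

lemma Gam_right:
  "Gam w (u + v) = Gam w u + Gam w v" "Gam w (u - v) = Gam w u - Gam w v"
  "Gam w (u * v) = u * Gam w v + v * Gam w u" "Gam w (const c) = 0" "Gam w 1 = 0"
  "Gam w (numeral k) = 0" "Gam w (- u) = - Gam w u" "Gam w 0 = 0"
  by (simp_all add: Gam_def dv_simps algebra_simps sum.distrib sum_distrib_left sum_subtractf sum_negf)


lemma Gam_left:
  "Gam (u + v) w = Gam u w + Gam v w" "Gam (u - v) w = Gam u w - Gam v w"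
  "Gam (u * v) w = u * Gam v w + v * Gam u w" "Gam (const c) w = 0" "Gam 1 w = 0"
  "Gam (numeral k) w = 0" "Gam (- u) w = - Gam u w" "Gam 0 w = 0"
  by (simp_all only: Gam_commute[of _ w] Gam_right)

lemmas Gam_simps = Gam_left Gam_right

lemma Lap_simps:
  "Lap (u + v) = Lap u + Lap v" "Lap (u - v) = Lap u - Lap v" "Lap (- u) = - Lap u"
  "Lap (u * v) = u * Lap v + v * Lap u + 2 * Gam u v" "Lap (const c) = 0" "Lap 1 = 0"
  "Lap (numeral k) = 0" "Lap 0 = 0"
  by (simp_all add: Lap_def Gam_def Eul_def dv_simps algebra_simps sum.distrib sum_distrib_left
      sum_subtractf sum_negf)

lemma dt_Eul: "dt (Eul u) = Eul (dt u)"
  by (simp add: Eul_def dv_simps dv_commute[of "(0, 1)"])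

lemma dt_Gam: "dt (Gam u v) = Gam (dt u) v + Gam u (dt v)"
  by (simp add: Gam_def dv_simps dt_hb dv_commute[of "(0, 1)"] sum.distrib algebra_simps)

lemma dt_Lap: "dt (Lap u) = Lap (dt u)"
  by (simp add: Lap_def dv_simps dt_hb dt_hN dt_Eul dv_commute[of "(0, 1)"])

text \<open>The divergence of X times the gradient of Y.\<close>

definition dvg :: "'n smooth_fun \<Rightarrow> 'n smooth_fun \<Rightarrow> ('n::finite) smooth_fun" where
  "dvg X Y = X * Lap Y + Gam X Y"

text \<open>\<open>hess2 \<phi> u\<close> is \<open>2 (D\<^sup>2\<phi>) (\<nabla>u, \<nabla>u)\<close>, expressed by gradient products only.\<close>

definition hess2 :: "'n smooth_fun \<Rightarrow> 'n smooth_fun \<Rightarrow> ('n::finite) smooth_fun" where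
  "hess2 \<phi> u = 2 * Gam u (Gam \<phi> u) - Gam \<phi> (Gam u u)"

text \<open>The names refer to the real operators that arise from the Laplacian by conjugation with
  e^\<phi>. Multiplication by i exchanges the roles: the antisymmetric part is \<open>symm\<close>
  times i, and the symmetric part is \<open>dt \<phi>\<close> minus i times
  \<open>skew\<close>.\<close>

definition symm :: "'n smooth_fun \<Rightarrow> 'n smooth_fun \<Rightarrow> ('n::finite) smooth_fun" where
  "symm \<phi> u = Lap u + Gam \<phi> \<phi> * u"

definition skew :: "'n smooth_fun \<Rightarrow> 'n smooth_fun \<Rightarrow> ('n::finite) smooth_fun" where
  "skew \<phi> u = 2 * Gam \<phi> u + Lap \<phi> * u"

text \<open>The commutator of \<open>symm\<close> and \<open>skew\<close>, with the divergences of
  the integration by parts written out. The derivation rules expand both sides to the same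
  polynomial in \<open>Gam\<close> and \<open>Lap\<close>.\<close>

lemma symm_skew_identity:
  "- 2 * (symm \<phi> u * skew \<phi> u) =
    2 * u * u * Gam \<phi> (Gam \<phi> \<phi>) + 2 * hess2 \<phi> u - u * u * Lap (Lap \<phi>)
    + (- 2 * dvg (Gam \<phi> \<phi> * u * u) \<phi> - 4 * dvg (Gam \<phi> u) u + 2 * dvg (Gam u u) \<phi>
      - 2 * dvg (u * Lap \<phi>) u + dvg (u * u) (Lap \<phi>))"
  by (simp add: symm_def skew_def dvg_def hess2_def Gam_simps Lap_simps algebra_simps
      Gam_commute)

text \<open>The metric does not depend on t, so \<open>dt\<close> passes through \<open>Gam\<close>
  and \<open>Lap\<close>; integrating it by parts leaves the gradient of
  \<open>dt \<phi>\<close>.\<close>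

lemma time_skew_identity:
  "- 2 * (dt p * skew \<phi> q - dt q * skew \<phi> p) =
    2 * (p * Gam (dt \<phi>) q - q * Gam (dt \<phi>) p)
    + (- 2 * dt (p * skew \<phi> q) + 4 * dvg (p * dt q) \<phi> + 2 * dvg (p * q) (dt \<phi>))"
  by (simp add: skew_def dvg_def Gam_simps dv_simps dt_Gam dt_Lap algebra_simps
      Gam_commute)

text \<open>For \<open>f = p + i q\<close> the left-hand side is \<open>- 2 Re \<langle>(\<partial>\<^sub>t - i symm) f, (\<partial>\<^sub>t\<phi> - i skew) f\<rangle>\<close> pointwise; on
  the right, the terms with an outer \<open>dt\<close> or \<open>dvg\<close> integrate to \<open>0\<close>.\<close>

lemma commutator_identity:
  "- 2 * ((dt p + symm \<phi> q) * (dt \<phi> * p + skew \<phi> q) + (dt q - symm \<phi> p) * (dt \<phi> * q - skew \<phi> p)) =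
    dt (dt \<phi>) * (p * p + q * q) + 4 * (p * Gam (dt \<phi>) q - q * Gam (dt \<phi>) p)
    + (2 * p * p * Gam \<phi> (Gam \<phi> \<phi>) + 2 * hess2 \<phi> p - p * p * Lap (Lap \<phi>))
    + (2 * q * q * Gam \<phi> (Gam \<phi> \<phi>) + 2 * hess2 \<phi> q - q * q * Lap (Lap \<phi>))
    + (- dt (dt \<phi> * (p * p + q * q)) - 2 * dt (p * skew \<phi> q)
      + 4 * dvg (p * dt q) \<phi> + 2 * dvg (p * q) (dt \<phi>)
      - 2 * dvg (dt \<phi> * p) q + 2 * dvg (dt \<phi> * q) p
      + (- 2 * dvg (Gam \<phi> \<phi> * p * p) \<phi> - 4 * dvg (Gam \<phi> p) p + 2 * dvg (Gam p p) \<phi>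
        - 2 * dvg (p * Lap \<phi>) p + dvg (p * p) (Lap \<phi>))
      + (- 2 * dvg (Gam \<phi> \<phi> * q * q) \<phi> - 4 * dvg (Gam \<phi> q) q + 2 * dvg (Gam q q) \<phi>
        - 2 * dvg (q * Lap \<phi>) q + dvg (q * q) (Lap \<phi>)))"
  (is "?lhs = ?rhs")
proof -
  have 1: "- 2 * (dt \<phi> * (p * dt p + q * dt q)) =
      dt (dt \<phi>) * (p * p + q * q) - dt (dt \<phi> * (p * p + q * q))"
    by (simp add: dv_simps algebra_simps)
  have 2: "- 2 * (dt \<phi> * (p * symm \<phi> q - q * symm \<phi> p)) =
      2 * (p * Gam (dt \<phi>) q - q * Gam (dt \<phi>) p)
      - 2 * dvg (dt \<phi> * p) q + 2 * dvg (dt \<phi> * q) p"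
    by (simp add: symm_def dvg_def Gam_simps algebra_simps Gam_commute)
  have "?lhs = - 2 * (dt \<phi> * (p * dt p + q * dt q)) + - 2 * (dt p * skew \<phi> q - dt q * skew \<phi> p)
      + - 2 * (dt \<phi> * (p * symm \<phi> q - q * symm \<phi> p))
      + - 2 * (symm \<phi> p * skew \<phi> p) + - 2 * (symm \<phi> q * skew \<phi> q)"
    by (simp add: algebra_simps)
  also have "\<dots> = ?rhs"
    unfolding 1 2 symm_skew_identity time_skew_identity by (simp add: algebra_simps)
  finally show ?thesis .
qed

section \<open>Integration by parts\<close>

text \<open>Any compact set may replace the support, which keeps the closure rules short. As it lies
  inside the open cylinder, the extension by zero is smooth across the boundary of the ball.\<close>

definition csupp :: "('n::finite) smooth_fun \<Rightarrow> bool" where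
  "csupp f \<longleftrightarrow> (\<exists>K. compact K \<and> K \<subseteq> hyp_cylinder \<and> (\<forall>z. z \<notin> K \<longrightarrow> ev f z = 0))"

lemma csupp_mult:
  assumes "csupp f"
  shows "csupp (f * g)" "csupp (g * f)"
proof -
  obtain K where "compact K" "K \<subseteq> hyp_cylinder" "\<And>z. z \<notin> K \<Longrightarrow> ev f z = 0"
    using assms unfolding csupp_def by metis
  then show "csupp (f * g)" "csupp (g * f)"
    unfolding csupp_def by (auto intro!: exI[of _ K] simp: ev_ring)
qed

lemma csupp_add:
  assumes "csupp f" "csupp g"
  shows "csupp (f + g)"
proof -
  obtain K L where "compact K" "K \<subseteq> hyp_cylinder" "\<And>z. z \<notin> K \<Longrightarrow> ev f z = 0"
    "compact L" "L \<subseteq> hyp_cylinder" "\<And>z. z \<notin> L \<Longrightarrow> ev g z = 0"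
    using assms unfolding csupp_def by metis
  then show ?thesis
    unfolding csupp_def by (intro exI[of _ "K \<union> L"]) (auto simp: ev_ring)
qed

lemma csupp_zero: "csupp 0"
  unfolding csupp_def by (intro exI[of _ "{}"]) (auto simp: ev_ring)

lemma csupp_minus: "csupp f \<Longrightarrow> csupp (- f)"
  using csupp_mult(1)[of f "- 1"] by simp

lemma csupp_diff: "csupp f \<Longrightarrow> csupp g \<Longrightarrow> csupp (f - g)"
  using csupp_add[of f "- g"] csupp_minus[of g] by simp

lemma csupp_sum: "(\<And>i. i \<in> I \<Longrightarrow> csupp (f i)) \<Longrightarrow> csupp (\<Sum>i\<in>I. f i)"
  by (induction I rule: infinite_finite_induct) (auto simp: csupp_zero csupp_add)

lemma has_derivative_off_support:
  assumes "compact K" "K \<subseteq> hyp_cylinder" "\<And>z. z \<notin> K \<Longrightarrow> ev f z = 0" "z \<notin> K"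
  shows "(ev f has_derivative (\<lambda>v. 0)) (at z)"
proof (rule has_derivative_transform_within_open[OF has_derivative_const])
  show "open (- K)" "z \<in> - K" using assms by (auto intro: compact_imp_closed)
  show "0 = ev f x" if "x \<in> - K" for x using assms(3) that by simp
qed

lemma ev_dv_off_support:
  assumes "compact K" "K \<subseteq> hyp_cylinder" "\<And>z. z \<notin> K \<Longrightarrow> ev f z = 0" "z \<notin> K"
  shows "ev (dv v f) z = 0"
proof (cases "z \<in> hyp_cylinder")
  case True
  from has_derivative_unique[OF ev_has_derivative[OF True] has_derivative_off_support[OF assms]]
  show ?thesis by metis
qed (rule ev_outside)

lemma csupp_dv: "csupp f \<Longrightarrow> csupp (dv v f)"
  unfolding csupp_def using ev_dv_off_support by metis

lemma csupp_ev_has_derivative: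
  assumes "csupp f"
  shows "(ev f has_derivative (\<lambda>v. ev (dv v f) z)) (at z)"
proof (cases "z \<in> hyp_cylinder")
  case False
  obtain K where K: "compact K" "K \<subseteq> hyp_cylinder" "\<And>z. z \<notin> K \<Longrightarrow> ev f z = 0"
    using assms unfolding csupp_def by metis
  then show ?thesis
    using has_derivative_off_support[OF K, of z] False by (auto simp: ev_outside)
qed (rule ev_has_derivative)

lemma csupp_continuous:
  assumes "csupp f"
  shows "continuous_on S (ev f)"
  by (intro continuous_at_imp_continuous_on ballI
      has_derivative_continuous[OF csupp_ev_has_derivative[OF assms]])

lemma csupp_integrable:
  assumes "csupp f"
  shows "integrable lborel (ev f)"
proof -
  obtain K where K: "compact K" "\<And>z. z \<notin> K \<Longrightarrow> ev f z = 0"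
    using assms unfolding csupp_def by metis
  have "integrable lborel (\<lambda>x. indicator K x *\<^sub>R ev f x)"
    by (rule borel_integrable_compact[OF K(1) csupp_continuous[OF assms]])
  moreover have "(\<lambda>x. indicator K x *\<^sub>R ev f x) = ev f"
  proof
    show "indicator K x *\<^sub>R ev f x = ev f x" for x
      using K(2)[of x] by (cases "x \<in> K") auto
  qed
  ultimately show ?thesis by (simp only:)
qed

text \<open>Difference quotients have integral zero by translation invariance of Lebesgue measure;
  dominated convergence passes this on to the derivative.\<close>

lemma integral_dv_eq_0:
  assumes "csupp f"
  shows "(LINT z|lborel. ev (dv v f) z) = 0"
proof -
  obtain K where K: "compact K" "K \<subseteq> hyp_cylinder" "\<And>z. z \<notin> K \<Longrightarrow> ev f z = 0"
    using assms unfolding csupp_def by metis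
  define s :: "nat \<Rightarrow> real" where "s n = 1 / real (Suc n)" for n
  have s: "0 < s n" "s n \<le> 1" for n by (auto simp: s_def)
  define q where "q n z = (ev f (z + s n *\<^sub>R v) - ev f z) / s n" for n z
  have der: "((\<lambda>t. ev f (z + t *\<^sub>R v)) has_real_derivative ev (dv v f) (z + t *\<^sub>R v)) (at t)" for z t
  proof -
    have *: "((\<lambda>t. z + t *\<^sub>R v) has_derivative (\<lambda>h. h *\<^sub>R v)) (at t)"
      by (auto intro!: derivative_eq_intros)
    note fd = csupp_ev_has_derivative[OF assms, of "z + t *\<^sub>R v"]
    have "ev (dv (h *\<^sub>R v) f) (z + t *\<^sub>R v) = ev (dv v f) (z + t *\<^sub>R v) * h" for h
      using linear_scale[OF has_derivative_linear[OF fd], of h v] by simp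
    then show ?thesis
      using has_derivative_compose[OF * fd] by (simp add: has_field_derivative_def)
  qed
  \<comment> \<open>\<open>K'\<close> contains every z for which some z + t v with 0 \<le> t \<le> 1
    lies in \<open>K\<close>, and so carries a dominating function for all steps
    \<open>s n \<le> 1\<close>.\<close>
  define K' where "K' = (\<lambda>(k, t). k - t *\<^sub>R v) ` (K \<times> {0..1})"
  have K': "compact K'"
    unfolding K'_def
    by (intro compact_continuous_image compact_Times K(1) compact_Icc)
      (auto intro!: continuous_intros simp: case_prod_beta)
  have "compact (ev (dv v f) ` K)"
    by (intro compact_continuous_image csupp_continuous csupp_dv assms K(1))
  then obtain B where B: "\<And>x. x \<in> K \<Longrightarrow> \<bar>ev (dv v f) x\<bar> \<le> B"
    using compact_imp_bounded[of "ev (dv v f) ` K"] unfolding bounded_iff by force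
  have bound: "norm (q n z) \<le> indicator K' z *\<^sub>R \<bar>B\<bar>" for n z
  proof -
    obtain c where c: "0 < c" "c < s n"
      "ev f (z + s n *\<^sub>R v) - ev f (z + 0 *\<^sub>R v) = (s n - 0) * ev (dv v f) (z + c *\<^sub>R v)"
      using MVT2[OF s(1)[of n] der] by blast
    then have q: "q n z = ev (dv v f) (z + c *\<^sub>R v)" using s(1)[of n] by (simp add: q_def)
    show ?thesis
    proof (cases "z + c *\<^sub>R v \<in> K")
      case True
      then have "z \<in> K'"
        unfolding K'_def using c s(2)[of n] by (intro image_eqI[of _ _ "(z + c *\<^sub>R v, c)"]) auto
      then show ?thesis using B[OF True] q by simp
    next
      case False
      then show ?thesis using ev_dv_off_support[OF K False] q by (simp add: indicator_def)
    qed
  qed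
  have lim: "(\<lambda>n. q n z) \<longlonglongrightarrow> ev (dv v f) z" for z
  proof -
    have "((\<lambda>h. (ev f (z + h *\<^sub>R v) - ev f z) / h) \<longlongrightarrow> ev (dv v f) z) (at 0)"
      using der[of z 0] by (simp add: has_field_derivative_def DERIV_def field_has_derivative_at)
    moreover have "filterlim s (at 0) sequentially"
    proof -
      have "s = (\<lambda>n. inverse (real (Suc n)))" by (auto simp: s_def inverse_eq_divide)
      then have "s \<longlonglongrightarrow> 0" using LIMSEQ_inverse_real_of_nat by simp
      then show ?thesis
        unfolding filterlim_at using s(1) by (auto intro!: always_eventually less_imp_neq[symmetric])
    qed
    ultimately show ?thesis unfolding q_def by (rule filterlim_compose)
  qed
  have int: "integrable lborel (\<lambda>z. ev f (z + s n *\<^sub>R v))"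
    and shift: "(LINT z|lborel. ev f (z + s n *\<^sub>R v)) = (LINT z|lborel. ev f z)" for n
  proof -
    have *: "distr lborel borel (\<lambda>z. s n *\<^sub>R v + z) = lborel" by (rule lborel_distr_plus)
    have m: "ev f \<in> borel_measurable borel"
      by (intro borel_measurable_continuous_onI csupp_continuous assms)
    show "(LINT z|lborel. ev f (z + s n *\<^sub>R v)) = (LINT z|lborel. ev f z)"
      using integral_distr[of "\<lambda>z. s n *\<^sub>R v + z" lborel borel "ev f"] m
      unfolding * by (simp add: add.commute)
    show "integrable lborel (\<lambda>z. ev f (z + s n *\<^sub>R v))"
      using integrable_distr_eq[of "\<lambda>z. s n *\<^sub>R v + z" lborel borel "ev f"] m csupp_integrable[OF assms]
      unfolding * by (simp add: add.commute)
  qed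
  have "(LINT z|lborel. q n z) = 0" for n
    unfolding q_def using int[of n] shift[of n] csupp_integrable[OF assms] by simp
  moreover have "(\<lambda>n. LINT z|lborel. q n z) \<longlonglongrightarrow> (LINT z|lborel. ev (dv v f) z)"
  proof (rule integral_dominated_convergence[where w = "\<lambda>z. indicator K' z *\<^sub>R \<bar>B\<bar>"])
    show "ev (dv v f) \<in> borel_measurable lborel"
      using borel_measurable_integrable csupp_integrable[OF csupp_dv[OF assms]] by blast
    show "q n \<in> borel_measurable lborel" for n
      unfolding q_def using int[of n] csupp_integrable[OF assms] borel_measurable_integrable
      by (intro borel_measurable_divide borel_measurable_diff) auto
    show "integrable lborel (\<lambda>z. indicator K' z *\<^sub>R \<bar>B\<bar>)"
      by (rule borel_integrable_compact[OF K']) (rule continuous_on_const)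
  qed (use lim bound in auto)
  ultimately show ?thesis by (simp add: LIMSEQ_const_iff)
qed

text \<open>The Riemannian volume density sqrt (det g) = (2 / N)^n.\<close>

definition vol :: "('n::finite) smooth_fun" where
  "vol = (2 * hM) ^ CARD('n)"

lemma of_nat_real_const: "const (real n) = of_nat n"
  by (induction n) (simp_all add: const_ring)

lemma dv_power: "dv v (f ^ n) = const (real n) * f ^ (n - 1) * dv v f"
proof (induction n)
  case (Suc n)
  then show ?case
    by (cases n) (simp_all add: dv_simps const_ring algebra_simps)
qed (simp add: dv_one const_ring)

lemma di_vol: "di i (vol :: ('n::finite) smooth_fun) = const (2 * real CARD('n)) * hM * coord i * vol"
proof -
  let ?g = "2 * hM :: 'n smooth_fun"
  have "?g ^ (CARD('n) - 1) * ?g = ?g ^ CARD('n)"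
    by (rule power_minus_mult) simp
  moreover have "di i ?g = 2 * hM * coord i * ?g"
    by (simp add: dv_simps di_hM)
  moreover have "const (real CARD('n)) * a * (2 * hM * coord i * b) =
      const (2 * real CARD('n)) * hM * coord i * (a * b)" for a b :: "'n smooth_fun"
    by (simp add: const_ring mult_ac)
  ultimately show ?thesis
    unfolding vol_def dv_power by (simp only:)
qed

lemma dt_vol: "dt vol = 0"
  by (simp add: vol_def dv_power dv_simps dt_hM)

text \<open>Weighted with the density, a divergence is a sum of coordinate derivatives; this reduces
  integration by parts to \<open>integral_dv_eq_0\<close>.\<close>

lemma vol_dvg:
  fixes X Y :: "('n::finite) smooth_fun"
  shows "vol * dvg X Y = (\<Sum>i\<in>UNIV. di i (vol * hb * X * di i Y))"
proof -
  have hbM: "hb * hM = const (1/4) * (hN :: 'n smooth_fun)"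
  proof (rule smooth_fun_eqI)
    fix z :: "(real ^ 'n) \<times> real" assume z: "z \<in> hyp_cylinder"
    show "ev (hb * hM) z = ev (const (1/4) * hN) z"
      using hN_pos[OF z] by (simp add: ev_simps hb_def ev_hM z)
  qed
  have "(\<Sum>i\<in>UNIV. di i (vol * hb * X * di i Y)) =
      vol * (const (2 * real CARD('n)) * (hb * hM) * X * Eul Y - hN * X * Eul Y
        + Gam X Y + X * (hb * (\<Sum>i\<in>UNIV. di i (di i Y))))"
    by (simp add: dv_simps di_vol di_hb Eul_def Gam_def sum.distrib sum_distrib_left sum_subtractf
        sum_negf algebra_simps)
  \<comment> \<open>\<open>hb * hM\<close> is N / 4, and 2 n N / 4 - N = (n - 2) N / 2 is the
    first-order coefficient of \<open>Lap\<close>.\<close>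
  also have "const (2 * real CARD('n)) * (hb * hM) * X * Eul Y - hN * X * Eul Y =
      X * (const ((real CARD('n) - 2) / 2) * hN * Eul Y)"
    unfolding hbM by (rule smooth_fun_eqI) (simp add: ev_simps field_simps)
  finally show ?thesis by (simp add: dvg_def Lap_def algebra_simps)
qed

definition integ :: "('n::finite) smooth_fun \<Rightarrow> real" where
  "integ f = (LINT z|lborel. ev (vol * f) z)"

lemma csupp_Gam:
  shows "csupp u \<Longrightarrow> csupp (Gam u v)" and "csupp v \<Longrightarrow> csupp (Gam u v)"
  unfolding Gam_def by (simp_all only: csupp_mult csupp_sum csupp_dv)

lemma csupp_Lap: "csupp u \<Longrightarrow> csupp (Lap u)"
  unfolding Lap_def Eul_def by (intro csupp_add csupp_mult(2) csupp_sum csupp_dv)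

lemma integ_dvg:
  assumes "csupp X \<or> csupp Y"
  shows "integ (dvg X Y) = 0" and "csupp (dvg X Y)"
proof -
  have *: "csupp (vol * hb * X * di i Y)" for i
    using assms csupp_mult(1)[OF csupp_mult(2)[of X "vol * hb"]] csupp_mult(2)[OF csupp_dv]
    by blast
  show "integ (dvg X Y) = 0"
    unfolding integ_def vol_dvg ev_sum
    by (subst Bochner_Integration.integral_sum)
      (auto intro!: csupp_integrable csupp_dv * simp: integral_dv_eq_0[OF *])
  show "csupp (dvg X Y)"
    using assms csupp_add[OF csupp_mult(1) csupp_Gam(1)]
      csupp_add[OF csupp_mult(2)[OF csupp_Lap] csupp_Gam(2)]
    unfolding dvg_def by blast
qed

lemma integ_dt: "csupp X \<Longrightarrow> integ (dt X) = 0" "csupp X \<Longrightarrow> csupp (dt X)"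
  using integral_dv_eq_0[of "vol * X" "(0, 1)"]
  by (auto simp: integ_def dv_mult dt_vol intro: csupp_mult csupp_dv)

lemma integ_add: "csupp f \<Longrightarrow> csupp g \<Longrightarrow> integ (f + g) = integ f + integ g"
  and integ_diff: "csupp f \<Longrightarrow> csupp g \<Longrightarrow> integ (f - g) = integ f - integ g"
  and integ_minus: "integ (- f) = - integ f"
  and integ_cmult: "integ (numeral k * f) = numeral k * integ f"
proof -
  show "integ (f + g) = integ f + integ g" if "csupp f" "csupp g"
    using csupp_integrable[OF csupp_mult(2)[OF that(1), of vol]]
      csupp_integrable[OF csupp_mult(2)[OF that(2), of vol]]
    by (simp add: integ_def distrib_left ev_ring(1))
  show "integ (f - g) = integ f - integ g" if "csupp f" "csupp g"
    using csupp_integrable[OF csupp_mult(2)[OF that(1), of vol]]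
      csupp_integrable[OF csupp_mult(2)[OF that(2), of vol]]
    by (simp add: integ_def right_diff_distrib ev_ring(4))
  show "integ (- f) = - integ f" by (simp add: integ_def ev_ring)
  have "ev (vol * (numeral k * f)) z = numeral k * ev (vol * f) z" for z
    by (cases "z \<in> hyp_cylinder") (simp_all add: ev_simps ev_outside)
  then show "integ (numeral k * f) = numeral k * integ f" by (simp add: integ_def)
qed

lemma vol_pos: "z \<in> hyp_cylinder \<Longrightarrow> ev vol z > 0"
  by (simp add: vol_def ev_simps ev_hM hN_pos)

lemma integ_mono:
  assumes "csupp f" "csupp g" "\<And>z. z \<in> hyp_cylinder \<Longrightarrow> ev f z \<le> ev g z"
  shows "integ f \<le> integ g"
  unfolding integ_def
proof (rule integral_mono)
  show "ev (vol * f) z \<le> ev (vol * g) z" for z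
  proof (cases "z \<in> hyp_cylinder")
    case True
    show ?thesis
      unfolding ev_ring using assms(3)[OF True] less_imp_le[OF vol_pos[OF True]]
      by (rule mult_left_mono)
  qed (simp add: ev_outside)
qed (auto intro!: csupp_integrable csupp_mult assms)

lemma csupp_conjugated:
  assumes "csupp u"
  shows "csupp (symm \<phi> u)" "csupp (skew \<phi> u)" "csupp (hess2 \<phi> u)"
  unfolding symm_def skew_def hess2_def
  by (intro csupp_add csupp_diff csupp_mult(2) csupp_Lap csupp_Gam(1) csupp_Gam(2) assms)+

text \<open>Support and vanishing integral are bundled because \<open>integ\<close> is known to be
  additive only under compact support; a long sum is then handled by introduction rules.\<close>

definition null_integ :: "('n::finite) smooth_fun \<Rightarrow> bool" where
  "null_integ f \<longleftrightarrow> csupp f \<and> integ f = 0"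

lemma null_integ_intros:
  "null_integ f \<Longrightarrow> null_integ g \<Longrightarrow> null_integ (f + g)"
  "null_integ f \<Longrightarrow> null_integ g \<Longrightarrow> null_integ (f - g)"
  "null_integ f \<Longrightarrow> null_integ (- f)"
  "null_integ f \<Longrightarrow> null_integ (numeral k * f)"
  "null_integ f \<Longrightarrow> null_integ (- numeral k * f)"
  "csupp X \<Longrightarrow> null_integ (dt X)"
  "csupp X \<Longrightarrow> null_integ (dvg X Y)"
  using integ_minus[of "numeral k * f"]
  by (auto simp: null_integ_def integ_add integ_diff integ_minus integ_cmult integ_dt integ_dvg
      csupp_add csupp_diff csupp_minus csupp_mult)

lemma commutator_inequality:
  assumes "csupp p" "csupp q"
  shows "integ (dt (dt \<phi>) * (p * p + q * q) + 4 * (p * Gam (dt \<phi>) q - q * Gam (dt \<phi>) p)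
      + (2 * p * p * Gam \<phi> (Gam \<phi> \<phi>) + 2 * hess2 \<phi> p - p * p * Lap (Lap \<phi>))
      + (2 * q * q * Gam \<phi> (Gam \<phi> \<phi>) + 2 * hess2 \<phi> q - q * q * Lap (Lap \<phi>)))
    \<le> integ ((dt p + symm \<phi> q - (dt \<phi> * p + skew \<phi> q)) ^ 2
      + (dt q - symm \<phi> p - (dt \<phi> * q - skew \<phi> p)) ^ 2)"
    (is "integ ?Q \<le> integ ?N") and
    "csupp (dt (dt \<phi>) * (p * p + q * q) + 4 * (p * Gam (dt \<phi>) q - q * Gam (dt \<phi>) p)
      + (2 * p * p * Gam \<phi> (Gam \<phi> \<phi>) + 2 * hess2 \<phi> p - p * p * Lap (Lap \<phi>))
      + (2 * q * q * Gam \<phi> (Gam \<phi> \<phi>) + 2 * hess2 \<phi> q - q * q * Lap (Lap \<phi>)))"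
proof -
  note supp = csupp_add csupp_diff csupp_mult csupp_dv csupp_Gam csupp_conjugated assms
  let ?a = "(dt p + symm \<phi> q) * (dt \<phi> * p + skew \<phi> q) + (dt q - symm \<phi> p) * (dt \<phi> * q - skew \<phi> p)"
  let ?Z = "- dt (dt \<phi> * (p * p + q * q)) - 2 * dt (p * skew \<phi> q)
      + 4 * dvg (p * dt q) \<phi> + 2 * dvg (p * q) (dt \<phi>)
      - 2 * dvg (dt \<phi> * p) q + 2 * dvg (dt \<phi> * q) p
      + (- 2 * dvg (Gam \<phi> \<phi> * p * p) \<phi> - 4 * dvg (Gam \<phi> p) p + 2 * dvg (Gam p p) \<phi>
        - 2 * dvg (p * Lap \<phi>) p + dvg (p * p) (Lap \<phi>))
      + (- 2 * dvg (Gam \<phi> \<phi> * q * q) \<phi> - 4 * dvg (Gam \<phi> q) q + 2 * dvg (Gam q q) \<phi>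
        - 2 * dvg (q * Lap \<phi>) q + dvg (q * q) (Lap \<phi>))"
  have Z: "null_integ ?Z"
    by (intro null_integ_intros; simp only: supp)
  have ca: "csupp (- 2 * ?a)"
    by (simp only: supp)
  show Q: "csupp ?Q"
    by (simp only: supp)
  have N: "csupp ?N"
    unfolding power2_eq_square by (simp only: supp)
  have "integ ?Q = integ (- 2 * ?a - ?Z)"
    unfolding commutator_identity by simp
  also have "\<dots> = integ (- 2 * ?a)"
    using Z integ_diff[OF ca, of ?Z] by (simp add: null_integ_def)
  also have "\<dots> \<le> integ ?N"
  proof (rule integ_mono[OF ca N])
    fix z :: "(real ^ 'a) \<times> real" assume z: "z \<in> hyp_cylinder"
    have *: "- 2 * (a * b + c * d) \<le> (a - b) ^ 2 + (c - d) ^ 2" for a b c d :: real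
      using sum_power2_ge_zero[of a b] sum_power2_ge_zero[of c d]
      by (simp add: power2_eq_square algebra_simps)
    show "ev (- 2 * ?a) z \<le> ev ?N z"
      using *[of "ev (dt p + symm \<phi> q) z" "ev (dt \<phi> * p + skew \<phi> q) z"
          "ev (dt q - symm \<phi> p) z" "ev (dt \<phi> * q - skew \<phi> p) z"]
      by (simp add: ev_simps z)
  qed
  finally show "integ ?Q \<le> integ ?N" .
qed

section \<open>The square of arcosh\<close>

text \<open>\<open>cosh_sqrt k\<close> is the \<open>k\<close>-th derivative of \<open>\<Sum>\<^sub>n x\<^sup>n / (2n)!\<close>, which is \<open>cosh (sqrt x)\<close> for
  \<open>x \<ge> 0\<close> and extends it smoothly to negative arguments.\<close>

definition cosh_sqrt :: "nat \<Rightarrow> real \<Rightarrow> real" where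
  "cosh_sqrt k x = (\<Sum>n. (diffs ^^ k) (\<lambda>n. inverse (fact (2 * n))) n * x ^ n)"

lemma summable_cosh_sqrt:
  "summable (\<lambda>n. (diffs ^^ k) (\<lambda>n. inverse (fact (2 * n))) n * (x :: real) ^ n)"
proof (induction k arbitrary: x)
  case 0
  show ?case
  proof (rule summable_comparison_test')
    show "summable (\<lambda>n. inverse (fact n) * \<bar>x\<bar> ^ n)" by (rule summable_exp)
    show "norm ((diffs ^^ 0) (\<lambda>n. inverse (fact (2 * n))) n * x ^ n) \<le> inverse (fact n) * \<bar>x\<bar> ^ n" for n
      by (auto simp: abs_mult power_abs intro!: mult_right_mono fact_mono)
  qed
next
  case (Suc k)
  then show ?case by (simp add: termdiff_converges_all)
qed

lemma DERIV_cosh_sqrt: "(cosh_sqrt k has_real_derivative cosh_sqrt (Suc k) x) (at x)"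
  using termdiffs_strong_converges_everywhere[OF summable_cosh_sqrt, of k x]
  unfolding cosh_sqrt_def[abs_def] by simp

lemma cosh_sqrt_square: "cosh_sqrt 0 (y\<^sup>2) = cosh y"
proof -
  have "(\<lambda>n. if even n then y ^ n /\<^sub>R fact n else 0) sums cosh y" by (rule cosh_converges)
  then have "(\<lambda>n. (if even (2 * n) then y ^ (2 * n) /\<^sub>R fact (2 * n) else 0)) sums cosh y"
    by (subst sums_mono_reindex[of "\<lambda>n. 2 * n"]) (auto simp: strict_mono_def elim!: evenE)
  then show ?thesis
    unfolding cosh_sqrt_def
    by (simp add: power_mult[of y 2, symmetric] divide_inverse mult.commute sums_iff)
qed

lemma cosh_sqrt_0: "cosh_sqrt (Suc 0) 0 = 1/2" "cosh_sqrt (Suc (Suc 0)) 0 = 1/12"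
  by (simp_all add: cosh_sqrt_def powser_zero diffs_def fact_numeral)

lemma cosh_sqrt_1: "2 * y * cosh_sqrt (Suc 0) (y\<^sup>2) = sinh y"
proof -
  have "((\<lambda>y. cosh_sqrt 0 (y\<^sup>2)) has_real_derivative cosh_sqrt (Suc 0) (y\<^sup>2) * (2 * y)) (at y)"
    by (rule DERIV_chain2[where f = "cosh_sqrt 0" and g = "\<lambda>y. y\<^sup>2", OF DERIV_cosh_sqrt])
      (auto intro!: derivative_eq_intros)
  moreover have "((\<lambda>y. cosh_sqrt 0 (y\<^sup>2)) has_real_derivative sinh y) (at y)"
    unfolding cosh_sqrt_square by (auto intro!: derivative_eq_intros)
  ultimately have "cosh_sqrt (Suc 0) (y\<^sup>2) * (2 * y) = sinh y" by (rule DERIV_unique)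
  then show ?thesis by (simp add: mult_ac)
qed

lemma cosh_sqrt_1_pos: "x \<ge> 0 \<Longrightarrow> cosh_sqrt (Suc 0) x > 0"
proof (cases "x = 0")
  case False
  assume "x \<ge> 0"
  then have "2 * sqrt x * cosh_sqrt (Suc 0) x = sinh (sqrt x)" "sqrt x > 0"
    using cosh_sqrt_1[of "sqrt x"] False by simp_all
  then have "2 * sqrt x * cosh_sqrt (Suc 0) x > 0" by simp
  then show ?thesis using \<open>sqrt x > 0\<close> by (simp add: zero_less_mult_iff)
qed (simp add: cosh_sqrt_0)

text \<open>The interface of the square of arcosh with two derivatives. \<open>V\<close> reaches
  below 1 because Z attains 1 at the centre and compositions require smoothness on a neighbourhood.
  \<open>G1_sq\<close> is the eikonal equation in the variable Z, and \<open>G_ode\<close> is its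
  derivative divided by 2 \<open>G1\<close>.\<close>

locale arcosh_square =
  fixes V :: "real set" and G G1 G2 :: "real \<Rightarrow> real"
  assumes open_V: "open V"
    and V: "{1..} \<subseteq> V"
    and smooth_G: "smooth_on V G" "smooth_on V G1" "smooth_on V G2"
    and DERIV_G: "\<And>z. z \<in> V \<Longrightarrow> (G has_real_derivative G1 z) (at z)"
    and DERIV_G1: "\<And>z. z \<in> V \<Longrightarrow> (G1 has_real_derivative G2 z) (at z)"
    and G_cosh: "\<And>y. G (cosh y) = y\<^sup>2"
    and G1_sq: "\<And>z. z \<ge> 1 \<Longrightarrow> (z\<^sup>2 - 1) * (G1 z)\<^sup>2 = 4 * G z"
    and G1_pos: "\<And>z. z \<ge> 1 \<Longrightarrow> G1 z > 0"
    and G_ode: "\<And>z. z \<ge> 1 \<Longrightarrow> z * G1 z + (z\<^sup>2 - 1) * G2 z = 2"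
    and G_at_1: "G1 1 = 2" "G2 1 = - 2 / 3"

text \<open>G is constructed as the inverse of the increasing function \<open>cosh_sqrt 0\<close> on
  a half-line that starts below 0; this makes it smooth across 1, where arcosh is singular.\<close>

lemma arcosh_square_exists: "\<exists>V G G1 G2. arcosh_square V G G1 G2"
proof -
  have "isCont (cosh_sqrt (Suc 0)) 0" using DERIV_cosh_sqrt DERIV_isCont by blast
  \<comment> \<open>The value at 0 is 1/2, so a deviation below 1/2 keeps the derivative positive
    for slightly negative arguments.\<close>
  then obtain d where d: "d > 0" "\<And>x. dist x 0 < d \<Longrightarrow> dist (cosh_sqrt (Suc 0) x) (cosh_sqrt (Suc 0) 0) < 1/2"
    unfolding continuous_at_eps_delta by (metis zero_less_divide_1_iff zero_less_numeral)
  define U where "U = {- d<..}"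
  have U: "open U" "0 \<in> U" "\<And>x. x \<ge> 0 \<Longrightarrow> x \<in> U" using d by (auto simp: U_def)
  have pos: "cosh_sqrt (Suc 0) x > 0" if "x \<in> U" for x
  proof (cases "x \<ge> 0")
    case False
    then show ?thesis
      using d(2)[of x] that by (auto simp: U_def dist_real_def cosh_sqrt_0 abs_if split: if_splits)
  qed (rule cosh_sqrt_1_pos)
  have mono: "cosh_sqrt 0 x < cosh_sqrt 0 y" if "x \<in> U" "y \<in> U" "x < y" for x y
    by (rule DERIV_pos_imp_increasing[OF that(3)])
      (use that in \<open>auto intro!: exI conjI DERIV_cosh_sqrt[of 0] pos simp: U_def\<close>)
  have inj: "inj_on (cosh_sqrt 0) U"
    by (rule linorder_inj_onI') (use mono in \<open>metis less_irrefl\<close>)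
  define V where "V = cosh_sqrt 0 ` U"
  define G where "G = the_inv_into U (cosh_sqrt 0)"
  define G1 where "G1 z = inverse (cosh_sqrt (Suc 0) (G z))" for z
  define G2 where "G2 z = - 1 * (cosh_sqrt (Suc (Suc 0)) (G z) * (G1 z * (G1 z * G1 z)))" for z
  have Ginv: "G (cosh_sqrt 0 x) = x" if "x \<in> U" for x
    unfolding G_def by (rule the_inv_into_f_f[OF inj that])
  have GU: "G z \<in> U" if "z \<in> V" for z
    using that Ginv unfolding V_def by auto
  have openV: "open V"
    unfolding V_def
    by (rule invariance_of_domain[OF _ U(1) inj])
      (auto intro!: continuous_at_imp_continuous_on DERIV_isCont DERIV_cosh_sqrt)
  have dG: "(G has_real_derivative G1 z) (at z)" if "z \<in> V" for z
  proof -
    obtain x where x: "x \<in> U" "z = cosh_sqrt 0 x" using \<open>z \<in> V\<close> unfolding V_def by blast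
    have "(G has_derivative (*) (inverse (cosh_sqrt (Suc 0) x))) (at (cosh_sqrt 0 x))"
    proof (rule has_derivative_inverse_on[OF U(1), where f = "cosh_sqrt 0" and g = G and x = x
          and f' = "\<lambda>x. (*) (cosh_sqrt (Suc 0) x)" and g' = "\<lambda>_. (*) (inverse (cosh_sqrt (Suc 0) x))"])
      show "G (cosh_sqrt 0 x) = x" if "x \<in> U" for x by (rule Ginv[OF that])
      show "(cosh_sqrt 0 has_derivative (*) (cosh_sqrt (Suc 0) x)) (at x)" if "x \<in> U" for x
        using DERIV_cosh_sqrt[of 0 x] by (simp add: has_field_derivative_def)
      show "(*) (cosh_sqrt (Suc 0) x) \<circ> (*) (inverse (cosh_sqrt (Suc 0) x)) = id"
        using pos[OF x(1)] by (auto simp: fun_eq_iff)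
    qed (use x in auto)
    then show ?thesis using x Ginv by (simp add: has_field_derivative_def G1_def)
  qed
  have dG1: "(G1 has_real_derivative G2 z) (at z)" if "z \<in> V" for z
  proof -
    have "((\<lambda>z. inverse (cosh_sqrt (Suc 0) (G z))) has_real_derivative
        - (inverse (cosh_sqrt (Suc 0) (G z)) * (cosh_sqrt (Suc (Suc 0)) (G z) * G1 z) * inverse (cosh_sqrt (Suc 0) (G z)))) (at z)"
      by (rule DERIV_inverse'[OF DERIV_chain2[OF DERIV_cosh_sqrt[of "Suc 0"] dG[OF that]]])
        (use pos[OF GU[OF that]] in simp)
    then show ?thesis by (simp add: G1_def[abs_def] G2_def mult_ac)
  qed
  have smc: "smooth_on U (cosh_sqrt k)" for k
    by (rule smooth_on_real_sequence[OF U(1)]) (rule DERIV_cosh_sqrt)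
  have smi: "smooth_on U (\<lambda>x. inverse (cosh_sqrt (Suc 0) x))"
    by (rule smooth_on_compose[OF U(1) open_greaterThan smooth_on_inverse smc]) (use pos in auto)
  have "Ck_on k V G" for k
  proof (induction k)
    case 0
    show ?case using dG by (auto intro!: continuous_at_imp_continuous_on DERIV_isCont)
  next
    case (Suc k)
    \<comment> \<open>Bootstrapping: if G is C^k, then so is its derivative, a smooth function of G,
      and G is C^(k + 1).\<close>
    have "Ck_on k V (\<lambda>z. G1 z * v)" for v
      unfolding G1_def
      by (intro Ck_on_mult[OF openV] Ck_on_const Ck_on_compose[OF openV U(1) smi Suc])
        (use GU in auto)
    then show ?case
      using dG by (intro Ck_on_derivI[OF openV, of G "\<lambda>z v. G1 z * v"])
        (auto simp: has_field_derivative_def)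
  qed
  then have smG: "smooth_on V G" by (simp add: smooth_on_def)
  have smG1: "smooth_on V G1"
    unfolding G1_def[abs_def]
    by (rule smooth_on_compose[OF openV U(1) smi smG]) (use GU in auto)
  have "smooth_on V (\<lambda>z. cosh_sqrt (Suc (Suc 0)) (G z))"
    by (rule smooth_on_compose[OF openV U(1) smc smG]) (use GU in auto)
  then have smG2: "smooth_on V G2"
    unfolding G2_def[abs_def] by (intro smooth_on_mult[OF openV] smooth_on_const smG1)
  have Gc: "G (cosh y) = y\<^sup>2" for y
    using Ginv[of "y\<^sup>2"] U(3) by (simp add: cosh_sqrt_square)
  have ex: "\<exists>y\<ge>0. z = cosh y" if "z \<ge> 1" for z :: real
    using that by (intro exI[of _ "arcosh z"]) simp
  have V1: "{1..} \<subseteq> V"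
    unfolding V_def using ex U(3) cosh_sqrt_square by (metis atLeast_iff imageI subsetI zero_le_power2)
  have G1_sq: "(z\<^sup>2 - 1) * (G1 z)\<^sup>2 = 4 * G z" if "z \<ge> 1" for z
  proof -
    obtain y where y: "y \<ge> 0" "z = cosh y" using ex[OF \<open>z \<ge> 1\<close>] by blast
    have "z\<^sup>2 - 1 = (2 * y * cosh_sqrt (Suc 0) (y\<^sup>2))\<^sup>2"
      unfolding cosh_sqrt_1 using y by (simp add: cosh_square_eq)
    then show ?thesis
      using pos[of "y\<^sup>2"] U(3) by (simp add: G1_def y Gc power_mult_distrib field_simps)
  qed
  have G1_pos: "G1 z > 0" if "z \<in> V" for z
    using pos[OF GU[OF that]] by (simp add: G1_def)
  have G_1: "G 1 = 0" using Gc[of 0] by simp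
  have at_1: "G1 1 = 2" "G2 1 = - 2 / 3"
    by (simp_all add: G1_def G2_def G_1 cosh_sqrt_0)
  \<comment> \<open>For z > 1 the eikonal equation holds on a neighbourhood and can be
    differentiated; at z = 1 the value \<open>G1 1 = 2\<close> suffices.\<close>
  have "z * G1 z + (z\<^sup>2 - 1) * G2 z = 2" if "z \<ge> 1" for z
  proof (cases "z = 1")
    case False
    then have z: "z > 1" "z \<in> V" using that V1 by auto
    have "((\<lambda>z. (z\<^sup>2 - 1) * (G1 z)\<^sup>2) has_real_derivative
        2 * z * (G1 z)\<^sup>2 + (z\<^sup>2 - 1) * (2 * G1 z * G2 z)) (at z)"
      by (auto intro!: derivative_eq_intros dG1[OF z(2)])
    moreover have "((\<lambda>z. (z\<^sup>2 - 1) * (G1 z)\<^sup>2) has_real_derivative 4 * G1 z) (at z)"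
      by (rule has_field_derivative_transform_within_open[OF DERIV_cmult[OF dG[OF z(2)]] open_greaterThan[of 1]])
        (use z G1_sq in auto)
    ultimately have "2 * z * (G1 z)\<^sup>2 + (z\<^sup>2 - 1) * (2 * G1 z * G2 z) = 4 * G1 z"
      by (rule DERIV_unique)
    then have "2 * G1 z * (z * G1 z + (z\<^sup>2 - 1) * G2 z) = 2 * G1 z * 2"
      by (simp add: power2_eq_square algebra_simps)
    then show ?thesis using G1_pos[OF z(2)] by simp
  qed (simp add: at_1)
  moreover have "G1 z > 0" if "z \<ge> 1" for z using G1_pos[of z] V1 that by auto
  ultimately have "arcosh_square V G G1 G2"
    by (intro arcosh_square.intro openV V1 smG smG1 smG2 dG dG1 Gc G1_sq at_1)
  then show ?thesis by blast
qed

section \<open>Linear functions on the hyperboloid\<close>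

text \<open>The hyperboloid coordinates of \<open>x\<close> are \<open>((1 + |x|\<^sup>2) / N, 2 x / N)\<close> with \<open>N = 1 - |x|\<^sup>2\<close>;
  \<open>hX0\<close> is the first one and \<open>hX1 e\<close> the component of the second one along \<open>e\<close>.\<close>

definition hX0 :: "('n::finite) smooth_fun" where
  "hX0 = 2 * hM - 1"

definition hxe :: "real ^ 'n \<Rightarrow> ('n::finite) smooth_fun" where
  "hxe e = (\<Sum>i\<in>UNIV. const (e $ i) * coord i)"

definition hX1 :: "real ^ 'n \<Rightarrow> ('n::finite) smooth_fun" where
  "hX1 e = 2 * hM * hxe e"

definition De :: "real ^ 'n \<Rightarrow> 'n smooth_fun \<Rightarrow> ('n::finite) smooth_fun" where
  "De e u = (\<Sum>i\<in>UNIV. const (e $ i) * di i u)"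

text \<open>Half of \<open>hN\<close>, so that \<open>hb = hY * hY\<close> and
  \<open>2 * hY * hM = 1\<close>; inserting the second relation stands in for division.\<close>

definition hY :: "('n::finite) smooth_fun" where
  "hY = const (1/2) * hN"

lemma hb_hY: "hb = hY * hY"
  by (simp add: hb_def hY_def)

lemma two_hY: "2 * hY = (hN :: ('n::finite) smooth_fun)"
  by (rule smooth_fun_eqI) (simp add: ev_simps hY_def)

lemma two_hY_hM: "2 * hY * hM = (1 :: ('n::finite) smooth_fun)"
  by (simp add: two_hY hN_hM)

lemma norm_coord: "(\<Sum>i\<in>UNIV. coord i * coord i) = 1 - 2 * hY"
  by (simp add: two_hY hN_def)

lemma ev_hxe: "z \<in> hyp_cylinder \<Longrightarrow> ev (hxe e) z = fst z \<bullet> e"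
  by (simp add: hxe_def ev_simps ev_coord inner_vec_def mult.commute)

lemma di_hxe: "di i (hxe e) = const (e $ i)"
proof -
  have "(\<Sum>j\<in>UNIV. const (e $ j) * (if i = j then 1 else 0)) = (\<Sum>j\<in>UNIV. if i = j then const (e $ j) else 0)"
    by (intro sum.cong) auto
  then show ?thesis by (simp add: hxe_def dv_simps)
qed

lemma di_hX0: "di i hX0 = 4 * hM * hM * coord i"
  by (simp add: hX0_def dv_simps di_hM)

lemma di_hY: "di i hY = - coord i"
proof -
  have "di i hY = - (const (1/2) + const (1/2)) * coord i"
    unfolding hY_def by (simp add: dv_simps di_hN algebra_simps)
  then show ?thesis by (simp add: half_double)
qed

lemma Eul_hxe: "Eul (hxe e) = hxe e"
  by (simp add: Eul_def di_hxe) (simp add: hxe_def mult.commute)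

lemma Eul_hM: "Eul hM = 2 * hM * hM - 2 * hM"
proof -
  have "Eul hM = 2 * hM * hM * (\<Sum>i\<in>UNIV. coord i * coord i)"
    by (simp add: Eul_def di_hM sum_distrib_left algebra_simps)
  also have "\<dots> = 2 * hM * hM - 2 * hM * (2 * hY * hM)"
    unfolding norm_coord by (simp add: algebra_simps)
  finally show ?thesis by (simp add: two_hY_hM)
qed

lemma Eul_hb: "Eul hb = - 2 * hY * (1 - 2 * hY)"
proof -
  have "Eul hb = - hN * (\<Sum>i\<in>UNIV. coord i * coord i)"
    by (simp add: Eul_def di_hb sum_distrib_left algebra_simps sum_negf)
  then show ?thesis unfolding norm_coord by (simp add: two_hY[symmetric])
qed

text \<open>The partial derivatives of \<open>hX0\<close> are 4 x_i / N^2, and the inverse metric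
  N^2 / 4 reduces them to x_i.\<close>

lemma Gam_hX0: "Gam hX0 u = Eul u"
proof -
  have "Gam hX0 u = (2 * hY * hM) * (2 * hY * hM) * Eul u"
    by (simp add: Gam_def di_hX0 hb_hY Eul_def sum_distrib_left algebra_simps)
  then show ?thesis by (simp only: two_hY_hM mult_1)
qed

lemma Gam_hxe: "Gam (hxe e) u = hb * De e u"
  by (simp add: Gam_def di_hxe De_def)

lemma Gam_hX1: "Gam (hX1 e) u = hY * De e u + hxe e * Eul u"
proof -
  have "2 * Gam hM u = Eul u"
    using Gam_hX0[of u] by (simp add: hX0_def Gam_simps)
  moreover have "Gam (hX1 e) u = hxe e * (2 * Gam hM u) + (2 * hY * hM) * (hY * De e u)"
    by (simp add: hX1_def Gam_simps Gam_hxe hb_hY algebra_simps)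
  ultimately show ?thesis by (simp only: two_hY_hM mult_1 add.commute)
qed

lemma Eul_hX0: "Eul hX0 = hX0 * hX0 - 1"
  by (simp add: hX0_def Eul_derivation Eul_hM algebra_simps)

lemma Eul_hX1: "Eul (hX1 e) = hX0 * hX1 e"
  by (simp add: hX1_def hX0_def Eul_derivation Eul_hM Eul_hxe algebra_simps)

lemma di_Eul: "di j (Eul u) = di j u + Eul (di j u)"
proof -
  have "(\<Sum>i\<in>UNIV. (if j = i then 1 else 0) * di i u) = (\<Sum>i\<in>UNIV. if j = i then di i u else 0)"
    by (intro sum.cong) auto
  then show ?thesis
    by (simp add: Eul_def dv_simps sum.distrib dv_commute[of "(axis j 1, 0)"])
qed

lemma di_De: "di j (De e u) = De e (di j u)"
  by (simp add: De_def dv_simps dv_commute[of "(axis j 1, 0)"])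

lemma De_mult: "De e (u * v) = De e u * v + u * De e v"
  by (simp add: De_def dv_simps algebra_simps sum.distrib sum_distrib_left sum_distrib_right)

lemma De_sum: "De e (\<Sum>i\<in>I. f i) = (\<Sum>i\<in>I. De e (f i))"
  by (induction I rule: infinite_finite_induct)
    (simp_all add: De_def dv_simps distrib_left sum.distrib)

lemma De_hY: "De e hY = - hxe e"
  by (simp add: De_def di_hY hxe_def sum_negf)

text \<open>The functions \<open>hX0\<close> and \<open>hX1 e\<close> have Hessian \<open>X g\<close>, as has every linear function on the
  hyperboloid.\<close>

lemma hess2_hX0: "hess2 hX0 u = 2 * hX0 * Gam u u"
proof -
  define S where "S = (\<Sum>i\<in>UNIV. di i u * di i u)"
  define T where "T = (\<Sum>i\<in>UNIV. di i u * Eul (di i u))"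
  have 1: "Gam u (Eul u) = hb * (S + T)"
    by (simp add: Gam_def di_Eul S_def T_def distrib_left sum.distrib)
  have 2: "Eul (Gam u u) = Eul hb * S + hb * (2 * T)"
    by (simp add: Gam_def Eul_derivation Eul_sum S_def T_def sum_distrib_left sum.distrib algebra_simps)
  have "hess2 hX0 u = 2 * hb * S - Eul hb * S"
    by (simp add: hess2_def Gam_hX0 1 2 algebra_simps)
  also have "\<dots> = (2 * hY - 2 * hY * hY) * S"
    unfolding Eul_hb unfolding hb_hY by (simp add: algebra_simps)
  \<comment> \<open>Inserting 1 = 2 hY hM in the first term brings out the factor
    \<open>2 * hM - 1\<close>, which is \<open>hX0\<close>.\<close>
  also have "\<dots> = (2 * hY * (2 * hY * hM) - 2 * hY * hY) * S"
    by (simp only: two_hY_hM mult_1_right)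
  also have "\<dots> = 2 * hX0 * Gam u u"
    by (simp add: hX0_def Gam_def S_def hb_hY algebra_simps)
  finally show ?thesis .
qed

lemma hess2_hX1: "hess2 (hX1 e) u = 2 * hX1 e * Gam u u"
proof -
  define S where "S = (\<Sum>i\<in>UNIV. di i u * di i u)"
  define T where "T = (\<Sum>i\<in>UNIV. di i u * Eul (di i u))"
  define T' where "T' = (\<Sum>i\<in>UNIV. di i u * De e (di i u))"
  have E: "(\<Sum>i\<in>UNIV. di i u * (coord i * A)) = Eul u * A" for A
    by (simp add: Eul_def sum_distrib_left mult_ac)
  have D: "(\<Sum>i\<in>UNIV. di i u * (const (e $ i) * A)) = De e u * A" for A
    by (simp add: De_def sum_distrib_left mult_ac)
  have "Gam u (hY * De e u + hxe e * Eul u) = hb * (\<Sum>i\<in>UNIV. hY * (di i u * De e (di i u))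
      + di i u * (const (e $ i) * Eul u) - di i u * (coord i * De e u)
      + hxe e * (di i u * di i u) + hxe e * (di i u * Eul (di i u)))"
    by (simp add: Gam_def dv_simps di_hY di_hxe di_De di_Eul algebra_simps)
  also have "\<dots> = hb * (hY * T' + hxe e * S + hxe e * T)"
    by (simp only: sum.distrib sum_subtractf E D S_def T_def T'_def sum_distrib_left[symmetric])
      (simp add: algebra_simps)
  finally have 1: "Gam u (hY * De e u + hxe e * Eul u) = hb * (hY * T' + hxe e * S + hxe e * T)" .
  have 2: "Eul (Gam u u) = Eul hb * S + hb * (2 * T)"
    by (simp add: Gam_def Eul_derivation Eul_sum S_def T_def sum_distrib_left sum.distrib algebra_simps)
  have 3: "De e (Gam u u) = - 2 * hY * hxe e * S + hb * (2 * T')"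
    by (simp add: Gam_def De_mult De_sum hb_hY De_hY S_def T'_def sum_distrib_left sum.distrib
        sum_subtractf sum_negf algebra_simps)
  have "hess2 (hX1 e) u = (2 * hb + 2 * hY * hY - Eul hb) * hxe e * S"
    unfolding hess2_def Gam_hX1 1 2 3 by (simp add: algebra_simps)
  also have "\<dots> = 2 * hY * hxe e * S"
    unfolding Eul_hb unfolding hb_hY by (simp add: algebra_simps)
  also have "\<dots> = 2 * hY * (2 * hY * hM) * hxe e * S"
    by (simp only: two_hY_hM mult_1_right)
  also have "\<dots> = 2 * hX1 e * Gam u u"
    by (simp add: hX1_def Gam_def S_def hb_hY algebra_simps)
  finally show ?thesis .
qed

lemma Gam_hX1_hX1:
  assumes "norm e = 1"
  shows "Gam (hX1 e) (hX1 e) = 1 + hX1 e * hX1 e"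
proof -
  have "(\<Sum>i\<in>UNIV. e $ i * e $ i) = 1"
    using assms by (simp add: norm_eq_1 inner_vec_def)
  then have De1: "De e (hxe e) = 1"
    unfolding De_def di_hxe const_ring[symmetric]
    by (intro smooth_fun_eqI) (simp add: ev_simps)
  have DeM: "De e hM = 2 * hM * hM * hxe e"
    by (simp add: De_def di_hM hxe_def sum_distrib_left algebra_simps)
  have "De e 2 = 0" by (simp add: De_def dv_simps)
  then have "De e (hX1 e) = 2 * hM + 4 * hM * hM * hxe e * hxe e"
    by (simp add: hX1_def De_mult De1 DeM algebra_simps)
  then have "Gam (hX1 e) (hX1 e) = (2 * hY * hM) + (2 * hY * hM) * 2 * hM * hxe e * hxe e + hxe e * hX0 * hX1 e"
    by (simp add: Gam_hX1 Eul_hX1 algebra_simps)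
  then show ?thesis
    unfolding two_hY_hM by (simp add: hX1_def hX0_def algebra_simps)
qed

lemma Lap_hxe: "Lap (hxe e :: ('n::finite) smooth_fun) = const ((real CARD('n) - 2) / 2) * hN * hxe e"
  by (simp add: Lap_def di_hxe dv_simps Eul_hxe)

text \<open>This is the trace of the Hessian \<open>X g\<close>, computed in coordinates since
  \<open>hess2\<close> gives the Hessian only on gradients.\<close>

lemma Lap_hX0: "Lap (hX0 :: ('n::finite) smooth_fun) = const (real CARD('n)) * hX0"
proof -
  have "(\<Sum>i\<in>UNIV. di i (di i hX0)) = 16 * hM * hM * hM * (\<Sum>i\<in>UNIV. coord i * coord i)
      + 4 * const (real CARD('n)) * hM * (hM :: 'n smooth_fun)"
    by (simp add: di_hX0 dv_simps di_hM sum.distrib sum_distrib_left algebra_simps of_nat_real_const)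
  also have "(\<Sum>i\<in>UNIV. coord i * coord i) = 1 - (hN :: 'n smooth_fun)"
    by (simp add: hN_def)
  finally have *: "(\<Sum>i\<in>UNIV. di i (di i hX0)) = 16 * hM * hM * hM * (1 - hN)
      + 4 * const (real CARD('n)) * hM * (hM :: 'n smooth_fun)" .
  have L: "Lap hX0 = hb * (16 * hM * hM * hM * (1 - hN) + 4 * const (real CARD('n)) * hM * hM)
      + const ((real CARD('n) - 2) / 2) * hN * (hX0 * hX0 - (1 :: 'n smooth_fun))"
    unfolding Lap_def * Eul_hX0 ..
  show ?thesis
  proof (rule smooth_fun_eqI)
    fix z :: "(real ^ 'n) \<times> real" assume z: "z \<in> hyp_cylinder"
    show "ev (Lap hX0) z = ev (const (real CARD('n)) * hX0) z"
      unfolding L using hN_pos[OF z]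
      by (simp add: ev_simps z ev_hM hX0_def hb_def field_simps power2_eq_square)
  qed
qed

lemma Lap_hX1: "Lap (hX1 e :: ('n::finite) smooth_fun) = const (real CARD('n)) * hX1 e"
proof -
  have "hX1 e = (hX0 + 1) * hxe e" by (simp add: hX1_def hX0_def)
  then have *: "Lap (hX1 e) = const (real CARD('n)) * hX0 * hxe e
      + (hX0 + 1) * const ((real CARD('n) - 2) / 2) * hN * hxe e + 2 * hxe e"
    by (simp add: Lap_simps Lap_hX0 Lap_hxe Gam_simps Gam_hX0 Eul_hxe algebra_simps)
  show ?thesis
  proof (rule smooth_fun_eqI)
    fix z :: "(real ^ 'n) \<times> real" assume z: "z \<in> hyp_cylinder"
    show "ev (Lap (hX1 e)) z = ev (const (real CARD('n)) * hX1 e) z"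
      unfolding * using hN_pos[OF z]
      by (simp add: ev_simps z ev_hM hX0_def hX1_def field_simps)
  qed
qed

lemma dt_hX: "dt hX0 = 0" "dt (hX1 e) = 0"
  by (simp_all add: hX0_def hX1_def hxe_def dv_simps dt_hM)

lemma ev_hX:
  assumes "z \<in> hyp_cylinder"
  shows "ev hX0 z = (1 + (norm (fst z))\<^sup>2) / (1 - (norm (fst z))\<^sup>2)"
    and "ev (hX1 e) z = 2 * (fst z \<bullet> e) / (1 - (norm (fst z))\<^sup>2)"
proof -
  have "1 - (norm (fst z))\<^sup>2 > 0" using hN_pos[OF assms] by (simp add: ev_hN[OF assms])
  then show "ev hX0 z = (1 + (norm (fst z))\<^sup>2) / (1 - (norm (fst z))\<^sup>2)"
    "ev (hX1 e) z = 2 * (fst z \<bullet> e) / (1 - (norm (fst z))\<^sup>2)"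
    by (simp_all add: hX0_def hX1_def ev_simps ev_hM ev_hN ev_hxe assms field_simps)
qed

text \<open>On the hyperboloid X0^2 = 1 + |X|^2, and \<open>hX1 e\<close> is one component of X;
  Cauchy-Schwarz places the pair in the future cone.\<close>

lemma ev_hX_cone:
  assumes z: "z \<in> hyp_cylinder" and e: "norm e = 1"
  shows "ev hX0 z > 0" and "1 + (ev (hX1 e) z)\<^sup>2 \<le> (ev hX0 z)\<^sup>2"
proof -
  define r where "r = norm (fst z)"
  have N: "1 - r\<^sup>2 > 0" using hN_pos[OF z] by (simp add: ev_hN[OF z] r_def)
  show "ev hX0 z > 0"
    using N by (simp add: ev_hX[OF z] r_def[symmetric] add_pos_nonneg)
  have "\<bar>fst z \<bullet> e\<bar> \<le> r" using Cauchy_Schwarz_ineq2[of "fst z" e] e by (simp add: r_def)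
  then have "(fst z \<bullet> e)\<^sup>2 \<le> r\<^sup>2" by (simp add: r_def abs_le_square_iff[symmetric])
  then have "(1 - r\<^sup>2)\<^sup>2 + (2 * (fst z \<bullet> e))\<^sup>2 \<le> (1 + r\<^sup>2)\<^sup>2"
    by (simp add: power2_eq_square algebra_simps)
  then have "((1 - r\<^sup>2)\<^sup>2 + (2 * (fst z \<bullet> e))\<^sup>2) / (1 - r\<^sup>2)\<^sup>2 \<le> (1 + r\<^sup>2)\<^sup>2 / (1 - r\<^sup>2)\<^sup>2"
    by (rule divide_right_mono) simp
  then show "1 + (ev (hX1 e) z)\<^sup>2 \<le> (ev hX0 z)\<^sup>2"
  proof -
    assume *: "((1 - r\<^sup>2)\<^sup>2 + (2 * (fst z \<bullet> e))\<^sup>2) / (1 - r\<^sup>2)\<^sup>2 \<le> (1 + r\<^sup>2)\<^sup>2 / (1 - r\<^sup>2)\<^sup>2"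
    have "((1 - r\<^sup>2)\<^sup>2 + (2 * (fst z \<bullet> e))\<^sup>2) / (1 - r\<^sup>2)\<^sup>2 = 1 + (2 * (fst z \<bullet> e) / (1 - r\<^sup>2))\<^sup>2"
      using N by (simp add: add_divide_distrib power_divide)
    with * show ?thesis by (simp only: ev_hX[OF z] r_def[symmetric] power_divide)
  qed
qed

section \<open>Squared distance to a point moving along a geodesic\<close>

lemma smooth_cosh_sinh: "smooth_on UNIV (cosh :: real \<Rightarrow> real)" "smooth_on UNIV (sinh :: real \<Rightarrow> real)"
proof -
  let ?g = "\<lambda>k. if even k then cosh else (sinh :: real \<Rightarrow> real)"
  have d: "(?g k has_real_derivative ?g (Suc k) x) (at x)" for k x
    by (auto intro!: derivative_eq_intros)
  show "smooth_on UNIV (cosh :: real \<Rightarrow> real)" "smooth_on UNIV (sinh :: real \<Rightarrow> real)"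
    using smooth_on_real_sequence[where g = ?g and j = 0, OF open_UNIV d]
      smooth_on_real_sequence[where g = ?g and j = 1, OF open_UNIV d] by simp_all
qed

lemma smooth_exp: "smooth_on UNIV (exp :: real \<Rightarrow> real)"
  by (rule smooth_on_real_sequence[where g = "\<lambda>_. exp"]) (auto intro!: derivative_eq_intros)

lemma spatially_constant:
  assumes "\<And>i. di i f = 0"
  shows "Gam f u = 0" "Gam u f = 0" "Lap f = 0" "Eul f = 0"
  by (simp_all add: Gam_def Lap_def Eul_def assms dv_zero)

lemma hess2_mult_const:
  assumes "\<And>i. di i c = 0"
  shows "hess2 (c * f) u = c * hess2 f u"
  by (simp add: hess2_def Gam_simps spatially_constant[OF assms] algebra_simps)

lemma hess2_diff: "hess2 (f - g) u = hess2 f u - hess2 g u"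
  by (simp add: hess2_def Gam_simps algebra_simps)

lemma Gam_nonneg: "z \<in> hyp_cylinder \<Longrightarrow> ev (Gam u u) z \<ge> 0"
  by (simp add: Gam_def hb_def ev_simps sum_nonneg)

text \<open>\<open>hS\<close> is the arclength parameter of the moving point \<open>P(t)\<close>, \<open>hZ\<close> is \<open>cosh d(x, P(t))\<close>,
  and \<open>hW\<close> is the derivative of \<open>hZ\<close> with respect to that parameter.\<close>

definition hS :: "real \<Rightarrow> ('n::finite) smooth_fun" where
  "hS R = const (- R) * (time * (1 - time))"

definition hZ :: "real \<Rightarrow> real ^ 'n \<Rightarrow> ('n::finite) smooth_fun" where
  "hZ R e = fcomp cosh (hS R) * hX0 - fcomp sinh (hS R) * hX1 e"

definition hW :: "real \<Rightarrow> real ^ 'n \<Rightarrow> ('n::finite) smooth_fun" where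
  "hW R e = fcomp sinh (hS R) * hX0 - fcomp cosh (hS R) * hX1 e"

lemma ev_hS: "z \<in> hyp_cylinder \<Longrightarrow> ev (hS R) z = - (R * snd z * (1 - snd z))"
  by (simp add: hS_def ev_simps ev_time)

lemma dv_hS: "di i (hS R) = 0" "dt (hS R) = const (- R) * (1 - 2 * time)"
  by (simp_all add: hS_def dv_simps algebra_simps)

lemma dv_hS_comp:
  "dv v (fcomp cosh f) = fcomp sinh f * dv v f" "dv v (fcomp sinh f) = fcomp cosh f * dv v f"
  by (rule dv_fcomp[OF open_UNIV]; auto intro!: smooth_cosh_sinh derivative_eq_intros)+

lemma ev_cosh_sinh:
  "z \<in> hyp_cylinder \<Longrightarrow> ev (fcomp cosh f) z = cosh (ev f z)"
  "z \<in> hyp_cylinder \<Longrightarrow> ev (fcomp sinh f) z = sinh (ev f z)"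
  by (rule ev_fcomp[OF open_UNIV]; simp add: smooth_cosh_sinh)+

lemma cosh_sinh_ring: "fcomp cosh f * fcomp cosh f = 1 + fcomp sinh f * fcomp sinh f"
  by (rule smooth_fun_eqI) (simp add: ev_simps ev_cosh_sinh cosh_square_eq[unfolded power2_eq_square])

lemma dt_hZ: "dt (hZ R e) = dt (hS R) * hW R e" and dt_hW: "dt (hW R e) = dt (hS R) * hZ R e"
  by (simp_all add: hZ_def hW_def dv_simps dv_hS_comp dt_hX algebra_simps)

lemma Gam_hS: "di i (fcomp cosh (hS R)) = 0" "di i (fcomp sinh (hS R)) = 0"
  by (simp_all add: dv_hS_comp dv_hS)

lemmas Gam_const = spatially_constant[OF Gam_hS(1)] spatially_constant[OF Gam_hS(2)]

context
  fixes R :: real and e :: "real ^ 'n::finite"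
  assumes e: "norm e = 1"
begin

lemma Gam_hX_table:
  "Gam hX0 hX0 = hX0 * hX0 - 1" "Gam hX0 (hX1 e) = hX0 * hX1 e" "Gam (hX1 e) hX0 = hX0 * hX1 e"
  "Gam (hX1 e) (hX1 e) = 1 + hX1 e * hX1 e"
  using Gam_commute[of "hX1 e" hX0]
  by (simp_all add: Gam_hX0 Eul_hX0 Eul_hX1 Gam_hX1_hX1 e)

text \<open>The pair (Z, - W) arises from (X0, X1) by a hyperbolic rotation whose angle is constant
  in space, and the table of gradient products is invariant under such rotations.\<close>

lemma Gam_hZ_hZ: "Gam (hZ R e) (hZ R e) = hZ R e * hZ R e - 1" (is ?thesis1)
  and Gam_hZ_hW: "Gam (hZ R e) (hW R e) = hZ R e * hW R e" (is ?thesis2)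
  and Gam_hW_hW: "Gam (hW R e) (hW R e) = 1 + hW R e * hW R e" (is ?thesis3)
proof -
  let ?c = "fcomp cosh (hS R) :: 'n smooth_fun" and ?s = "fcomp sinh (hS R) :: 'n smooth_fun"
  \<comment> \<open>The extra factor lets rewriting reach cosh times cosh inside longer normalised
    products.\<close>
  have cs: "?c * (?c * a) = a + ?s * (?s * a)" for a
    using arg_cong[OF cosh_sinh_ring[of "hS R :: 'n smooth_fun"], of "\<lambda>x. x * a"]
    by (simp add: algebra_simps)
  show ?thesis1 ?thesis2 ?thesis3
    by (simp_all add: hZ_def hW_def Gam_simps Gam_const Gam_hX_table cs cosh_sinh_ring algebra_simps)
qed

lemma hess2_hZ: "hess2 (hZ R e) u = 2 * hZ R e * Gam u u"
  unfolding hZ_def hess2_diff hess2_mult_const[OF Gam_hS(1)] hess2_mult_const[OF Gam_hS(2)]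
    hess2_hX0 hess2_hX1
  by (simp add: algebra_simps)

lemma Lap_hZ: "Lap (hZ R e) = const (real CARD('n)) * hZ R e"
  by (simp add: hZ_def Lap_simps Gam_const Lap_hX0 Lap_hX1 algebra_simps)

text \<open>Hyperbolic rotation preserves X0^2 - X1^2 \<ge> 1 and the positivity of the first
  coordinate.\<close>

lemma hZ_ge_1:
  assumes z: "z \<in> hyp_cylinder"
  shows "ev (hZ R e) z \<ge> 1" and "(ev (hW R e) z)\<^sup>2 \<le> (ev (hZ R e) z)\<^sup>2 - 1"
proof -
  define s where "s = ev (hS R) z"
  define a where "a = ev hX0 z"
  define b where "b = ev (hX1 e) z"
  have a: "a > 0" "1 + b\<^sup>2 \<le> a\<^sup>2" using ev_hX_cone[OF z e] by (simp_all add: a_def b_def)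
  have Z: "ev (hZ R e) z = cosh s * a - sinh s * b" and W: "ev (hW R e) z = sinh s * a - cosh s * b"
    by (simp_all add: hZ_def hW_def ev_simps ev_cosh_sinh z s_def a_def b_def)
  have "(ev (hZ R e) z)\<^sup>2 - (ev (hW R e) z)\<^sup>2 = (cosh s ^ 2 - sinh s ^ 2) * (a\<^sup>2 - b\<^sup>2)"
    unfolding Z W by (simp add: power2_eq_square algebra_simps)
  then have ZW: "(ev (hZ R e) z)\<^sup>2 - (ev (hW R e) z)\<^sup>2 = a\<^sup>2 - b\<^sup>2"
    by (simp add: cosh_square_eq)
  then show 1: "(ev (hW R e) z)\<^sup>2 \<le> (ev (hZ R e) z)\<^sup>2 - 1" using a by simp
  have "\<bar>b\<bar> < a" using a power2_less_imp_less[of "\<bar>b\<bar>" a] by simp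
  moreover have "\<bar>sinh s\<bar> < cosh s" by (rule power2_less_imp_less) (simp_all add: cosh_square_eq)
  ultimately have "\<bar>sinh s\<bar> * \<bar>b\<bar> < cosh s * a" using a by (intro mult_strict_mono') auto
  then have "ev (hZ R e) z > 0" unfolding Z by (simp add: abs_mult[symmetric])
  moreover have "(ev (hZ R e) z)\<^sup>2 \<ge> 1\<^sup>2" 
    unfolding power_one using 1 zero_le_power2[of "ev (hW R e) z"] by linarith
  ultimately show "ev (hZ R e) z \<ge> 1" using power2_le_imp_le[of 1 "ev (hZ R e) z"] by simp
qed

text \<open>The squared length of a combination of the gradients of u, Z and W; in this form the
  metric enters the purely real inequality that follows.\<close>

lemma gram_nonneg:
  assumes z: "z \<in> hyp_cylinder"
  shows "a\<^sup>2 * ev (Gam u u) z + \<alpha>\<^sup>2 * ((ev (hZ R e) z)\<^sup>2 - 1) + \<beta>\<^sup>2 * (1 + (ev (hW R e) z)\<^sup>2)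
      + 2 * a * \<alpha> * ev (Gam (hZ R e) u) z + 2 * a * \<beta> * ev (Gam (hW R e) u) z
      + 2 * \<alpha> * \<beta> * (ev (hZ R e) z * ev (hW R e) z) \<ge> 0"
proof -
  let ?v = "const a * u + const \<alpha> * hZ R e + const \<beta> * hW R e"
  have "ev (Gam ?v ?v) z \<ge> 0" by (rule Gam_nonneg[OF z])
  then show ?thesis
    using Gam_commute[of u "hZ R e"] Gam_commute[of u "hW R e"] Gam_commute[of "hW R e" "hZ R e"]
    by (simp add: Gam_simps Gam_hZ_hZ Gam_hZ_hW Gam_hW_hW ev_simps z power2_eq_square algebra_simps)
qed

end

text \<open>With \<open>\<xi>\<close> and \<open>\<omega>\<close> the components of \<open>\<nabla>u\<close> and \<open>\<nabla>W\<close> orthogonal to \<open>\<nabla>Z\<close>, the left-hand side is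
  \<open>|\<xi> + b \<omega>|\<^sup>2 + (Z - 1) (|\<xi>|\<^sup>2 + b\<^sup>2 |\<omega>|\<^sup>2)\<close>.\<close>

lemma joint_convexity_algebra:
  fixes Z W g k m b :: real
  assumes Z: "Z > 1" and W: "W\<^sup>2 \<le> Z\<^sup>2 - 1"
    and gram: "\<And>a \<alpha> \<beta>. a\<^sup>2 * g + \<alpha>\<^sup>2 * (Z\<^sup>2 - 1) + \<beta>\<^sup>2 * (1 + W\<^sup>2) + 2 * a * \<alpha> * k + 2 * a * \<beta> * m
      + 2 * \<alpha> * \<beta> * (Z * W) \<ge> 0"
  shows "Z * g + 2 * b * m + b\<^sup>2 * Z - Z / (Z\<^sup>2 - 1) * (k + b * W)\<^sup>2 \<ge> 0"
proof -
  define D where "D = Z\<^sup>2 - 1"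
  have D: "D > 0" unfolding D_def using Z by (simp add: one_less_power)
  have Z2: "Z\<^sup>2 = D + 1" by (simp add: D_def)
  have Z2': "Z * (Z * x) = x + D * x" for x by (simp add: D_def power2_eq_square algebra_simps)
  have 1: "g - k\<^sup>2 / D \<ge> 0"
    using gram[of 1 "- k / D" 0, folded D_def] D by (simp add: power2_eq_square field_simps)
  have 2: "1 - W\<^sup>2 / D \<ge> 0" using W D by (simp add: D_def[symmetric] field_simps)
  \<comment> \<open>The coefficient \<alpha> = - (k + b Z W) / D makes the combination orthogonal to
    the gradient of Z, so the Gram form equals |\<xi> + b \<omega>|^2.\<close>
  have "g - k\<^sup>2 / D + 2 * b * (m - Z * W * k / D) + b\<^sup>2 * (1 - W\<^sup>2 / D)
      = 1\<^sup>2 * g + (- (k + b * Z * W) / D)\<^sup>2 * (Z\<^sup>2 - 1) + b\<^sup>2 * (1 + W\<^sup>2)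
        + 2 * 1 * (- (k + b * Z * W) / D) * k + 2 * 1 * b * m + 2 * (- (k + b * Z * W) / D) * b * (Z * W)"
    using D unfolding D_def[symmetric]
    by (simp add: power2_eq_square field_simps Z2')
  then have 3: "g - k\<^sup>2 / D + 2 * b * (m - Z * W * k / D) + b\<^sup>2 * (1 - W\<^sup>2 / D) \<ge> 0"
    using gram[of 1 "- (k + b * Z * W) / D" b] by simp
  have "Z * g + 2 * b * m + b\<^sup>2 * Z - Z / D * (k + b * W)\<^sup>2 =
      (g - k\<^sup>2 / D + 2 * b * (m - Z * W * k / D) + b\<^sup>2 * (1 - W\<^sup>2 / D))
      + (Z - 1) * ((g - k\<^sup>2 / D) + b\<^sup>2 * (1 - W\<^sup>2 / D))"
    using D by (simp add: power2_eq_square field_simps)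
  also have "\<dots> \<ge> 0"
    using 1 2 Z by (intro add_nonneg_nonneg[OF 3] mult_nonneg_nonneg add_nonneg_nonneg) auto
  finally show ?thesis by (simp add: D_def)
qed

text \<open>The differential equation gives (Z^2 - 1) G2 \<ge> - Z G1, so for Z > 1 the previous
  inequality, multiplied by G1, suffices. At Z = 1 both W and k vanish, and the Gram form with
  \<alpha> = 0 remains.\<close>

lemma joint_convexity:
  fixes Z W g k m b G1 G2 :: real
  assumes Z: "Z \<ge> 1" and W: "W\<^sup>2 \<le> Z\<^sup>2 - 1" and G1: "G1 > 0" and G2: "Z * G1 + (Z\<^sup>2 - 1) * G2 = 2"
    and gram: "\<And>a \<alpha> \<beta>. a\<^sup>2 * g + \<alpha>\<^sup>2 * (Z\<^sup>2 - 1) + \<beta>\<^sup>2 * (1 + W\<^sup>2) + 2 * a * \<alpha> * k + 2 * a * \<beta> * m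
      + 2 * \<alpha> * \<beta> * (Z * W) \<ge> 0"
  shows "G1 * (Z * g + 2 * b * m + b\<^sup>2 * Z) + G2 * (k + b * W)\<^sup>2 \<ge> 0"
proof (cases "Z = 1")
  case True
  then have W0: "W = 0" using W by simp
  \<comment> \<open>For Z = 1, a = 1 and \<beta> = 0 the Gram form is affine in \<alpha> with slope
    2 k; being bounded below, it has slope zero.\<close>
  have "k = 0"
  proof (rule ccontr)
    assume "k \<noteq> 0"
    then show False using gram[of 1 "- (g + 1) / (2 * k)" 0] True by (simp add: field_simps)
  qed
  then show ?thesis
    using gram[of 1 0 b] mult_nonneg_nonneg[of G1 "g + 2 * b * m + b\<^sup>2"] G1 True W0
    by (simp add: algebra_simps)
next
  case False
  then have Z1: "Z > 1" using Z by simp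
  then have D: "Z\<^sup>2 - 1 > 0" by (simp add: one_less_power)
  have "(Z\<^sup>2 - 1) * G2 \<ge> - (Z * G1)" using G2 by simp
  then have G2': "G2 \<ge> - (Z * G1) / (Z\<^sup>2 - 1)" by (subst pos_divide_le_eq[OF D]) (simp add: mult.commute)
  have "0 \<le> G1 * (Z * g + 2 * b * m + b\<^sup>2 * Z - Z / (Z\<^sup>2 - 1) * (k + b * W)\<^sup>2)"
    using joint_convexity_algebra[OF Z1 W gram] G1 by simp
  also have "\<dots> = G1 * (Z * g + 2 * b * m + b\<^sup>2 * Z) + - (Z * G1) / (Z\<^sup>2 - 1) * (k + b * W)\<^sup>2"
    by (simp add: algebra_simps)
  also have "\<dots> \<le> G1 * (Z * g + 2 * b * m + b\<^sup>2 * Z) + G2 * (k + b * W)\<^sup>2"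
    using G2' by (intro add_left_mono mult_right_mono) auto
  finally show ?thesis .
qed

context arcosh_square
begin

context
  fixes R :: real and e :: "real ^ 'n::finite"
  assumes e: "norm e = 1"
begin

text \<open>The squared distance to \<open>P(t)\<close>.\<close>

definition hF :: "'n smooth_fun" where "hF = fcomp G (hZ R e)"
definition hF1 :: "'n smooth_fun" where "hF1 = fcomp G1 (hZ R e)"
definition hF2 :: "'n smooth_fun" where "hF2 = fcomp G2 (hZ R e)"

lemma hZ_in_V: "z \<in> hyp_cylinder \<Longrightarrow> ev (hZ R e) z \<in> V"
  using hZ_ge_1(1)[OF e] V by auto

lemma ev_hF:
  assumes z: "z \<in> hyp_cylinder"
  shows "ev hF z = G (ev (hZ R e) z)" "ev hF1 z = G1 (ev (hZ R e) z)" "ev hF2 z = G2 (ev (hZ R e) z)"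
  unfolding hF_def hF1_def hF2_def
  by (rule ev_fcomp[OF open_V _ hZ_in_V z], use smooth_G in blast, blast)+

lemma dv_hF: "dv v hF = hF1 * dv v (hZ R e)" "dv v hF1 = hF2 * dv v (hZ R e)"
  unfolding hF_def hF1_def hF2_def
  by (rule dv_fcomp[OF open_V _ _ hZ_in_V]; use smooth_G DERIV_G DERIV_G1 in blast)+

lemma Gam_hF: "Gam hF u = hF1 * Gam (hZ R e) u" "Gam hF1 u = hF2 * Gam (hZ R e) u"
  "Gam u hF = hF1 * Gam (hZ R e) u" "Gam u hF1 = hF2 * Gam (hZ R e) u"
  by (simp_all add: Gam_def dv_hF sum_distrib_left mult_ac)

lemma hF1_sq: "hF1 * hF1 * (hZ R e * hZ R e - 1) = 4 * hF"
  and hF_ode: "hZ R e * hF1 + (hZ R e * hZ R e - 1) * hF2 = 2"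
proof -
  show "hF1 * hF1 * (hZ R e * hZ R e - 1) = 4 * hF"
  proof (rule smooth_fun_eqI)
    fix z :: "(real ^ 'n) \<times> real" assume z: "z \<in> hyp_cylinder"
    show "ev (hF1 * hF1 * (hZ R e * hZ R e - 1)) z = ev (4 * hF) z"
      using G1_sq[OF hZ_ge_1(1)[OF e z]] by (simp add: ev_simps z ev_hF power2_eq_square algebra_simps)
  qed
  show "hZ R e * hF1 + (hZ R e * hZ R e - 1) * hF2 = 2"
  proof (rule smooth_fun_eqI)
    fix z :: "(real ^ 'n) \<times> real" assume z: "z \<in> hyp_cylinder"
    show "ev (hZ R e * hF1 + (hZ R e * hZ R e - 1) * hF2) z = ev 2 z"
      using G_ode[OF hZ_ge_1(1)[OF e z]] by (simp add: ev_simps z ev_hF power2_eq_square algebra_simps)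
  qed
qed

lemma Gam_hF_hF: "Gam hF hF = 4 * hF"
proof -
  have "Gam hF hF = hF1 * hF1 * (hZ R e * hZ R e - 1)"
    by (simp add: Gam_hF Gam_hZ_hZ[OF e] mult_ac)
  then show ?thesis by (simp only: hF1_sq)
qed

lemma hess2_hF: "hess2 hF u = 2 * (hF1 * hZ R e * Gam u u + hF2 * Gam (hZ R e) u * Gam (hZ R e) u)"
proof -
  have "hess2 hF u = 2 * hF2 * Gam (hZ R e) u * Gam (hZ R e) u + hF1 * hess2 (hZ R e) u"
    by (simp add: hess2_def Gam_hF Gam_simps algebra_simps)
  then show ?thesis by (simp add: hess2_hZ[OF e] algebra_simps)
qed

text \<open>The differential equation removes \<open>hF2\<close>; in terms of d this is the
  classical 2 + 2 (n - 1) d coth d.\<close>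

lemma Lap_hF: "Lap hF = 2 + const (real CARD('n) - 1) * (hZ R e * hF1)"
proof -
  have "Lap hF = hF1 * Lap (hZ R e) + hF2 * Gam (hZ R e) (hZ R e)"
    by (simp add: Lap_def Gam_def dv_hF dv_mult Eul_def sum.distrib sum_distrib_left algebra_simps)
  also have "\<dots> = const (real CARD('n)) * (hZ R e * hF1) + (hZ R e * hZ R e - 1) * hF2"
    by (simp add: Lap_hZ[OF e] Gam_hZ_hZ[OF e] algebra_simps)
  also have "\<dots> = 2 + const (real CARD('n) - 1) * (hZ R e * hF1)"
    using hF_ode by (simp add: const_ring algebra_simps)
  finally show ?thesis .
qed

text \<open>The arclength parameter has second derivative 2 R; the last term is thus the effect of
  the acceleration of \<open>P\<close> along its geodesic.\<close>

lemma dt_hF: "dt hF = dt (hS R) * (hF1 * hW R e)"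
  "dt (dt hF) = dt (hS R) * dt (hS R) * (hF2 * hW R e * hW R e + hF1 * hZ R e) + const (2 * R) * (hF1 * hW R e)"
proof -
  show 1: "dt hF = dt (hS R) * (hF1 * hW R e)"
    by (simp add: dv_hF dt_hZ mult_ac)
  have dd: "dt (dt (hS R)) = const (2 * R)"
    unfolding dv_hS by (simp add: dv_simps const_ring)
  show "dt (dt hF) = dt (hS R) * dt (hS R) * (hF2 * hW R e * hW R e + hF1 * hZ R e)
      + const (2 * R) * (hF1 * hW R e)"
    unfolding 1 by (simp add: dv_mult dv_hF dt_hZ dt_hW dd algebra_simps)
qed

lemma Gam_dt_hF: "Gam (dt hF) u = dt (hS R) * (hF2 * hW R e * Gam (hZ R e) u + hF1 * Gam (hW R e) u)"
proof -
  have "di i (dt (hS R)) = 0" for i :: 'n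
    by (simp add: dv_commute[of "(axis i 1, 0)"] dv_hS dv_simps)
  then show ?thesis
    by (simp add: dt_hF(1) Gam_simps Gam_hF spatially_constant algebra_simps)
qed

lemma hF_nonneg: "z \<in> hyp_cylinder \<Longrightarrow> ev hF z \<ge> 0"
proof -
  assume z: "z \<in> hyp_cylinder"
  have "4 * ev hF z = ev (Gam hF hF) z" by (simp add: Gam_hF_hF ev_simps z)
  then show ?thesis using Gam_nonneg[OF z, of hF] by simp
qed

text \<open>A point of unit speed changes d at rate at most 1 and d^2 at rate at most 2 d; here this
  comes from W^2 \<le> Z^2 - 1 and the eikonal equation.\<close>

lemma hF_speed:
  assumes z: "z \<in> hyp_cylinder"
  shows "\<bar>ev (hF1 * hW R e) z\<bar> \<le> 2 * sqrt (ev hF z)"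
proof -
  have "(ev (hF1 * hW R e) z)\<^sup>2 = (ev hF1 z)\<^sup>2 * (ev (hW R e) z)\<^sup>2"
    by (simp add: ev_simps power_mult_distrib)
  also have "\<dots> \<le> (ev hF1 z)\<^sup>2 * ((ev (hZ R e) z)\<^sup>2 - 1)"
    using hZ_ge_1(2)[OF e z] by (intro mult_left_mono) auto
  also have "\<dots> = 4 * ev hF z"
    using G1_sq[OF hZ_ge_1(1)[OF e z]] by (simp add: ev_hF z mult.commute)
  also have "\<dots> = (2 * sqrt (ev hF z))\<^sup>2"
    using hF_nonneg[OF z] by (simp add: power_mult_distrib)
  finally have "\<bar>ev (hF1 * hW R e) z\<bar>\<^sup>2 \<le> (2 * sqrt (ev hF z))\<^sup>2" by simp
  then show ?thesis by (rule power2_le_imp_le) (simp add: hF_nonneg z)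
qed

text \<open>The expression is twice the Hessian of the squared distance in space and arclength
  jointly, on the vector formed by the gradient of u and b.\<close>

lemma hF_joint_convexity:
  assumes z: "z \<in> hyp_cylinder"
  shows "ev (hess2 hF u) z + 4 * b * ev (hF2 * hW R e * Gam (hZ R e) u + hF1 * Gam (hW R e) u) z
    + 2 * b\<^sup>2 * ev (hF2 * hW R e * hW R e + hF1 * hZ R e) z \<ge> 0"
proof -
  define Z where "Z = ev (hZ R e) z"
  define W where "W = ev (hW R e) z"
  have "G1 Z * (Z * ev (Gam u u) z + 2 * b * ev (Gam (hW R e) u) z + b\<^sup>2 * Z)
      + G2 Z * (ev (Gam (hZ R e) u) z + b * W)\<^sup>2 \<ge> 0"
    unfolding Z_def W_def
    by (rule joint_convexity[OF hZ_ge_1[OF e z] G1_pos[OF hZ_ge_1(1)[OF e z]]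
          G_ode[OF hZ_ge_1(1)[OF e z]] gram_nonneg[OF e z]])
  then show ?thesis
    by (simp add: hess2_hF ev_simps z ev_hF Z_def W_def power2_eq_square algebra_simps)
qed

text \<open>Z G1 = 2 - (Z^2 - 1) G2, and at the centre Z^2 - 1 vanishes with its gradient, so only
  G2 = - 2/3 and the Laplacian 2 n of Z^2 - 1 survive. The value is 4 n (n - 1) / 3, which is at
  least 8/3 for n \<ge> 2.\<close>

lemma Lap_Lap_hF_origin:
  assumes n: "CARD('n) \<ge> 2"
  shows "ev (Lap (Lap hF)) (0, 0) \<ge> 8 / 3"
proof -
  define n where "n = real CARD('n)"
  have o': "(0 :: real ^ 'n) \<in> hyp_space" by (simp add: hyp_space_def)
  then have o: "(0, 0) \<in> (hyp_cylinder :: ((real ^ 'n) \<times> real) set)" by simp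
  have S0: "ev (hS R) (0 :: real ^ 'n, 0) = 0" by (simp add: ev_hS[OF o])
  have X: "ev hX0 (0 :: real ^ 'n, 0) = 1" "ev (hX1 e) (0, 0) = 0" by (simp_all add: ev_hX[OF o])
  have Z: "ev (hZ R e) (0, 0) = 1"
    by (simp add: hZ_def ev_simps ev_cosh_sinh o' S0 X)
  have EO: "ev (Eul u) (0, 0) = 0" for u :: "'n smooth_fun"
    by (simp add: Eul_def ev_simps ev_coord o')
  have GZ: "ev (Gam (hZ R e) u) (0, 0) = 0" for u
    by (simp add: hZ_def Gam_simps Gam_const Gam_hX0 ev_simps ev_cosh_sinh o' S0 EO)
  let ?A = "hZ R e * hZ R e - 1"
  have ZF: "hZ R e * hF1 = 2 - ?A * hF2"
    using hF_ode by (simp add: algebra_simps)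
  have LZ: "ev (Lap (hZ R e)) (0, 0) = n" by (simp add: Lap_hZ[OF e] ev_simps o' Z n_def)
  have "Lap (Lap hF) = const (n - 1) * Lap (2 - ?A * hF2)"
    unfolding Lap_hF ZF by (simp add: Lap_simps Gam_simps n_def)
  then have "ev (Lap (Lap hF)) (0, 0) = (n - 1) * ev (Lap (2 - ?A * hF2)) (0, 0)"
    by (simp add: ev_simps o')
  also have "\<dots> = (n - 1) * (4 / 3 * n)"
    by (simp add: Lap_simps Gam_simps ev_simps o' Z GZ LZ ev_hF G_at_1)
  also have "\<dots> \<ge> (2 - 1) * (4 / 3 * 2)"
    using n by (intro mult_mono) (auto simp: n_def)
  finally show ?thesis by simp
qed

section \<open>The phase and the pointwise lower bound\<close>

definition phase :: "real \<Rightarrow> real \<Rightarrow> 'n smooth_fun" where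
  "phase \<mu> \<epsilon> = const \<mu> * hF + const (- ((1 + \<epsilon>) * R\<^sup>2 / (16 * \<mu>))) * (time * (1 - time))"

lemma hess2_const_mult: "hess2 (const c * f) u = const c * hess2 f (u :: 'n smooth_fun)"
  by (rule hess2_mult_const) (simp add: dv_const)

lemma hess2_add_const:
  assumes "\<And>i. di i c = 0"
  shows "hess2 (f + c) u = hess2 f (u :: 'n smooth_fun)"
  by (simp add: hess2_def Gam_simps spatially_constant[OF assms])

text \<open>Joint convexity absorbs the derivatives of p and q together with the part of the second
  time derivative quadratic in the speed. What is left is a quadratic polynomial in d times the
  squared modulus.\<close>

lemma quadratic_form_bound:
  fixes p q \<phi> :: "'n smooth_fun"
  assumes z: "z \<in> hyp_cylinder" and \<mu>: "\<mu> > 0" and R: "R > 0"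
    and C: "ev (Lap (Lap hF)) z \<le> C"
    and \<phi>_phase: "\<phi> = phase \<mu> \<epsilon>"
  shows "(\<epsilon> * R\<^sup>2 / (8 * \<mu>) - \<mu> * C) * ((ev p z)\<^sup>2 + (ev q z)\<^sup>2) \<le>
    ev (dt (dt \<phi>) * (p * p + q * q) + 4 * (p * Gam (dt \<phi>) q - q * Gam (dt \<phi>) p)
      + (2 * p * p * Gam \<phi> (Gam \<phi> \<phi>) + 2 * hess2 \<phi> p - p * p * Lap (Lap \<phi>))
      + (2 * q * q * Gam \<phi> (Gam \<phi> \<phi>) + 2 * hess2 \<phi> q - q * q * Lap (Lap \<phi>))) z"
proof -
  define c where "c = (1 + \<epsilon>) * R\<^sup>2 / (16 * \<mu>)"
  define tt where "tt = const (- c) * (time * (1 - time :: 'n smooth_fun))"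
  have \<phi>: "\<phi> = const \<mu> * hF + tt" by (simp add: \<phi>_phase phase_def tt_def c_def)
  have tt: "di i tt = 0" for i by (simp add: tt_def dv_simps)
  have dtt: "di i (dt tt) = 0" for i by (simp add: tt_def dv_simps)
  have ddtt: "dt (dt tt) = const (2 * c)" by (simp add: tt_def dv_simps const_ring)
  note sc = spatially_constant[OF tt] spatially_constant[OF dtt]
  define y where "y = sqrt (ev hF z)"
  have y: "y \<ge> 0" "ev hF z = y\<^sup>2" using hF_nonneg[OF z] by (simp_all add: y_def)
  define P where "P = ev p z"
  define Q where "Q = ev q z"
  define s where "s = ev (dt (hS R)) z"
  define A where "A u = ev (hF2 * hW R e * Gam (hZ R e) u + hF1 * Gam (hW R e) u) z" for u
  define B where "B = ev (hF2 * hW R e * hW R e + hF1 * hZ R e) z"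
  define w where "w = ev (hF1 * hW R e) z"
  define L where "L = ev (Lap (Lap hF)) z"
  have 1: "ev (dt (dt \<phi>)) z = \<mu> * (s\<^sup>2 * B + 2 * R * w) + 2 * c"
    unfolding \<phi> dv_add dv_mult dv_const ddtt
    by (simp add: dv_mult dv_zero dv_const dt_hF(2) ev_simps z s_def B_def w_def power2_eq_square)
  have 2: "ev (Gam (dt \<phi>) u) z = \<mu> * (s * A u)" for u
    by (simp add: \<phi> dv_add dv_mult dv_const Gam_simps sc Gam_dt_hF ev_simps z s_def A_def)
  have 3: "ev (Gam \<phi> (Gam \<phi> \<phi>)) z = 16 * \<mu> ^ 3 * y\<^sup>2"
    by (simp add: \<phi> Gam_simps sc Gam_hF_hF ev_simps z y power3_eq_cube)
  have 4: "ev (hess2 \<phi> u) z = \<mu> * ev (hess2 hF u) z" for u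
    by (simp add: \<phi> hess2_add_const[OF tt] hess2_const_mult ev_simps z)
  have 5: "ev (Lap (Lap \<phi>)) z = \<mu> * L"
    by (simp add: \<phi> Lap_simps Gam_simps sc ev_simps z L_def)
  \<comment> \<open>The values - s Q / 2 and s P / 2 of b are chosen so that, after multiplication
    by 2 \<mu>, the mixed terms are those of the quadratic form and the squares add up to \<mu> s^2
    B (P^2 + Q^2).\<close>
  have J1: "ev (hess2 hF p) z + 4 * (- s * Q / 2) * A p + 2 * (- s * Q / 2)\<^sup>2 * B \<ge> 0"
    using hF_joint_convexity[OF z, of p "- s * Q / 2"] by (simp add: A_def B_def)
  have J2: "ev (hess2 hF q) z + 4 * (s * P / 2) * A q + 2 * (s * P / 2)\<^sup>2 * B \<ge> 0"
    using hF_joint_convexity[OF z, of q "s * P / 2"] by (simp add: A_def B_def)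
  have "\<bar>w\<bar> \<le> 2 * y" unfolding w_def y_def by (rule hF_speed[OF z])
  then have "2 * R * \<mu> * w \<ge> 2 * R * \<mu> * (- 2 * y)" using R \<mu> by (intro mult_left_mono) auto
  moreover have "32 * \<mu> ^ 3 * y\<^sup>2 - 4 * R * \<mu> * y + R\<^sup>2 / (8 * \<mu>) = 32 * \<mu> ^ 3 * (y - R / (16 * \<mu>\<^sup>2))\<^sup>2"
    using \<mu> by (simp add: power2_eq_square power3_eq_cube field_simps)
  moreover have "32 * \<mu> ^ 3 * (y - R / (16 * \<mu>\<^sup>2))\<^sup>2 \<ge> 0" using \<mu> by simp
  moreover have "2 * c = R\<^sup>2 / (8 * \<mu>) + \<epsilon> * R\<^sup>2 / (8 * \<mu>)"
    using \<mu> by (simp add: c_def field_simps)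
  moreover have "\<mu> * L \<le> \<mu> * C" using C \<mu> by (simp add: L_def)
  ultimately have "\<epsilon> * R\<^sup>2 / (8 * \<mu>) - \<mu> * C \<le> 2 * R * \<mu> * w + 2 * c + 32 * \<mu> ^ 3 * y\<^sup>2 - \<mu> * L"
    by linarith
  then have "(\<epsilon> * R\<^sup>2 / (8 * \<mu>) - \<mu> * C) * (P\<^sup>2 + Q\<^sup>2) \<le>
      (2 * R * \<mu> * w + 2 * c + 32 * \<mu> ^ 3 * y\<^sup>2 - \<mu> * L) * (P\<^sup>2 + Q\<^sup>2)"
    by (intro mult_right_mono) auto
  also have "\<dots> \<le> (2 * R * \<mu> * w + 2 * c + 32 * \<mu> ^ 3 * y\<^sup>2 - \<mu> * L) * (P\<^sup>2 + Q\<^sup>2)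
      + 2 * \<mu> * (ev (hess2 hF p) z + 4 * (- s * Q / 2) * A p + 2 * (- s * Q / 2)\<^sup>2 * B)
      + 2 * \<mu> * (ev (hess2 hF q) z + 4 * (s * P / 2) * A q + 2 * (s * P / 2)\<^sup>2 * B)"
    using J1 J2 \<mu> by simp
  also have "\<dots> = (\<mu> * (s\<^sup>2 * B + 2 * R * w) + 2 * c) * (P * P + Q * Q)
      + 4 * (P * (\<mu> * (s * A q)) - Q * (\<mu> * (s * A p)))
      + (2 * P * P * (16 * \<mu> ^ 3 * y\<^sup>2) + 2 * (\<mu> * ev (hess2 hF p) z) - P * P * (\<mu> * L))
      + (2 * Q * Q * (16 * \<mu> ^ 3 * y\<^sup>2) + 2 * (\<mu> * ev (hess2 hF q) z) - Q * Q * (\<mu> * L))"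
    by (simp add: power2_eq_square algebra_simps)
  also have "\<dots> = ev (dt (dt \<phi>) * (p * p + q * q) + 4 * (p * Gam (dt \<phi>) q - q * Gam (dt \<phi>) p)
      + (2 * p * p * Gam \<phi> (Gam \<phi> \<phi>) + 2 * hess2 \<phi> p - p * p * Lap (Lap \<phi>))
      + (2 * q * q * Gam \<phi> (Gam \<phi> \<phi>) + 2 * hess2 \<phi> q - q * q * Lap (Lap \<phi>))) z"
    by (simp only: ev_simps(1-6) ev_numeral[OF z] 1 2 3 4 5 P_def Q_def)
  finally show ?thesis by (simp add: P_def Q_def)
qed

end

end

section \<open>The hyperbolic distance\<close>

lemma hyp_space_pos: "x \<in> hyp_space \<Longrightarrow> 1 - (norm x)\<^sup>2 > 0"
  by (simp add: hyp_space_def abs_square_less_1)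

lemma riem_inner_hyp: "riem_inner hyp_metric x v w = 4 / (1 - (norm x)\<^sup>2)\<^sup>2 * (v \<bullet> w)"
  by (simp add: riem_inner_def hyp_metric_def scaleR_matrix_vector_assoc[symmetric])

lemma riem_norm_hyp: "x \<in> hyp_space \<Longrightarrow> riem_norm hyp_metric x v = 2 * norm v / (1 - (norm x)\<^sup>2)"
  using hyp_space_pos[of x]
  by (simp add: riem_norm_def riem_inner_hyp power2_norm_eq_inner[symmetric] real_sqrt_mult
      real_sqrt_divide)

lemma hyperboloid_norm:
  fixes u :: "'a::real_inner"
  assumes "a\<^sup>2 - u \<bullet> u = 1" "a > 0"
  shows "1 - (norm (u /\<^sub>R (1 + a)))\<^sup>2 = 2 / (1 + a)"
proof -
  have "(norm u)\<^sup>2 = (a - 1) * (1 + a)"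
    unfolding power2_norm_eq_inner using assms(1) by (simp add: power2_eq_square algebra_simps)
  moreover have "(norm (u /\<^sub>R (1 + a)))\<^sup>2 = (norm u)\<^sup>2 / (1 + a)\<^sup>2"
    by (simp add: power_mult_distrib divide_inverse power_inverse mult.commute)
  ultimately have "(norm (u /\<^sub>R (1 + a)))\<^sup>2 = (a - 1) / (1 + a)"
    using assms(2) by (simp add: power2_eq_square)
  then show ?thesis using assms(2) by (simp add: field_simps)
qed

text \<open>Two points of the hyperboloid are joined by the intersection with the plane they span,
  which stereographic projection maps to a curve of constant speed in the ball.\<close>

lemma hyperboloid_geodesic:
  fixes u v :: "real ^ 'n::finite" and a b \<rho> :: real
  assumes a: "a\<^sup>2 - u \<bullet> u = 1" "a > 0" and b: "b\<^sup>2 - v \<bullet> v = 1" "b > 0"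
    and \<rho>: "a * b - u \<bullet> v = cosh \<rho>" "\<rho> > 0"
  shows "\<exists>\<gamma>. valid_path \<gamma> \<and> path_image \<gamma> \<subseteq> hyp_space \<and>
     pathstart \<gamma> = u /\<^sub>R (1 + a) \<and> pathfinish \<gamma> = v /\<^sub>R (1 + b) \<and>
     ((\<lambda>s. riem_norm hyp_metric (\<gamma> s) (vector_derivative \<gamma> (at s))) has_integral \<rho>) {0..1}"
proof -
  define S where "S = sinh \<rho>"
  have S: "S > 0" using \<rho> by (simp add: S_def)
  \<comment> \<open>The hyperbolic analogue of spherical linear interpolation: these coefficients
    keep the combination on the hyperboloid, at constant speed \<rho>.\<close>
  define A where "A t = sinh (\<rho> - \<rho> * t) / S" for t
  define B where "B t = sinh (\<rho> * t) / S" for t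
  define A' where "A' t = - (\<rho> * cosh (\<rho> - \<rho> * t) / S)" for t
  define B' where "B' t = \<rho> * cosh (\<rho> * t) / S" for t
  define y where "y t = A t * a + B t * b" for t
  define U where "U t = A t *\<^sub>R u + B t *\<^sub>R v" for t
  define y' where "y' t = A' t * a + B' t * b" for t
  define U' where "U' t = A' t *\<^sub>R u + B' t *\<^sub>R v" for t
  define \<gamma> where "\<gamma> t = U t /\<^sub>R (1 + y t)" for t
  define \<gamma>' where "\<gamma>' t = U' t /\<^sub>R (1 + y t) - (y' t / (1 + y t)\<^sup>2) *\<^sub>R U t" for t
  have AB: "(A t)\<^sup>2 + (B t)\<^sup>2 + 2 * A t * B t * cosh \<rho> = 1"
    and AB': "(A' t)\<^sup>2 + (B' t)\<^sup>2 + 2 * A' t * B' t * cosh \<rho> = - \<rho>\<^sup>2" for t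
  proof -
    define r where "r = \<rho> - \<rho> * t"
    define q where "q = \<rho> * t"
    have rq: "\<rho> = r + q" by (simp add: r_def q_def)
    have C: "cosh x * cosh x = sinh x * sinh x + 1" for x :: real
      using cosh_square_eq[of x] by (simp add: power2_eq_square)
    have C': "cosh x * (cosh x * c) = sinh x * (sinh x * c) + c" for x c :: real
      by (simp only: mult.assoc[symmetric] C) (simp add: algebra_simps)
    have "(sinh r)\<^sup>2 + (sinh q)\<^sup>2 + 2 * sinh r * sinh q * cosh (r + q) = (sinh (r + q))\<^sup>2"
      by (simp add: sinh_add cosh_add power2_eq_square algebra_simps C C')
    then have 1: "(sinh r)\<^sup>2 + (sinh q)\<^sup>2 + 2 * sinh r * sinh q * cosh \<rho> = S\<^sup>2"
      by (simp add: S_def rq[symmetric])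
    have "(A t)\<^sup>2 + (B t)\<^sup>2 + 2 * A t * B t * cosh \<rho>
        = ((sinh r)\<^sup>2 + (sinh q)\<^sup>2 + 2 * sinh r * sinh q * cosh \<rho>) / S\<^sup>2"
      using S by (simp add: A_def B_def r_def q_def power2_eq_square add_divide_distrib)
    then show "(A t)\<^sup>2 + (B t)\<^sup>2 + 2 * A t * B t * cosh \<rho> = 1" unfolding 1 using S by simp
    have "(cosh r)\<^sup>2 + (cosh q)\<^sup>2 - 2 * cosh r * cosh q * cosh (r + q) = - (sinh (r + q))\<^sup>2"
      by (simp add: sinh_add cosh_add power2_eq_square algebra_simps C C')
    then have 2: "(cosh r)\<^sup>2 + (cosh q)\<^sup>2 - 2 * cosh r * cosh q * cosh \<rho> = - (S\<^sup>2)"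
      by (simp add: S_def rq[symmetric])
    have "(A' t)\<^sup>2 + (B' t)\<^sup>2 + 2 * A' t * B' t * cosh \<rho>
        = \<rho>\<^sup>2 * ((cosh r)\<^sup>2 + (cosh q)\<^sup>2 - 2 * cosh r * cosh q * cosh \<rho>) / S\<^sup>2"
      using S by (simp add: A'_def B'_def r_def q_def power2_eq_square field_simps)
    then show "(A' t)\<^sup>2 + (B' t)\<^sup>2 + 2 * A' t * B' t * cosh \<rho> = - \<rho>\<^sup>2" unfolding 2 using S by simp
  qed
  have lorentz: "(x * a + w * b)\<^sup>2 - (x *\<^sub>R u + w *\<^sub>R v) \<bullet> (x *\<^sub>R u + w *\<^sub>R v)
      = x\<^sup>2 + w\<^sup>2 + 2 * x * w * cosh \<rho>" for x w
  proof -
    have "(x * a + w * b)\<^sup>2 - (x *\<^sub>R u + w *\<^sub>R v) \<bullet> (x *\<^sub>R u + w *\<^sub>R v)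
        = x\<^sup>2 * (a\<^sup>2 - u \<bullet> u) + w\<^sup>2 * (b\<^sup>2 - v \<bullet> v) + 2 * x * w * (a * b - u \<bullet> v)"
      by (simp add: inner_add_left inner_add_right inner_commute[of v u] power2_eq_square algebra_simps)
    then show ?thesis by (simp add: a b \<rho>)
  qed
  have hyp: "(y t)\<^sup>2 - U t \<bullet> U t = 1" and speed: "(y' t)\<^sup>2 - U' t \<bullet> U' t = - \<rho>\<^sup>2" for t
    unfolding y_def U_def y'_def U'_def lorentz using AB AB' by auto
  have dA: "(A has_real_derivative A' t) (at t)" and dB: "(B has_real_derivative B' t) (at t)" for t
    unfolding A_def[abs_def] B_def[abs_def] A'_def B'_def
    using S by (auto intro!: derivative_eq_intros simp: field_simps)
  have dy: "(y has_real_derivative y' t) (at t)" for t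
    unfolding y_def[abs_def] y'_def by (auto intro!: derivative_eq_intros dA dB)
  have dU: "(U has_vector_derivative U' t) (at t)" for t
    unfolding U_def[abs_def] U'_def
    by (auto intro!: derivative_eq_intros dA dB simp: has_real_derivative_iff_has_vector_derivative[symmetric])
  \<comment> \<open>The constraint y^2 - |U|^2 = 1, differentiated.\<close>
  have orth: "y t * y' t = U t \<bullet> U' t" for t
  proof -
    have "((\<lambda>t. (y t)\<^sup>2 - U t \<bullet> U t) has_real_derivative 2 * y t * y' t - 2 * (U t \<bullet> U' t)) (at t)"
    proof -
      have "((\<lambda>t. U t \<bullet> U t) has_real_derivative (U t \<bullet> U' t + U' t \<bullet> U t)) (at t)"
        using bounded_bilinear.has_vector_derivative[OF bounded_bilinear_inner dU dU]
        by (simp add: has_real_derivative_iff_has_vector_derivative)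
      from DERIV_diff[OF DERIV_power[OF dy, of 2] this] show ?thesis
        by (simp add: inner_commute mult_ac)
    qed
    moreover have "((\<lambda>t. (y t)\<^sup>2 - U t \<bullet> U t) has_real_derivative 0) (at t)"
      unfolding hyp by simp
    ultimately have "2 * y t * y' t - 2 * (U t \<bullet> U' t) = 0" by (rule DERIV_unique)
    then show ?thesis by simp
  qed
  have ypos: "y t > 0" if "t \<in> {0..1}" for t
  proof -
    have "A t \<ge> 0" "B t \<ge> 0" using that \<rho>(2) S by (auto simp: A_def B_def mult_left_le)
    moreover have "A t \<noteq> 0 \<or> B t \<noteq> 0" using AB[of t] by auto
    ultimately have "A t > 0 \<and> B t \<ge> 0 \<or> A t \<ge> 0 \<and> B t > 0" by linarith
    then show ?thesis
      using a(2) b(2) by (auto simp: y_def intro: add_nonneg_pos add_pos_nonneg)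
  qed
  have d\<gamma>: "(\<gamma> has_vector_derivative \<gamma>' t) (at t)" if "t \<in> {0..1}" for t
  proof -
    have y0: "1 + y t \<noteq> 0" using ypos[OF that] by simp
    have "((\<lambda>t. inverse (1 + y t)) has_real_derivative - (y' t / (1 + y t)\<^sup>2)) (at t)"
      by (rule derivative_eq_intros dy refl y0 | simp add: power2_eq_square divide_inverse)+
    from has_vector_derivative_scaleR[OF this dU]
    show ?thesis
      unfolding \<gamma>_def[abs_def] \<gamma>'_def by (simp add: algebra_simps)
  qed
  have in_ball: "\<gamma> t \<in> hyp_space" and N: "1 - (norm (\<gamma> t))\<^sup>2 = 2 / (1 + y t)" if "t \<in> {0..1}" for t
  proof -
    show N: "1 - (norm (\<gamma> t))\<^sup>2 = 2 / (1 + y t)"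
      unfolding \<gamma>_def by (rule hyperboloid_norm[OF hyp ypos[OF that]])
    have "2 / (1 + y t) > 0" using ypos[OF that] by simp
    then have "(norm (\<gamma> t))\<^sup>2 < 1" using N by linarith
    then show "\<gamma> t \<in> hyp_space" by (simp add: hyp_space_def abs_square_less_1)
  qed
  have len: "riem_norm hyp_metric (\<gamma> t) (vector_derivative \<gamma> (at t)) = \<rho>" if "t \<in> {0..1}" for t
  proof -
    define k where "k = 1 + y t"
    have k: "k > 0" using ypos[OF that] by (simp add: k_def)
    \<comment> \<open>All inner products are expressed by k = 1 + y and y', after which the squared
      norm of k \<gamma>' collapses to \<rho>^2.\<close>
    have UU: "U t \<bullet> U t = k * (k - 2)" "U' t \<bullet> U' t = (y' t)\<^sup>2 + \<rho>\<^sup>2" "U t \<bullet> U' t = (k - 1) * y' t"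
      using hyp[of t] speed[of t] orth[of t] by (auto simp: k_def power2_eq_square algebra_simps)
    have "(k * norm (\<gamma>' t))\<^sup>2 = (norm (k *\<^sub>R \<gamma>' t))\<^sup>2" using k by simp
    also have "k *\<^sub>R \<gamma>' t = U' t - (y' t / k) *\<^sub>R U t"
      using k by (simp add: \<gamma>'_def k_def[symmetric] power2_eq_square algebra_simps)
    also have "(norm (U' t - (y' t / k) *\<^sub>R U t))\<^sup>2
        = U' t \<bullet> U' t - 2 * (y' t / k) * (U t \<bullet> U' t) + (y' t / k)\<^sup>2 * (U t \<bullet> U t)"
      unfolding power2_norm_eq_inner
      by (simp add: inner_diff_left inner_diff_right inner_commute[of "U' t" "U t"] power2_eq_square algebra_simps)
    also have "\<dots> = \<rho>\<^sup>2"
      unfolding UU using k by (simp add: power2_eq_square field_simps)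
    finally have "k * norm (\<gamma>' t) = \<rho>"
      using k \<rho>(2) by (subst (asm) power2_eq_iff_nonneg) auto
    then show ?thesis
      unfolding vector_derivative_at[OF d\<gamma>[OF that]] riem_norm_hyp[OF in_ball[OF that]] N[OF that]
      using k by (simp add: k_def[symmetric] mult.commute)
  qed
  have cy: "continuous_on {0..1} y" "continuous_on {0..1} U"
    by (intro continuous_at_imp_continuous_on ballI DERIV_isCont[OF dy]
        has_vector_derivative_continuous[OF dU])+
  have "continuous_on {0..1} \<gamma>'"
    unfolding \<gamma>'_def[abs_def] y'_def[abs_def] U'_def[abs_def] A'_def[abs_def] B'_def[abs_def]
    using S ypos by (intro continuous_intros cy) force+
  then have "\<gamma> C1_differentiable_on {0..1}"
    unfolding C1_differentiable_on_def using d\<gamma> by blast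
  then have "valid_path \<gamma>"
    unfolding valid_path_def by (rule C1_differentiable_imp_piecewise)
  moreover have "path_image \<gamma> \<subseteq> hyp_space" unfolding path_image_def using in_ball by auto
  moreover have "pathstart \<gamma> = u /\<^sub>R (1 + a)" "pathfinish \<gamma> = v /\<^sub>R (1 + b)"
    using S by (simp_all add: pathstart_def pathfinish_def \<gamma>_def U_def y_def A_def B_def S_def[symmetric])
  moreover have "((\<lambda>s. riem_norm hyp_metric (\<gamma> s) (vector_derivative \<gamma> (at s))) has_integral \<rho>) {0..1}"
  proof -
    have "((\<lambda>_. \<rho>) has_integral \<rho>) {0..1::real}" using has_integral_const_real[of \<rho> 0 1] by simp
    then show ?thesis by (rule has_integral_eq[rotated]) (simp add: len)
  qed
  ultimately show ?thesis by blast
qed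

text \<open>\<open>hyp_point e s\<close> is the point at signed distance \<open>s\<close> from the origin in direction \<open>e\<close>.\<close>

definition hyp_point :: "real ^ 'n::finite \<Rightarrow> real \<Rightarrow> real ^ 'n" where
  "hyp_point e s = (sinh s / (1 + cosh s)) *\<^sub>R e"

text \<open>The Lorentz product, up to sign, of the hyperboloid coordinates of x and of
  \<open>hyp_point e s\<close>.\<close>

definition cosh_dist :: "real ^ 'n::finite \<Rightarrow> real \<Rightarrow> real ^ 'n \<Rightarrow> real" where
  "cosh_dist e s x = cosh s * ((1 + (norm x)\<^sup>2) / (1 - (norm x)\<^sup>2)) - sinh s * (2 * (x \<bullet> e) / (1 - (norm x)\<^sup>2))"

lemma ev_hZ:
  assumes "x \<in> hyp_space"
  shows "ev (hZ R e) (x, t) = cosh_dist e (- (R * t * (1 - t))) x"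
proof -
  have z: "(x, t) \<in> hyp_cylinder" using assms by simp
  show ?thesis
    using ev_hX[OF z] ev_hS[OF z, of R] ev_cosh_sinh[OF z]
    by (simp add: hZ_def ev_ring cosh_dist_def)
qed

lemma hyp_point_in_hyp_space:
  assumes "norm e = 1"
  shows "hyp_point e s \<in> hyp_space"
proof -
  have "\<bar>sinh s\<bar> < 1 + cosh s"
    using sinh_less_cosh_real[of "\<bar>s\<bar>"] by (simp add: sinh_real_abs)
  moreover have "1 + cosh s > 0" by (simp add: add_pos_pos)
  ultimately show ?thesis
    using assms by (simp add: hyp_point_def hyp_space_def)
qed

lemma hyp_point_coords:
  assumes "norm e = 1"
  shows "(norm (hyp_point e s))\<^sup>2 = (cosh s - 1) / (cosh s + 1)"
    and "1 - (norm (hyp_point e s))\<^sup>2 = 2 / (1 + cosh s)"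
proof -
  have c: "1 + cosh s > 0" by (simp add: add_pos_pos)
  have "(norm (hyp_point e s))\<^sup>2 = (sinh s)\<^sup>2 / (1 + cosh s)\<^sup>2"
    using assms by (simp add: hyp_point_def power_divide)
  also have "(sinh s)\<^sup>2 = (cosh s - 1) * (cosh s + 1)"
    using cosh_square_eq[of s] by (simp add: power2_eq_square algebra_simps)
  finally show 1: "(norm (hyp_point e s))\<^sup>2 = (cosh s - 1) / (cosh s + 1)"
    using c by (simp add: power2_eq_square add.commute)
  show "1 - (norm (hyp_point e s))\<^sup>2 = 2 / (1 + cosh s)"
    unfolding 1 using c by (simp add: field_simps)
qed

lemma cosh_dist_hyp_point:
  assumes e: "norm e = 1"
  shows "cosh_dist e s (hyp_point e s) = 1"
proof -
  have c: "1 + cosh s > 0" by (simp add: add_pos_pos)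
  have "(1 + (norm (hyp_point e s))\<^sup>2) / (1 - (norm (hyp_point e s))\<^sup>2) = cosh s"
    unfolding hyp_point_coords[OF e] using c by (simp add: field_simps)
  moreover have "2 * (hyp_point e s \<bullet> e) / (1 - (norm (hyp_point e s))\<^sup>2) = sinh s"
    unfolding hyp_point_coords(2)[OF e] using c e by (simp add: hyp_point_def norm_eq_1)
  ultimately show ?thesis
    using cosh_square_eq[of s] by (simp only: cosh_dist_def) (simp add: power2_eq_square)
qed

text \<open>The squared Euclidean distance from x to the point is a positive multiple of
  \<open>cosh_dist e s x - 1\<close>.\<close>

lemma cosh_dist_eq_1D:
  assumes e: "norm e = 1" and x: "x \<in> hyp_space" and "cosh_dist e s x = 1"
  shows "x = hyp_point e s"
proof -
  have N: "1 - (norm x)\<^sup>2 > 0" by (rule hyp_space_pos[OF x])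
  have c: "1 + cosh s > 0" by (simp add: add_pos_pos)
  have "cosh_dist e s x * (1 - (norm x)\<^sup>2) = 1 - (norm x)\<^sup>2" using assms(3) by simp
  then have "cosh s * (1 + (norm x)\<^sup>2) - sinh s * (2 * (x \<bullet> e)) = 1 - (norm x)\<^sup>2"
    using N by (simp add: cosh_dist_def left_diff_distrib)
  then have *: "(cosh s - 1) + (cosh s + 1) * (norm x)\<^sup>2 - 2 * sinh s * (x \<bullet> e) = 0"
    by (simp add: algebra_simps)
  have "(norm (x - hyp_point e s))\<^sup>2 = (norm x)\<^sup>2 - 2 * (x \<bullet> hyp_point e s) + (norm (hyp_point e s))\<^sup>2"
    by (simp add: power2_norm_eq_inner inner_diff_left inner_diff_right inner_commute)
  also have "\<dots> = ((cosh s - 1) + (cosh s + 1) * (norm x)\<^sup>2 - 2 * sinh s * (x \<bullet> e)) / (1 + cosh s)"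
  proof -
    have "n - 2 * (sinh s / k * d) + (k - 2) / k = ((k - 2) + k * n - 2 * sinh s * d) / k"
      if "k > 0" for n d k
      using that by (simp add: field_simps)
    from this[OF c] show ?thesis
      unfolding hyp_point_coords[OF e] by (simp add: hyp_point_def add.commute)
  qed
  finally show ?thesis unfolding * by simp
qed

lemma dv_sum_di: "z \<in> hyp_cylinder \<Longrightarrow> ev (dv (v, 0) f) z = (\<Sum>i\<in>UNIV. v $ i * ev (di i f) z)"
proof -
  assume z: "z \<in> hyp_cylinder"
  interpret l: linear "\<lambda>v. ev (dv v f) z"
    using ev_has_derivative[OF z] has_derivative_linear by blast
  have v: "(v, 0 :: real) = (\<Sum>i\<in>UNIV. v $ i *\<^sub>R (axis i 1, 0))"
    by (simp add: prod_eq_iff fst_sum snd_sum basis_expansion[of v, unfolded scalar_mult_eq_scaleR])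
  show ?thesis by (subst v) (simp only: l.sum l.scaleR real_scaleR_def)
qed

lemma cosh_dist_derivative:
  assumes e: "norm e = 1" and x: "x \<in> hyp_space"
  obtains f' where "(cosh_dist e s has_derivative f') (at x)"
    and "\<And>v. \<bar>f' v\<bar> \<le> sqrt ((cosh_dist e s x)\<^sup>2 - 1) * riem_norm hyp_metric x v"
    and "cosh_dist e s x \<ge> 1"
proof -
  \<comment> \<open>At t = 1/2 the parameter - R t (1 - t) is - R / 4, so R = - 4 s yields
    s.\<close>
  define Z where "Z = hZ (- 4 * s) e"
  define z where "z = (x, 1/2 :: real)"
  have z: "z \<in> hyp_cylinder" using x by (simp add: z_def)
  have Zx: "ev Z (y, 1/2) = cosh_dist e s y" if "y \<in> hyp_space" for y
    using ev_hZ[OF that, of "- 4 * s" e "1/2"] by (simp add: Z_def)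
  have "((\<lambda>y. (y, 1/2 :: real)) has_derivative (\<lambda>v. (v, 0))) (at x)"
    by (auto intro!: derivative_eq_intros)
  from has_derivative_compose[OF this, of "ev Z"] ev_has_derivative[OF z, of Z]
  have "((\<lambda>y. ev Z (y, 1/2)) has_derivative (\<lambda>v. ev (dv (v, 0) Z) z)) (at x)"
    by (simp add: z_def)
  then have 1: "(cosh_dist e s has_derivative (\<lambda>v. ev (dv (v, 0) Z) z)) (at x)"
    by (rule has_derivative_transform_within_open[where s = hyp_space])
      (use x Zx in \<open>auto simp: hyp_space_def\<close>)
  have N: "1 - (norm x)\<^sup>2 > 0" by (rule hyp_space_pos[OF x])
  have 2: "\<bar>ev (dv (v, 0) Z) z\<bar> \<le> sqrt ((cosh_dist e s x)\<^sup>2 - 1) * riem_norm hyp_metric x v" for v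
  proof -
    define D where "D = (\<chi> i. ev (di i Z) z)"
    have "ev (dv (v, 0) Z) z = v \<bullet> D"
      by (subst dv_sum_di[OF z]) (simp add: D_def inner_vec_def)
    moreover have "\<bar>v \<bullet> D\<bar> \<le> norm v * norm D" by (rule Cauchy_Schwarz_ineq2)
    moreover have "norm D = sqrt ((cosh_dist e s x)\<^sup>2 - 1) * (2 / (1 - (norm x)\<^sup>2))"
    proof -
      have "ev (Gam Z Z) z = (cosh_dist e s x)\<^sup>2 - 1"
      proof -
        have "Gam Z Z = Z * Z - 1" unfolding Z_def by (rule Gam_hZ_hZ[OF e])
        then show ?thesis using Zx[OF x] ev_ring(6)[OF z] by (simp add: ev_ring(2,4) z_def power2_eq_square)
      qed
      moreover have "ev (Gam Z Z) z = ((1 - (norm x)\<^sup>2) / 2)\<^sup>2 * (norm D)\<^sup>2"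
      proof -
        have 1: "(norm D)\<^sup>2 = (\<Sum>i\<in>UNIV. ev (di i Z) z * ev (di i Z) z)"
          by (simp only: power2_norm_eq_inner inner_vec_def D_def vec_lambda_beta inner_real_def)
        have 2: "ev hN z = 1 - (norm x)\<^sup>2" using ev_hN[OF z] by (simp add: z_def)
        show ?thesis
          unfolding 1 Gam_def hb_def ev_ring ev_sum ev_const[OF z] 2 by (simp add: power2_eq_square)
      qed
      ultimately have "((1 - (norm x)\<^sup>2) / 2 * norm D)\<^sup>2 = (cosh_dist e s x)\<^sup>2 - 1"
        by (simp add: power_mult_distrib power_divide)
      then have "sqrt ((cosh_dist e s x)\<^sup>2 - 1) = (1 - (norm x)\<^sup>2) / 2 * norm D"
        by (rule real_sqrt_unique) (use N in simp)
      then show ?thesis using N by (simp only:) simp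
    qed
    ultimately show ?thesis unfolding riem_norm_hyp[OF x] by (simp only:) (simp add: mult_ac)
  qed
  have "cosh_dist e s x \<ge> 1"
    using hZ_ge_1(1)[OF e z, of "- 4 * s"] Zx[OF x] by (simp add: Z_def z_def)
  with 1 2 show thesis by (rule that)
qed

lemma cosh_dist_ge_1: "norm e = 1 \<Longrightarrow> x \<in> hyp_space \<Longrightarrow> cosh_dist e s x \<ge> 1"
  using cosh_dist_derivative by metis

text \<open>Along a curve, \<open>arcosh (cosh_dist + \<delta>)\<close> grows at most at unit speed; the shift by \<open>\<delta> > 0\<close>
  avoids the singularity of arcosh at \<open>1\<close>.\<close>

lemma length_ge_arcosh:
  assumes e: "norm e = 1" and \<gamma>: "valid_path \<gamma>" "path_image \<gamma> \<subseteq> hyp_space"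
    and L: "((\<lambda>s. riem_norm hyp_metric (\<gamma> s) (vector_derivative \<gamma> (at s))) has_integral L) {0..1}"
    and finish: "pathfinish \<gamma> = hyp_point e s"
  shows "arcosh (cosh_dist e s (pathstart \<gamma>)) \<le> L"
proof -
  have in_ball: "\<gamma> t \<in> hyp_space" if "t \<in> {0..1}" for t
    using \<gamma>(2) that by (auto simp: path_image_def)
  obtain T where T: "finite T" "\<gamma> C1_differentiable_on {0..1} - T" and cont: "continuous_on {0..1} \<gamma>"
    using \<gamma>(1) by (auto simp: valid_path_def piecewise_C1_differentiable_on_def)
  have bound: "arcosh (cosh_dist e s (\<gamma> 0) + \<delta>) - arcosh (1 + \<delta>) \<le> L" if \<delta>: "\<delta> > 0" for \<delta>
  proof -
    \<comment> \<open>With the minus sign, f 1 - f 0 is the loss of (shifted) distance along the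
      curve, to be bounded by the length.\<close>
    define f where "f t = - arcosh (cosh_dist e s (\<gamma> t) + \<delta>)" for t
    define l where "l t = riem_norm hyp_metric (\<gamma> t) (vector_derivative \<gamma> (at t))" for t
    have "\<exists>d. (f has_vector_derivative d) (at t) \<and> d \<le> l t" if t: "t \<in> {0..1} - T" for t
    proof -
      have x: "\<gamma> t \<in> hyp_space" using in_ball t by simp
      obtain f' where f': "(cosh_dist e s has_derivative f') (at (\<gamma> t))"
        "\<And>v. \<bar>f' v\<bar> \<le> sqrt ((cosh_dist e s (\<gamma> t))\<^sup>2 - 1) * riem_norm hyp_metric (\<gamma> t) v"
        "cosh_dist e s (\<gamma> t) \<ge> 1"
        using cosh_dist_derivative[OF e x] by metis
      obtain v where v: "(\<gamma> has_vector_derivative v) (at t)"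
        using T(2) t unfolding C1_differentiable_on_def by blast
      define q where "q = sqrt ((cosh_dist e s (\<gamma> t) + \<delta>)\<^sup>2 - 1)"
      have le: "sqrt ((cosh_dist e s (\<gamma> t))\<^sup>2 - 1) \<le> q"
        unfolding q_def using f'(3) \<delta> by (intro real_sqrt_le_mono diff_right_mono power_mono) auto
      have q: "q > 0" unfolding q_def using f'(3) \<delta> by (simp add: one_less_power)
      have "((\<lambda>t. cosh_dist e s (\<gamma> t)) has_derivative (\<lambda>h. f' (h *\<^sub>R v))) (at t)"
        using has_derivative_compose[OF v[unfolded has_vector_derivative_def] f'(1)] .
      moreover have "f' (h *\<^sub>R v) = f' v * h" for h
        using linear_scale[OF has_derivative_linear[OF f'(1)], of h v] by simp
      ultimately have "((\<lambda>t. cosh_dist e s (\<gamma> t)) has_real_derivative f' v) (at t)"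
        by (simp add: has_field_derivative_def)
      then have "((\<lambda>t. cosh_dist e s (\<gamma> t) + \<delta>) has_real_derivative f' v) (at t)"
        by (auto intro!: derivative_eq_intros)
      then have "(f has_real_derivative - (1 / q * f' v)) (at t)"
        unfolding f_def[abs_def] q_def
        using f'(3) \<delta> by (intro DERIV_minus DERIV_chain2[OF arcosh_real_has_field_derivative]) auto
      moreover have "- (1 / q * f' v) \<le> l t"
      proof -
        have ln: "riem_norm hyp_metric (\<gamma> t) v \<ge> 0"
          using hyp_space_pos[OF x] by (simp add: riem_norm_hyp[OF x])
        have "- f' v \<le> q * riem_norm hyp_metric (\<gamma> t) v"
          using f'(2)[of v] mult_right_mono[OF le ln] by linarith
        then show ?thesis
          unfolding l_def vector_derivative_at[OF v] using q by (simp add: field_simps)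
      qed
      ultimately show ?thesis
        by (auto simp: has_real_derivative_iff_has_vector_derivative)
    qed
    then obtain d where d: "\<And>t. t \<in> {0..1} - T \<Longrightarrow> (f has_vector_derivative d t) (at t) \<and> d t \<le> l t"
      by metis
    have "continuous_on hyp_space (cosh_dist e s)"
      using cosh_dist_derivative[OF e] has_derivative_continuous
      by (metis continuous_at_imp_continuous_on)
    then have cz: "continuous_on {0..1} (\<lambda>t. cosh_dist e s (\<gamma> t))"
      by (rule continuous_on_compose2[OF _ cont]) (use in_ball in auto)
    have cf: "continuous_on {0..1} f"
    proof -
      have "cosh_dist e s (\<gamma> t) + \<delta> \<ge> 1" if "t \<in> {0..1}" for t
        using cosh_dist_ge_1[OF e in_ball[OF that], of s] \<delta> by simp
      then show ?thesis
        unfolding f_def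
        by (intro continuous_on_minus continuous_on_arcosh' continuous_on_add cz continuous_on_const)
    qed
    \<comment> \<open>On the exceptional set the derivative is replaced by the integrand, so that d'
      \<le> l holds on all of [0, 1]; finitely many points do not change the integral.\<close>
    define d' where "d' t = (if t \<in> T then l t else d t)" for t
    have "(d has_integral (f 1 - f 0)) {0..1}"
      using d by (intro fundamental_theorem_of_calculus_interior_strong[OF T(1) _ _ cf]) auto
    then have "(d' has_integral (f 1 - f 0)) {0..1}"
      by (rule has_integral_spike_finite[OF T(1), rotated]) (auto simp: d'_def)
    then have "f 1 - f 0 \<le> L"
      by (rule has_integral_le[OF _ L]) (use d in \<open>auto simp: d'_def l_def\<close>)
    moreover have "cosh_dist e s (\<gamma> 1) = 1"
      using finish by (simp add: pathfinish_def cosh_dist_hyp_point[OF e])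
    ultimately show ?thesis by (simp add: f_def)
  qed
  have x0: "cosh_dist e s (\<gamma> 0) \<ge> 1" using cosh_dist_ge_1[OF e in_ball] by simp
  \<comment> \<open>Continuity of arcosh from the right, also at 1, allows \<delta> to tend to
    0.\<close>
  have cA: "((\<lambda>\<delta>. arcosh (a + \<delta>)) \<longlongrightarrow> arcosh a) (at_right 0)" if "a \<ge> 1" for a :: real
  proof -
    have "continuous_on {0..} (\<lambda>\<delta>. arcosh (a + \<delta>))"
      using that by (intro continuous_on_arcosh' continuous_intros) auto
    from this[unfolded continuous_on_def, rule_format, of 0]
    have "((\<lambda>\<delta>. arcosh (a + \<delta>)) \<longlongrightarrow> arcosh (a + 0)) (at 0 within {0..})"
      by simp
    then have "((\<lambda>\<delta>. arcosh (a + \<delta>)) \<longlongrightarrow> arcosh (a + 0)) (at 0 within {0<..})"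
      by (rule tendsto_within_subset) auto
    then show ?thesis by simp
  qed
  have "((\<lambda>\<delta>. arcosh (cosh_dist e s (\<gamma> 0) + \<delta>) - arcosh (1 + \<delta>)) \<longlongrightarrow>
      arcosh (cosh_dist e s (\<gamma> 0)) - arcosh 1) (at_right 0)"
    by (intro tendsto_diff cA x0) simp
  then have "arcosh (cosh_dist e s (\<gamma> 0)) - arcosh 1 \<le> L"
    by (rule tendsto_upperbound)
      (auto simp: eventually_at_right_less intro!: eventually_mono[OF eventually_at_right_less] bound)
  then show ?thesis by (simp add: pathstart_def)
qed

text \<open>The lower bound on lengths is attained, so the infimum is a minimum. Coinciding points
  are joined by a constant curve, since \<open>hyperboloid_geodesic\<close> divides by sinh
  \<rho>.\<close>

lemma hyp_dist_hyp_point: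
  assumes e: "norm e = 1" and x: "x \<in> hyp_space"
  shows "hyp_dist x (hyp_point e s) = arcosh (cosh_dist e s x)"
proof -
  define \<rho> where "\<rho> = arcosh (cosh_dist e s x)"
  have ge: "cosh_dist e s x \<ge> 1" by (rule cosh_dist_ge_1[OF e x])
  have "\<exists>\<gamma>. valid_path \<gamma> \<and> path_image \<gamma> \<subseteq> hyp_space \<and> pathstart \<gamma> = x \<and> pathfinish \<gamma> = hyp_point e s \<and>
     ((\<lambda>s. riem_norm hyp_metric (\<gamma> s) (vector_derivative \<gamma> (at s))) has_integral \<rho>) {0..1}"
  proof (cases "cosh_dist e s x = 1")
    case True
    then have "x = hyp_point e s" by (rule cosh_dist_eq_1D[OF e x])
    moreover have "valid_path (\<lambda>_. x)"
      by (simp add: valid_path_def C1_differentiable_imp_piecewise)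
    ultimately show ?thesis
      using x True by (intro exI[of _ "\<lambda>_. x"])
        (auto simp: path_image_def pathstart_def pathfinish_def \<rho>_def riem_norm_hyp)
  next
    case False
    then have \<rho>: "\<rho> > 0" "cosh \<rho> = cosh_dist e s x" using ge by (simp_all add: \<rho>_def)
    define N where "N = 1 - (norm x)\<^sup>2"
    have N: "N > 0" using hyp_space_pos[OF x] by (simp add: N_def)
    \<comment> \<open>a and u are the hyperboloid coordinates of x.\<close>
    define a where "a = (2 - N) / N"
    define u where "u = (2 / N) *\<^sub>R x"
    have r: "norm x ^ 2 = 1 - N" "x \<bullet> x = 1 - N" by (simp_all add: N_def power2_norm_eq_inner)
    have "N \<le> 1" by (simp add: N_def)
    have "a\<^sup>2 - u \<bullet> u = 1"
      using N by (simp add: a_def u_def r power2_eq_square field_simps)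
    moreover have "a > 0" using N \<open>N \<le> 1\<close> by (simp add: a_def)
    moreover have "(cosh s)\<^sup>2 - (sinh s *\<^sub>R e) \<bullet> (sinh s *\<^sub>R e) = 1"
      using e by (simp add: cosh_square_eq norm_eq_1 power2_eq_square[symmetric])
    moreover have "a * cosh s - u \<bullet> (sinh s *\<^sub>R e) = cosh \<rho>"
      unfolding \<rho> cosh_dist_def N_def[symmetric] r(1) by (simp add: a_def u_def)
    ultimately obtain \<gamma> where \<gamma>: "valid_path \<gamma>" "path_image \<gamma> \<subseteq> hyp_space" "pathstart \<gamma> = u /\<^sub>R (1 + a)"
        "pathfinish \<gamma> = (sinh s *\<^sub>R e) /\<^sub>R (1 + cosh s)"
        "((\<lambda>s. riem_norm hyp_metric (\<gamma> s) (vector_derivative \<gamma> (at s))) has_integral \<rho>) {0..1}"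
      using hyperboloid_geodesic[of a u "cosh s" "sinh s *\<^sub>R e" \<rho>] \<rho>(1) cosh_real_pos[of s] by blast
    have start: "u /\<^sub>R (1 + a) = x"
    proof -
      have "1 + a = 2 / N" using N by (simp add: a_def field_simps)
      then show ?thesis using N by (simp add: u_def)
    qed
    have finish: "(sinh s *\<^sub>R e) /\<^sub>R (1 + cosh s) = hyp_point e s"
      by (simp add: hyp_point_def divide_inverse mult.commute)
    show ?thesis
      using \<gamma> unfolding start finish by (intro exI[of _ \<gamma>] conjI)
  qed
  moreover have "\<rho> \<le> L" if "valid_path \<gamma>" "path_image \<gamma> \<subseteq> hyp_space" "pathstart \<gamma> = x"
    "pathfinish \<gamma> = hyp_point e s"
    "((\<lambda>s. riem_norm hyp_metric (\<gamma> s) (vector_derivative \<gamma> (at s))) has_integral L) {0..1}" for \<gamma> L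
    using length_ge_arcosh[OF e that(1,2,5,4)] unfolding that(3) \<rho>_def .
  ultimately show ?thesis
    unfolding hyp_dist_def riem_dist_def \<rho>_def[symmetric] by (intro cInf_eq_minimum) blast+
qed

section \<open>The exponential map\<close>

lemma matrix_inv_hyp_metric:
  assumes "x \<in> hyp_space"
  shows "matrix_inv (hyp_metric x) = ((1 - (norm x)\<^sup>2)\<^sup>2 / 4) *\<^sub>R mat 1"
proof -
  define c where "c = 4 / (1 - (norm x)\<^sup>2)\<^sup>2"
  have c: "c \<noteq> 0" using hyp_space_pos[OF assms] by (simp add: c_def)
  have m: "hyp_metric x = c *\<^sub>R mat 1" by (simp add: hyp_metric_def c_def)
  have *: "(c *\<^sub>R mat 1 :: real ^ 'a ^ 'a) ** B = c *\<^sub>R B" "B ** (c *\<^sub>R mat 1) = c *\<^sub>R B"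
    for B :: "real ^ 'a ^ 'a" and c
    by (simp_all add: scalar_matrix_assoc[symmetric] matrix_scalar_ac)
  have "matrix_inv (hyp_metric x) = inverse c *\<^sub>R mat 1"
    unfolding matrix_inv_def m
  proof (rule some_equality)
    show "c *\<^sub>R mat 1 ** inverse c *\<^sub>R mat 1 = (mat 1 :: real ^ 'a ^ 'a) \<and>
        inverse c *\<^sub>R mat 1 ** c *\<^sub>R mat 1 = (mat 1 :: real ^ 'a ^ 'a)"
      using c by (simp add: *)
    show "B = inverse c *\<^sub>R mat 1" if "c *\<^sub>R mat 1 ** B = mat 1 \<and> B ** c *\<^sub>R mat 1 = mat 1"
      for B :: "real ^ 'a ^ 'a"
    proof -
      have "c *\<^sub>R B = mat 1" using that by (simp add: *)
      then have "inverse c *\<^sub>R (c *\<^sub>R B) = inverse c *\<^sub>R mat 1" by simp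
      then show ?thesis using c by simp
    qed
  qed
  then show ?thesis by (simp add: c_def)
qed

lemma hyp_metric_component: "hyp_metric y $ j $ l = (if j = l then 4 / (1 - (norm y)\<^sup>2)\<^sup>2 else 0)"
  by (simp add: hyp_metric_def mat_def)

lemma partial_hyp_metric:
  assumes "x \<in> hyp_space"
  shows "partial i (\<lambda>y. hyp_metric y $ j $ l) x = (if j = l then 16 * x $ i / (1 - (norm x)\<^sup>2) ^ 3 else 0)"
proof (cases "j = l")
  case True
  define n where "n = 1 - x \<bullet> x"
  have n: "n \<noteq> 0" using hyp_space_pos[OF assms] by (simp add: n_def power2_norm_eq_inner)
  have "((\<lambda>y. 4 / (1 - y \<bullet> y)\<^sup>2) has_derivative (\<lambda>h. 16 * (x \<bullet> h) / n ^ 3)) (at x)"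
    by (rule derivative_eq_intros refl | simp add: n_def[symmetric] n)+
      (use n in \<open>auto simp: fun_eq_iff inner_commute field_simps power2_eq_square power3_eq_cube\<close>)
  then have "partial i (\<lambda>y. 4 / (1 - y \<bullet> y)\<^sup>2) x = 16 * (x \<bullet> axis i 1) / n ^ 3"
    unfolding partial_def by (simp add: frechet_derivative_at[symmetric])
  then show ?thesis
    using True by (simp add: hyp_metric_component power2_norm_eq_inner n_def inner_axis)
next
  case False
  then show ?thesis by (simp add: hyp_metric_component partial_def)
qed

text \<open>For a metric e^(2 f) |dx|^2 geodesics satisfy x'' = |v|^2 F - 2 (F . v) v with F the
  gradient of f; here F = 2 x / (1 - |x|^2).\<close>

lemma hyp_acceleration:
  assumes "x \<in> hyp_space"
  shows "(\<chi> k. - (\<Sum>i\<in>UNIV. \<Sum>j\<in>UNIV. christoffel hyp_metric x k i j * v $ i * v $ j)) =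
    (2 / (1 - (norm x)\<^sup>2)) *\<^sub>R ((v \<bullet> v) *\<^sub>R x - (2 * (x \<bullet> v)) *\<^sub>R v)"
proof -
  define n where "n = 1 - (norm x)\<^sup>2"
  have n: "n > 0" using hyp_space_pos[OF assms] by (simp add: n_def)
  have ch: "christoffel hyp_metric x k i j =
      2 / n * ((if j = k then x $ i else 0) + (if i = k then x $ j else 0) - (if i = j then x $ k else 0))"
    for k i j
  proof -
    have cmp: "(c *\<^sub>R mat 1 :: real ^ 'a ^ 'a) $ k $ l = (if k = l then c else 0)" for c l
      by (simp add: mat_def)
    have delta: "(\<Sum>l\<in>UNIV. (if k = l then c else 0) * f l) = c * f k" for c :: real and f :: "'a \<Rightarrow> real"
    proof -
      have "(\<Sum>l\<in>UNIV. (if k = l then c else 0) * f l) = (\<Sum>l\<in>UNIV. if k = l then c * f l else 0)"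
        by (intro sum.cong) auto
      then show ?thesis by simp
    qed
    have "christoffel hyp_metric x k i j = 1 / 2 * (n\<^sup>2 / 4 *
        ((if j = k then 16 * x $ i / n ^ 3 else 0) + (if i = k then 16 * x $ j / n ^ 3 else 0)
          - (if i = j then 16 * x $ k / n ^ 3 else 0)))"
      unfolding christoffel_def matrix_inv_hyp_metric[OF assms] partial_hyp_metric[OF assms] cmp delta n_def
      ..
    moreover have "(if c then 16 * b / n ^ 3 else 0) = 16 / n ^ 3 * (if c then b else 0)" for c b
      by simp
    moreover have "1 / 2 * (n\<^sup>2 / 4 * (16 / n ^ 3 * p + 16 / n ^ 3 * q - 16 / n ^ 3 * r)) = 2 / n * (p + q - r)"
      for p q r
      using n by (simp add: field_simps power2_eq_square power3_eq_cube)
    ultimately show ?thesis by (simp only:)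
  qed
  have "(\<Sum>i\<in>UNIV. \<Sum>j\<in>UNIV. christoffel hyp_metric x k i j * v $ i * v $ j)
      = 2 / n * (2 * (x \<bullet> v) * v $ k - (v \<bullet> v) * x $ k)" for k
  proof -
    have "(\<Sum>i\<in>UNIV. \<Sum>j\<in>UNIV. christoffel hyp_metric x k i j * v $ i * v $ j)
      = 2 / n * (\<Sum>i\<in>UNIV. \<Sum>j\<in>UNIV. (if j = k then x $ i * v $ i * v $ j else 0)
        + (if i = k then x $ j * v $ i * v $ j else 0) - (if i = j then x $ k * v $ i * v $ j else 0))"
      unfolding ch sum_distrib_left by (intro sum.cong refl) (simp add: algebra_simps)
    also have "(\<Sum>i\<in>UNIV. \<Sum>j\<in>UNIV. (if j = k then x $ i * v $ i * v $ j else 0)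
        + (if i = k then x $ j * v $ i * v $ j else 0) - (if i = j then x $ k * v $ i * v $ j else 0))
      = (\<Sum>i\<in>UNIV. x $ i * v $ i * v $ k) + (\<Sum>j\<in>UNIV. x $ j * v $ k * v $ j)
        - (\<Sum>i\<in>UNIV. x $ k * v $ i * v $ i)"
    proof -
      have "(\<Sum>i\<in>UNIV. \<Sum>j\<in>UNIV. if i = k then x $ j * v $ i * v $ j else 0)
          = (\<Sum>i\<in>UNIV. if i = k then (\<Sum>j\<in>UNIV. x $ j * v $ i * v $ j) else 0)"
        by (intro sum.cong) auto
      then show ?thesis by (simp add: sum.distrib sum_subtractf)
    qed
    also have "\<dots> = 2 * (x \<bullet> v) * v $ k - (v \<bullet> v) * x $ k"
      by (simp add: inner_vec_def sum_distrib_left sum_distrib_right mult_ac)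
    finally show ?thesis .
  qed
  then show ?thesis
    by (simp add: vec_eq_iff n_def[symmetric] algebra_simps diff_divide_distrib)
qed

lemma geodesic_on_hyp_iff:
  "geodesic_on hyp_space hyp_metric S \<gamma> v \<longleftrightarrow> (\<forall>s\<in>S. \<gamma> s \<in> hyp_space \<and>
     (\<gamma> has_vector_derivative v s) (at s within S) \<and>
     (v has_vector_derivative (2 / (1 - (norm (\<gamma> s))\<^sup>2)) *\<^sub>R ((v s \<bullet> v s) *\<^sub>R \<gamma> s - (2 * (\<gamma> s \<bullet> v s)) *\<^sub>R v s))
       (at s within S))"
  unfolding geodesic_on_def by (intro ball_cong refl conj_cong) (simp add: hyp_acceleration)

text \<open>On the hyperboloid a geodesic solves \<open>U'' = c U\<close> with the constant \<open>c = |v|\<^sub>g\<^sup>2\<close>, and the two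
  quantities \<open>cosh (s t) U' - s sinh (s t) U\<close> and \<open>s cosh (s t) U - sinh (s t) U'\<close> with \<open>s\<^sup>2 = c\<close>
  are conserved.\<close>

lemma hyp_geodesic_unique:
  fixes e :: "real ^ 'n::finite"
  assumes e: "norm e = 1" and geo: "geodesic_on hyp_space hyp_metric {0..1} \<gamma> v"
    and init: "\<gamma> 0 = 0" "v 0 = (s / 2) *\<^sub>R e"
  shows "\<gamma> 1 = hyp_point e s"
proof -
  define n where "n t = 1 - \<gamma> t \<bullet> \<gamma> t" for t
  define a where "a t = (2 / n t) *\<^sub>R ((v t \<bullet> v t) *\<^sub>R \<gamma> t - (2 * (\<gamma> t \<bullet> v t)) *\<^sub>R v t)" for t
  have n: "n t > 0" and d\<gamma>: "(\<gamma> has_vector_derivative v t) (at t within {0..1})"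
    and dv: "(v has_vector_derivative a t) (at t within {0..1})" if "t \<in> {0..1}" for t
    using geo[unfolded geodesic_on_hyp_iff, rule_format, OF that] hyp_space_pos[of "\<gamma> t"]
    by (simp_all add: n_def a_def power2_norm_eq_inner)
  have dn: "(n has_real_derivative - 2 * (\<gamma> t \<bullet> v t)) (at t within {0..1})" if "t \<in> {0..1}" for t
    using has_vector_derivative_diff[OF has_vector_derivative_const[of 1]
        bounded_bilinear.has_vector_derivative[OF bounded_bilinear_inner d\<gamma>[OF that] d\<gamma>[OF that]]]
    unfolding n_def[abs_def]
    by (simp add: has_real_derivative_iff_has_vector_derivative inner_commute)
  have dvv: "((\<lambda>t. v t \<bullet> v t) has_real_derivative 2 * (v t \<bullet> a t)) (at t within {0..1})"
    and dxv: "((\<lambda>t. \<gamma> t \<bullet> v t) has_real_derivative \<gamma> t \<bullet> a t + v t \<bullet> v t) (at t within {0..1})"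
    if "t \<in> {0..1}" for t
    using bounded_bilinear.has_vector_derivative[OF bounded_bilinear_inner dv[OF that] dv[OF that]]
      bounded_bilinear.has_vector_derivative[OF bounded_bilinear_inner d\<gamma>[OF that] dv[OF that]]
    by (simp_all add: has_real_derivative_iff_has_vector_derivative inner_commute)
  have va: "v t \<bullet> a t = - 2 / n t * (\<gamma> t \<bullet> v t) * (v t \<bullet> v t)"
    and xa: "\<gamma> t \<bullet> a t = 2 / n t * ((v t \<bullet> v t) * (1 - n t) - 2 * (\<gamma> t \<bullet> v t)\<^sup>2)" for t
    by (simp_all add: a_def n_def inner_diff_right inner_commute algebra_simps power2_eq_square)
  \<comment> \<open>Conservation of the squared Riemannian speed; at time 0 it is 4 (s /
    2)^2.\<close>
  have const: "4 * (v t \<bullet> v t) / (n t)\<^sup>2 = s\<^sup>2" if "t \<in> {0..1}" for t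
  proof -
    have "((\<lambda>t. 4 * (v t \<bullet> v t) / (n t)\<^sup>2) has_real_derivative 0) (at t within {0..1})"
      if "t \<in> {0..1}" for t
    proof -
      have "((\<lambda>t. 4 * (v t \<bullet> v t) / (n t)\<^sup>2) has_real_derivative
          (4 * (2 * (v t \<bullet> a t)) * (n t)\<^sup>2 - 4 * (v t \<bullet> v t) * (2 * n t * (- 2 * (\<gamma> t \<bullet> v t))))
            / ((n t)\<^sup>2 * (n t)\<^sup>2)) (at t within {0..1})"
        using n[OF that] by (auto intro!: derivative_eq_intros dvv dn that)
      moreover have "4 * (2 * (v t \<bullet> a t)) * (n t)\<^sup>2 - 4 * (v t \<bullet> v t) * (2 * n t * (- 2 * (\<gamma> t \<bullet> v t))) = 0"
        unfolding va using n[OF that] by (simp add: field_simps power2_eq_square)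
      ultimately show ?thesis by simp
    qed
    then obtain c where c: "\<And>t. t \<in> {0..1} \<Longrightarrow> 4 * (v t \<bullet> v t) / (n t)\<^sup>2 = c"
      using has_vector_derivative_zero_constant[of "{0..1}" "\<lambda>t. 4 * (v t \<bullet> v t) / (n t)\<^sup>2"]
      by (auto simp: has_real_derivative_iff_has_vector_derivative)
    have "c = s\<^sup>2"
      using c[of 0] e by (simp add: init n_def norm_eq_1 power2_eq_square)
    then show ?thesis using c[OF that] by simp
  qed
  define U where "U t = (2 / n t) *\<^sub>R \<gamma> t" for t
  define U' where "U' t = (2 / n t) *\<^sub>R v t + (4 * (\<gamma> t \<bullet> v t) / (n t)\<^sup>2) *\<^sub>R \<gamma> t" for t
  have dU: "(U has_vector_derivative U' t) (at t within {0..1})" if "t \<in> {0..1}" for t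
  proof -
    have "((\<lambda>t. 2 / n t) has_real_derivative 4 * (\<gamma> t \<bullet> v t) / (n t)\<^sup>2) (at t within {0..1})"
      using n[OF that] by (auto intro!: derivative_eq_intros dn that simp: power2_eq_square)
    from has_vector_derivative_scaleR[OF this d\<gamma>[OF that]] show ?thesis
      unfolding U_def[abs_def] U'_def .
  qed
  have dU': "(U' has_vector_derivative s\<^sup>2 *\<^sub>R U t) (at t within {0..1})" if "t \<in> {0..1}" for t
  proof -
    have 1: "((\<lambda>t. 2 / n t) has_real_derivative 4 * (\<gamma> t \<bullet> v t) / (n t)\<^sup>2) (at t within {0..1})"
      using n[OF that] by (auto intro!: derivative_eq_intros dn that simp: power2_eq_square)
    have 2: "((\<lambda>t. 4 * (\<gamma> t \<bullet> v t) / (n t)\<^sup>2) has_real_derivative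
        (4 * (\<gamma> t \<bullet> a t + v t \<bullet> v t) * (n t)\<^sup>2 - 4 * (\<gamma> t \<bullet> v t) * (2 * n t * (- 2 * (\<gamma> t \<bullet> v t))))
          / ((n t)\<^sup>2 * (n t)\<^sup>2)) (at t within {0..1})" (is "(_ has_real_derivative ?d) _")
      using n[OF that] by (auto intro!: derivative_eq_intros dxv dn that)
    have "(U' has_vector_derivative
        (2 / n t) *\<^sub>R a t + (4 * (\<gamma> t \<bullet> v t) / (n t)\<^sup>2) *\<^sub>R v t
        + ((4 * (\<gamma> t \<bullet> v t) / (n t)\<^sup>2) *\<^sub>R v t + ?d *\<^sub>R \<gamma> t)) (at t within {0..1})"
      unfolding U'_def[abs_def]
      by (intro has_vector_derivative_add has_vector_derivative_scaleR[OF 1 dv[OF that]]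
          has_vector_derivative_scaleR[OF 2 d\<gamma>[OF that]])
    moreover have "(2 / n t) *\<^sub>R a t + (4 * (\<gamma> t \<bullet> v t) / (n t)\<^sup>2) *\<^sub>R v t
        + ((4 * (\<gamma> t \<bullet> v t) / (n t)\<^sup>2) *\<^sub>R v t + D *\<^sub>R \<gamma> t)
        = (4 / (n t)\<^sup>2 * (v t \<bullet> v t) + D) *\<^sub>R \<gamma> t" for D
      using n[OF that] by (simp add: a_def vec_eq_iff field_simps power2_eq_square)
    moreover have "4 / (n t)\<^sup>2 * (v t \<bullet> v t) + ?d = 4 * (v t \<bullet> v t) / (n t)\<^sup>2 * (2 / n t)"
      unfolding xa using n[OF that] by (simp add: field_simps power2_eq_square)
    ultimately show ?thesis unfolding const[OF that] by (simp only: U_def scaleR_scaleR)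
  qed
  have dch: "((\<lambda>t. cosh (s * t)) has_real_derivative s * sinh (s * t)) (at t within {0..1})"
    and dsh: "((\<lambda>t. sinh (s * t)) has_real_derivative s * cosh (s * t)) (at t within {0..1})" for t
    by (auto intro!: derivative_eq_intros)
  have i0: "U 0 = 0" "U' 0 = s *\<^sub>R e" by (simp_all add: U_def U'_def init n_def)
  have f: "cosh (s * t) *\<^sub>R U' t - (s * sinh (s * t)) *\<^sub>R U t = s *\<^sub>R e" if "t \<in> {0..1}" for t
  proof -
    have "((\<lambda>t. cosh (s * t) *\<^sub>R U' t - (s * sinh (s * t)) *\<^sub>R U t) has_vector_derivative
        (cosh (s * t) *\<^sub>R s\<^sup>2 *\<^sub>R U t + (s * sinh (s * t)) *\<^sub>R U' t)
        - ((s * sinh (s * t)) *\<^sub>R U' t + (s * (s * cosh (s * t))) *\<^sub>R U t)) (at t within {0..1})"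
      if "t \<in> {0..1}" for t
      by (intro has_vector_derivative_diff has_vector_derivative_scaleR dch dU' dU that DERIV_cmult dsh)
    then have "((\<lambda>t. cosh (s * t) *\<^sub>R U' t - (s * sinh (s * t)) *\<^sub>R U t) has_vector_derivative 0) (at t within {0..1})"
      if "t \<in> {0..1}" for t
      using that by (simp add: power2_eq_square mult_ac)
    then obtain c where c: "\<And>t. t \<in> {0..1} \<Longrightarrow> cosh (s * t) *\<^sub>R U' t - (s * sinh (s * t)) *\<^sub>R U t = c"
      using has_vector_derivative_zero_constant[of "{0..1}" "\<lambda>t. cosh (s * t) *\<^sub>R U' t - (s * sinh (s * t)) *\<^sub>R U t"]
      by auto
    then show ?thesis using c[OF that] c[of 0] i0 by simp
  qed
  have g: "(s * cosh (s * t)) *\<^sub>R U t - sinh (s * t) *\<^sub>R U' t = 0" if "t \<in> {0..1}" for t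
  proof -
    have "((\<lambda>t. (s * cosh (s * t)) *\<^sub>R U t - sinh (s * t) *\<^sub>R U' t) has_vector_derivative
        ((s * cosh (s * t)) *\<^sub>R U' t + (s * (s * sinh (s * t))) *\<^sub>R U t)
        - (sinh (s * t) *\<^sub>R s\<^sup>2 *\<^sub>R U t + (s * cosh (s * t)) *\<^sub>R U' t)) (at t within {0..1})"
      if "t \<in> {0..1}" for t
      by (intro has_vector_derivative_diff has_vector_derivative_scaleR dch dU' dU that DERIV_cmult dsh)
    then have "((\<lambda>t. (s * cosh (s * t)) *\<^sub>R U t - sinh (s * t) *\<^sub>R U' t) has_vector_derivative 0) (at t within {0..1})"
      if "t \<in> {0..1}" for t
      using that by (simp add: power2_eq_square mult_ac)
    then obtain c where c: "\<And>t. t \<in> {0..1} \<Longrightarrow> (s * cosh (s * t)) *\<^sub>R U t - sinh (s * t) *\<^sub>R U' t = c"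
      using has_vector_derivative_zero_constant[of "{0..1}" "\<lambda>t. (s * cosh (s * t)) *\<^sub>R U t - sinh (s * t) *\<^sub>R U' t"]
      by auto
    then show ?thesis using c[OF that] c[of 0] i0 by simp
  qed
  \<comment> \<open>The conserved quantities are two linear equations for U 1 and U' 1 with
    determinant s; for s = 0 they reduce to U' = 0, and U is constant.\<close>
  have U1: "U 1 = sinh s *\<^sub>R e"
  proof (cases "s = 0")
    case True
    then have "U' t = 0" if "t \<in> {0..1}" for t using f[OF that] by simp
    then have "(U has_vector_derivative 0) (at t within {0..1})" if "t \<in> {0..1}" for t
      using dU that by metis
    then obtain c where "\<And>t. t \<in> {0..1} \<Longrightarrow> U t = c"
      using has_vector_derivative_zero_constant[of "{0..1}" U] by auto
    then have "U 1 = U 0" by simp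
    then show ?thesis using True i0 by simp
  next
    case False
    have "(s * ((cosh s)\<^sup>2 - (sinh s)\<^sup>2)) *\<^sub>R U 1
        = cosh s *\<^sub>R ((s * cosh s) *\<^sub>R U 1 - sinh s *\<^sub>R U' 1)
          + sinh s *\<^sub>R (cosh s *\<^sub>R U' 1 - (s * sinh s) *\<^sub>R U 1)"
      by (simp add: power2_eq_square algebra_simps)
    also have "\<dots> = sinh s *\<^sub>R (s *\<^sub>R e)" using f[of 1] g[of 1] by simp
    finally have "s *\<^sub>R U 1 = s *\<^sub>R (sinh s *\<^sub>R e)"
      by (simp add: cosh_square_eq mult.commute)
    then show ?thesis by (rule scaleR_left_imp_eq[OF False])
  qed
  have n1: "n 1 > 0" using n by simp
  \<comment> \<open>Only the spatial part of the hyperboloid coordinates was tracked; its length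
    sinh s recovers the height cosh s = (2 - n) / n.\<close>
  have "U 1 \<bullet> U 1 = 4 * (1 - n 1) / (n 1)\<^sup>2"
    by (simp add: U_def n_def power2_eq_square)
  moreover have "U 1 \<bullet> U 1 = (sinh s)\<^sup>2" using e by (simp add: U1 norm_eq_1 power2_eq_square)
  ultimately have "(sinh s)\<^sup>2 = 4 * (1 - n 1) / (n 1)\<^sup>2" by simp
  then have "(cosh s)\<^sup>2 = 4 * (1 - n 1) / (n 1)\<^sup>2 + 1" by (simp only: cosh_square_eq)
  also have "\<dots> = ((2 - n 1) / n 1)\<^sup>2"
    using n1 by (simp add: power2_eq_square field_simps)
  finally have "(cosh s)\<^sup>2 = ((2 - n 1) / n 1)\<^sup>2" .
  moreover have "(2 - n 1) / n 1 \<ge> 0" using n1 by (simp add: n_def)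
  ultimately have "cosh s = (2 - n 1) / n 1" by (simp add: power2_eq_iff_nonneg)
  then have "1 + cosh s = 2 / n 1" using n1 by (simp add: field_simps)
  then have "hyp_point e s = (n 1 / 2) *\<^sub>R U 1" by (simp add: hyp_point_def U1)
  then show ?thesis using n1 by (simp add: U_def)
qed

text \<open>The definite description needs existence as well as uniqueness, so the geodesic tanh (s
  t / 2) e is exhibited; its endpoint then follows from uniqueness. The vector (s / 2) e has
  Riemannian length |s| at the origin.\<close>

lemma hyp_exp_eq_hyp_point:
  fixes e :: "real ^ 'n::finite"
  assumes e: "norm e = 1"
  shows "hyp_exp 0 ((s / 2) *\<^sub>R e) = hyp_point e s"
proof -
  define T where "T t = tanh (s * t / 2)" for t
  define \<gamma> where "\<gamma> t = T t *\<^sub>R e" for t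
  define v where "v t = (s / 2 * (1 - (T t)\<^sup>2)) *\<^sub>R e" for t
  have ee: "e \<bullet> e = 1" using e by (simp add: norm_eq_1)
  have dT: "(T has_real_derivative s / 2 * (1 - (T t)\<^sup>2)) (at t within {0..1})" for t
    unfolding T_def[abs_def] by (auto intro!: derivative_eq_intros simp: cosh_real_nonzero algebra_simps)
  have T1: "\<bar>T t\<bar> < 1" for t unfolding T_def by (simp add: tanh_real_lt_1 abs_less_iff tanh_real_gt_neg1 minus_less_iff)
  have "geodesic_on hyp_space hyp_metric {0..1} \<gamma> v"
    unfolding geodesic_on_hyp_iff
  proof (intro ballI conjI)
    fix t :: real assume "t \<in> {0..1}"
    show "\<gamma> t \<in> hyp_space" using T1[of t] e by (simp add: \<gamma>_def hyp_space_def)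
    show "(\<gamma> has_vector_derivative v t) (at t within {0..1})"
      using has_vector_derivative_scaleR[OF dT has_vector_derivative_const[of e]]
      unfolding \<gamma>_def[abs_def] v_def by simp
    have N: "1 - (T t)\<^sup>2 \<noteq> 0" using T1[of t] by (simp add: abs_square_eq_1)
    have "((\<lambda>t. s / 2 * (1 - (T t)\<^sup>2)) has_real_derivative
        s / 2 * (- (2 * T t * (s / 2 * (1 - (T t)\<^sup>2))))) (at t within {0..1})"
      by (auto intro!: derivative_eq_intros dT)
    from has_vector_derivative_scaleR[OF this has_vector_derivative_const[of e]]
    have "(v has_vector_derivative (s / 2 * (- (2 * T t * (s / 2 * (1 - (T t)\<^sup>2))))) *\<^sub>R e) (at t within {0..1})"
      unfolding v_def[abs_def] by simp
    moreover have "s / 2 * (- (2 * T t * (s / 2 * (1 - (T t)\<^sup>2)))) =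
        2 / (1 - (T t)\<^sup>2) * ((s / 2 * (1 - (T t)\<^sup>2))\<^sup>2 * T t
          - 2 * (T t * (s / 2 * (1 - (T t)\<^sup>2))) * (s / 2 * (1 - (T t)\<^sup>2)))"
    proof -
      have "s / 2 * (- (2 * T t * (s / 2 * k))) = 2 / k * ((s / 2 * k)\<^sup>2 * T t - 2 * (T t * (s / 2 * k)) * (s / 2 * k))"
        if "k \<noteq> 0" for k
        using that by (simp add: field_simps power2_eq_square)
      from this[OF N] show ?thesis .
    qed
    moreover have "(norm (\<gamma> t))\<^sup>2 = (T t)\<^sup>2" by (simp add: \<gamma>_def e)
    moreover have "v t \<bullet> v t = (s / 2 * (1 - (T t)\<^sup>2))\<^sup>2" "\<gamma> t \<bullet> v t = T t * (s / 2 * (1 - (T t)\<^sup>2))"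
      by (simp_all add: v_def \<gamma>_def ee power2_eq_square)
    ultimately show "(v has_vector_derivative (2 / (1 - (norm (\<gamma> t))\<^sup>2)) *\<^sub>R
        ((v t \<bullet> v t) *\<^sub>R \<gamma> t - (2 * (\<gamma> t \<bullet> v t)) *\<^sub>R v t)) (at t within {0..1})"
      by (simp only:) (simp only: \<gamma>_def v_def scaleR_scaleR scaleR_left_diff_distrib[symmetric])
  qed
  moreover have "\<gamma> 0 = 0" "v 0 = (s / 2) *\<^sub>R e" by (simp_all add: \<gamma>_def v_def T_def)
  ultimately have ex: "\<exists>\<gamma> v. geodesic_on hyp_space hyp_metric {0..1} \<gamma> v \<and> \<gamma> 0 = 0 \<and>
      v 0 = (s / 2) *\<^sub>R e \<and> \<gamma> 1 = hyp_point e s"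
    using hyp_geodesic_unique[OF e] by blast
  show ?thesis
    unfolding hyp_exp_def riem_exp_def
  proof (rule the_equality)
    show "\<exists>\<gamma> v. geodesic_on hyp_space hyp_metric {0..1} \<gamma> v \<and> \<gamma> 0 = 0 \<and>
      v 0 = (s / 2) *\<^sub>R e \<and> \<gamma> 1 = hyp_point e s" by (rule ex)
    show "q = hyp_point e s" if "\<exists>\<gamma> v. geodesic_on hyp_space hyp_metric {0..1} \<gamma> v \<and> \<gamma> 0 = 0 \<and>
        v 0 = (s / 2) *\<^sub>R e \<and> \<gamma> 1 = q" for q
      using that hyp_geodesic_unique[OF e] by blast
  qed
qed

section \<open>Chart expressions\<close>

lemma sqrt_det_hyp_metric:
  fixes x :: "real ^ 'n::finite"
  assumes "x \<in> hyp_space"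
  shows "sqrt (det (hyp_metric x)) = ev vol (x, t)"
proof -
  define k where "k = 1 - (norm x)\<^sup>2"
  have k: "k > 0" using hyp_space_pos[OF assms] by (simp add: k_def)
  have z: "(x, t) \<in> hyp_cylinder" using assms by simp
  have "det (hyp_metric x) = (4 / k\<^sup>2) ^ CARD('n)"
    by (subst det_diagonal) (simp_all add: hyp_metric_component k_def)
  also have "4 / k\<^sup>2 = (2 / k)\<^sup>2" by (simp add: power_divide)
  also have "((2 / k)\<^sup>2) ^ CARD('n) = ((2 / k) ^ CARD('n))\<^sup>2"
    by (simp only: power_mult[symmetric] mult.commute)
  finally have "sqrt (det (hyp_metric x)) = (2 / k) ^ CARD('n)"
    using k by simp
  moreover have "ev vol (x, t) = (2 / k) ^ CARD('n)"
    unfolding vol_def ev_power[OF z] ev_ring ev_numeral[OF z] ev_hM[OF z] ev_hN[OF z]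
    by (simp add: k_def divide_inverse)
  ultimately show ?thesis by simp
qed

text \<open>Combinations with fixed vectors c and d serve complex functions (c = 1, d = i) and real
  ones (v = 0) alike.\<close>

lemma partial_ev:
  fixes f :: "real ^ 'n::finite \<Rightarrow> 'b::real_normed_vector" and u v :: "'n smooth_fun"
  assumes f: "\<And>y. y \<in> hyp_space \<Longrightarrow> f y = ev u (y, t) *\<^sub>R c + ev v (y, t) *\<^sub>R d"
    and x: "x \<in> hyp_space"
  shows "partial i f x = ev (di i u) (x, t) *\<^sub>R c + ev (di i v) (x, t) *\<^sub>R d"
proof -
  have z: "(x, t) \<in> hyp_cylinder" using x by simp
  have "((\<lambda>y. (y, t)) has_derivative (\<lambda>h. (h, 0))) (at x)"
    by (auto intro!: derivative_eq_intros)
  from has_derivative_compose[OF this] ev_has_derivative[OF z]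
  have d: "((\<lambda>y. ev u (y, t)) has_derivative (\<lambda>h. ev (dv (h, 0) u) (x, t))) (at x)" for u
    by blast
  have "((\<lambda>y. ev u (y, t) *\<^sub>R c + ev v (y, t) *\<^sub>R d) has_derivative
      (\<lambda>h. ev (dv (h, 0) u) (x, t) *\<^sub>R c + ev (dv (h, 0) v) (x, t) *\<^sub>R d)) (at x)"
    by (intro has_derivative_add has_derivative_scaleR_left d)
  then have "(f has_derivative
      (\<lambda>h. ev (dv (h, 0) u) (x, t) *\<^sub>R c + ev (dv (h, 0) v) (x, t) *\<^sub>R d)) (at x)"
    by (rule has_derivative_transform_within_open[where s = hyp_space])
      (use x f in \<open>simp_all add: hyp_space_def\<close>)
  then show ?thesis
    unfolding partial_def by (simp add: frechet_derivative_at[symmetric])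
qed

text \<open>The chart formula is the divergence of 1 times the gradient, so \<open>vol_dvg\<close>
  with X = 1 identifies it; hence the factors 1 in the proof.\<close>

lemma hyp_laplacian_ev:
  fixes f :: "real ^ 'n::finite \<Rightarrow> 'b::real_normed_vector" and u v :: "'n smooth_fun"
  assumes f: "\<And>y. y \<in> hyp_space \<Longrightarrow> f y = ev u (y, t) *\<^sub>R c + ev v (y, t) *\<^sub>R d"
    and x: "x \<in> hyp_space"
  shows "hyp_laplacian f x = ev (Lap u) (x, t) *\<^sub>R c + ev (Lap v) (x, t) *\<^sub>R d"
proof -
  have z: "(x, t) \<in> hyp_cylinder" using x by simp
  have inner: "sqrt (det (hyp_metric y)) *\<^sub>R (\<Sum>j\<in>UNIV. (matrix_inv (hyp_metric y) $ i $ j) *\<^sub>R partial j f y)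
      = ev (vol * hb * 1 * di i u) (y, t) *\<^sub>R c + ev (vol * hb * 1 * di i v) (y, t) *\<^sub>R d"
    if y: "y \<in> hyp_space" for y i
  proof -
    have zy: "(y, t) \<in> hyp_cylinder" using y by simp
    have hb: "ev hb (y, t) = (1 - (norm y)\<^sup>2)\<^sup>2 / 4"
      using ev_hN[OF zy] ev_const[OF zy] by (simp add: hb_def ev_ring power2_eq_square)
    have "(\<Sum>j\<in>UNIV. (matrix_inv (hyp_metric y) $ i $ j) *\<^sub>R partial j f y)
        = (\<Sum>j\<in>UNIV. if i = j then ev hb (y, t) *\<^sub>R partial j f y else 0)"
      by (intro sum.cong) (auto simp: matrix_inv_hyp_metric[OF y] hb mat_def)
    also have "\<dots> = ev hb (y, t) *\<^sub>R partial i f y" by simp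
    finally show ?thesis
      using ev_ring(6)[OF zy]
      by (simp add: sqrt_det_hyp_metric[OF y, of t] partial_ev[OF f y] ev_ring(2) scaleR_add_right mult.assoc)
  qed
  have "(\<Sum>i\<in>UNIV. partial i
      (\<lambda>y. sqrt (det (hyp_metric y)) *\<^sub>R (\<Sum>j\<in>UNIV. (matrix_inv (hyp_metric y) $ i $ j) *\<^sub>R partial j f y)) x)
    = (\<Sum>i\<in>UNIV. ev (di i (vol * hb * 1 * di i u)) (x, t) *\<^sub>R c + ev (di i (vol * hb * 1 * di i v)) (x, t) *\<^sub>R d)"
    by (intro sum.cong refl partial_ev inner x)
  also have "\<dots> = ev (vol * dvg 1 u) (x, t) *\<^sub>R c + ev (vol * dvg 1 v) (x, t) *\<^sub>R d"
    unfolding vol_dvg ev_sum by (simp add: sum.distrib scaleR_left.sum)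
  also have "\<dots> = ev vol (x, t) *\<^sub>R (ev (Lap u) (x, t) *\<^sub>R c + ev (Lap v) (x, t) *\<^sub>R d)"
    by (simp add: dvg_def Gam_simps ev_ring(2) scaleR_add_right)
  finally show ?thesis
    unfolding hyp_laplacian_def laplace_beltrami_def sqrt_det_hyp_metric[OF x, of t]
    using vol_pos[OF z] by simp
qed

section \<open>The space-time measure\<close>

text \<open>Nonnegativity permits Tonelli, which separates space from time. The restrictions to the
  ball and to [0, 1] are harmless as the integrand vanishes outside.\<close>

lemma integral_spacetime_measure:
  fixes f :: "'n::finite smooth_fun"
  assumes f: "csupp f" "\<And>z. ev f z \<ge> 0" and t: "\<And>x t. t \<notin> {0..1} \<Longrightarrow> ev f (x, t) = 0"
  shows "(LINT z|spacetime_measure. ev f z) = integ f"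
proof -
  let ?M = "hyp_volume :: (real ^ 'n) measure" and ?T = "restrict_space lborel {0..1::real}"
  let ?B = "restrict_space lborel hyp_space :: (real ^ 'n) measure"
  have B: "hyp_space \<in> sets (lborel :: (real ^ 'n) measure)" by (simp add: hyp_space_def)
  have cont: "continuous_on UNIV (ev f)" by (rule csupp_continuous[OF f(1)])
  then have mf: "ev f \<in> borel_measurable borel" by (rule borel_measurable_continuous_onI)
  have mf': "(\<lambda>z. ennreal (ev f z)) \<in> borel_measurable (lborel \<Otimes>\<^sub>M lborel)"
    using mf unfolding lborel_prod by simp
  have id: "(\<lambda>z. (fst z, snd z)) \<in> measurable (?M \<Otimes>\<^sub>M ?T) (borel \<Otimes>\<^sub>M borel)"
  proof (intro measurable_Pair)
    have "(\<lambda>x. x) \<in> measurable ?M borel"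
      unfolding hyp_volume_def riem_volume_def
      by (simp add: measurable_restrict_space1)
    then show "fst \<in> measurable (?M \<Otimes>\<^sub>M ?T) borel"
      using measurable_compose[OF measurable_fst] by blast
    have "(\<lambda>x. x) \<in> measurable ?T borel" by (simp add: measurable_restrict_space1)
    then show "snd \<in> measurable (?M \<Otimes>\<^sub>M ?T) borel"
      using measurable_compose[OF measurable_snd] by blast
  qed
  have ms: "ev f \<in> borel_measurable (?M \<Otimes>\<^sub>M ?T)"
    using measurable_compose[OF id, of "ev f" borel] mf by (simp add: borel_prod)
  have mvol: "(\<lambda>x. ennreal (sqrt (det (hyp_metric x)))) \<in> borel_measurable ?B"
  proof -
    have "continuous_on hyp_space (\<lambda>x. ev vol (x, 0))"
      by (rule continuous_on_compose2[OF smooth_on_continuous_on[OF smooth_ev]])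
        (auto intro!: continuous_intros)
    then have "(\<lambda>x. ev vol (x :: real ^ 'n, 0)) \<in> borel_measurable (restrict_space borel hyp_space)"
      by (rule borel_measurable_continuous_on_restrict)
    then have "(\<lambda>x. ev vol (x :: real ^ 'n, 0)) \<in> borel_measurable ?B"
      by (simp add: measurable_cong_sets[OF sets_restrict_space_cong[OF sets_lborel] refl])
    then have "(\<lambda>x. sqrt (det (hyp_metric x))) \<in> borel_measurable ?B"
      by (subst measurable_cong[where g = "\<lambda>x. ev vol (x, 0)"])
        (auto simp: space_restrict_space sqrt_det_hyp_metric[where t = 0])
    then show ?thesis by measurable
  qed
  interpret T: sigma_finite_measure ?T
    by (rule sigma_finite_measure_restrict_space) (auto intro: lborel.sigma_finite_measure_axioms)
  have inner: "(\<integral>\<^sup>+t. ennreal (ev f (x, t)) \<partial>?T) = (\<integral>\<^sup>+t. ennreal (ev f (x, t)) \<partial>lborel)" for x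
    by (subst nn_integral_restrict_space)
      (auto intro!: nn_integral_cong simp: t indicator_def)
  have mi: "(\<lambda>x. \<integral>\<^sup>+t. ennreal (ev f (x, t)) \<partial>lborel) \<in> borel_measurable lborel"
    using lborel.borel_measurable_nn_integral_fst[OF mf'] by simp
  have miB: "(\<lambda>x. \<integral>\<^sup>+t. ennreal (ev f (x, t)) \<partial>lborel) \<in> borel_measurable ?B"
    by (rule measurable_restrict_space1[OF mi])
  have "(\<integral>\<^sup>+z. ennreal (ev f z) \<partial>spacetime_measure) = (\<integral>\<^sup>+x. (\<integral>\<^sup>+t. ennreal (ev f (x, t)) \<partial>?T) \<partial>?M)"
    unfolding spacetime_measure_def
    by (rule T.nn_integral_fst[symmetric]) (use ms in measurable)
  also have "\<dots> = (\<integral>\<^sup>+x. ennreal (sqrt (det (hyp_metric x))) * (\<integral>\<^sup>+t. ennreal (ev f (x, t)) \<partial>lborel) \<partial>?B)"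
    unfolding inner unfolding hyp_volume_def riem_volume_def
    by (rule nn_integral_density[OF mvol miB])
  also have "\<dots> = (\<integral>\<^sup>+x. ennreal (sqrt (det (hyp_metric x))) * (\<integral>\<^sup>+t. ennreal (ev f (x, t)) \<partial>lborel)
      * indicator hyp_space x \<partial>lborel)"
    by (rule nn_integral_restrict_space) (use B in simp)
  also have "\<dots> = (\<integral>\<^sup>+x. (\<integral>\<^sup>+t. ennreal (ev (vol * f) (x, t)) \<partial>lborel) \<partial>lborel)"
  proof (rule nn_integral_cong)
    fix x :: "real ^ 'n"
    show "ennreal (sqrt (det (hyp_metric x))) * (\<integral>\<^sup>+t. ennreal (ev f (x, t)) \<partial>lborel) * indicator hyp_space x
        = (\<integral>\<^sup>+t. ennreal (ev (vol * f) (x, t)) \<partial>lborel)"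
    proof (cases "x \<in> hyp_space")
      case True
      have m: "(\<lambda>t. ennreal (ev f (x, t))) \<in> borel_measurable lborel"
        using measurable_compose[OF measurable_Pair1'[of x lborel lborel] mf'] by simp
      have "ennreal (ev (vol * f) (x, t)) = ennreal (sqrt (det (hyp_metric x))) * ennreal (ev f (x, t))" for t
        using vol_pos[of "(x, t)"] True f(2)
        by (simp add: ev_ring(2) sqrt_det_hyp_metric[OF True, of t] ennreal_mult)
      then show ?thesis using True nn_integral_cmult[OF m] by simp
    next
      case False
      then show ?thesis by (simp add: ev_outside)
    qed
  qed
  also have "\<dots> = (\<integral>\<^sup>+z. ennreal (ev (vol * f) z) \<partial>lborel)"
  proof -
    have "csupp (vol * f)" by (rule csupp_mult(2)[OF f(1)])
    then have "ev (vol * f) \<in> borel_measurable borel"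
      by (intro borel_measurable_continuous_onI csupp_continuous)
    then have "(\<lambda>z. ennreal (ev (vol * f) z)) \<in> borel_measurable (lborel \<Otimes>\<^sub>M lborel)"
      unfolding lborel_prod by simp
    from lborel.nn_integral_fst[OF this] show ?thesis unfolding lborel_prod .
  qed
  finally have nn: "(\<integral>\<^sup>+z. ennreal (ev f z) \<partial>spacetime_measure) = (\<integral>\<^sup>+z. ennreal (ev (vol * f) z) \<partial>lborel)" .
  have "(LINT z|spacetime_measure. ev f z) = enn2real (\<integral>\<^sup>+z. ennreal (ev f z) \<partial>spacetime_measure)"
    by (rule integral_eq_nn_integral) (use ms f(2) in \<open>auto simp: spacetime_measure_def\<close>)
  also have "\<dots> = integ f"
    unfolding nn integ_def
  proof (rule integral_eq_nn_integral[symmetric])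
    show "ev (vol * f) \<in> borel_measurable lborel"
      using csupp_integrable[OF csupp_mult(2)[OF f(1)]] by (rule borel_measurable_integrable)
    have "ev (vol * f) z \<ge> 0" for z
      using f(2)[of z] vol_pos[of z] ev_outside[of z vol] by (cases "z \<in> hyp_cylinder") (auto simp: ev_ring(2))
    then show "AE z in lborel. 0 \<le> ev (vol * f) z" by simp
  qed
  finally show ?thesis .
qed

lemma space_spacetime_measure: "z \<in> space spacetime_measure \<longleftrightarrow> fst z \<in> hyp_space \<and> snd z \<in> {0..1}"
  by (auto simp: spacetime_measure_def hyp_volume_def riem_volume_def space_pair_measure
      space_restrict_space mem_Times_iff)

lemma L2norm_spacetime:
  assumes "csupp p" "csupp q" and t: "\<And>x t. t \<notin> {0..1} \<Longrightarrow> ev p (x, t) = 0 \<and> ev q (x, t) = 0"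
    and f: "\<And>x t. x \<in> hyp_space \<Longrightarrow> t \<in> {0..1} \<Longrightarrow> f (x, t) = Complex (ev p (x, t)) (ev q (x, t))"
  shows "L2norm spacetime_measure f = sqrt (integ (p * p + q * q))"
proof -
  have "(LINT z|spacetime_measure. (cmod (f z))\<^sup>2) = (LINT z|spacetime_measure. ev (p * p + q * q) z)"
  proof (rule Bochner_Integration.integral_cong[OF refl])
    fix z :: "(real ^ 'a) \<times> real" assume "z \<in> space spacetime_measure"
    then have "f z = Complex (ev p z) (ev q z)"
      using f[of "fst z" "snd z"] by (simp add: space_spacetime_measure)
    moreover have "(cmod (Complex a b))\<^sup>2 = a * a + b * b" for a b
      unfolding cmod_power2 by (simp add: power2_eq_square)
    ultimately show "(cmod (f z))\<^sup>2 = ev (p * p + q * q) z"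
      by (simp only: ev_ring)
  qed
  also have "\<dots> = integ (p * p + q * q)"
    by (rule integral_spacetime_measure) (use assms t in \<open>auto simp: csupp_add csupp_mult ev_ring\<close>)
  finally show ?thesis by (simp add: L2norm_def)
qed

section \<open>Test functions\<close>

lemma Ck_on_Un:
  assumes "open A" "open B"
  shows "Ck_on k A f \<Longrightarrow> Ck_on k B f \<Longrightarrow> Ck_on k (A \<union> B) f"
  by (induction k arbitrary: f) (auto intro: continuous_on_open_Un assms)

lemma test_function_components:
  fixes h :: "(real ^ 'n::finite) \<times> real \<Rightarrow> complex"
  assumes "h \<in> test_functions (hyp_space \<times> {0<..<1})"
  obtains h1 h2 :: "'n smooth_fun" and S where "\<And>z. h z = Complex (ev h1 z) (ev h2 z)"
    "compact S" "S \<subseteq> hyp_space \<times> {0<..<1}"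
    "\<And>z. z \<notin> S \<Longrightarrow> ev h1 z = 0" "\<And>z. z \<notin> S \<Longrightarrow> ev h2 z = 0"
proof -
  define S where "S = closure {z. h z \<noteq> 0}"
  have h: "smooth_on (hyp_space \<times> {0<..<1}) h" "compact S" "S \<subseteq> hyp_space \<times> {0<..<1}"
    using assms by (auto simp: test_functions_def S_def)
  have off: "h z = 0" if "z \<notin> S" for z
    using that closure_subset[of "{z. h z \<noteq> 0}"] by (auto simp: S_def)
  have opens: "open (hyp_space \<times> {0<..<1} :: ((real ^ 'n) \<times> real) set)" "open (- S)"
    using h(2) by (auto simp: hyp_space_def open_Times compact_imp_closed)
  \<comment> \<open>\<open>h\<close> is smooth on the slab 0 < t < 1 and zero off its support; these
    two open sets cover the cylinder.\<close>
  have "Ck_on k hyp_cylinder h" for k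
  proof -
    have "Ck_on k (- S) h"
      by (subst Ck_on_cong[OF opens(2), where g = "\<lambda>_. 0"]) (auto simp: off Ck_on_const)
    then have "Ck_on k (hyp_space \<times> {0<..<1} \<union> - S) h"
      using h(1) by (intro Ck_on_Un opens) (auto simp: smooth_on_def)
    then show ?thesis by (rule Ck_on_subset) (use h(3) in auto)
  qed
  then have sm: "smooth_on hyp_cylinder h" by (simp add: smooth_on_def)
  define h1 where "h1 = restr (\<lambda>z. Re (h z))"
  define h2 where "h2 = restr (\<lambda>z. Im (h z))"
  have S: "S \<subseteq> hyp_cylinder" using h(3) by auto
  then have off': "h z = 0" if "z \<notin> hyp_cylinder" for z
    using that off by blast
  have e: "ev h1 z = Re (h z)" "ev h2 z = Im (h z)" for z
    unfolding h1_def h2_def using off'[of z]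
    by (simp_all add: ev_restr smooth_on_linear_comp[OF open_hyp_cylinder bounded_linear_Re sm]
        smooth_on_linear_comp[OF open_hyp_cylinder bounded_linear_Im sm])
  show thesis
    by (rule that[of h1 h2 S]) (use h(2,3) off in \<open>simp_all add: e\<close>)
qed

lemma ev_Lap_off_support:
  assumes "compact K" "K \<subseteq> hyp_cylinder" "\<And>z. z \<notin> K \<Longrightarrow> ev f z = 0" "z \<notin> K"
  shows "ev (Lap f) z = 0"
proof -
  have 1: "ev (dv v f) z = 0" if "z \<notin> K" for v z
    by (rule ev_dv_off_support[OF assms(1-3) that])
  have "ev (dv v' (dv v f)) z = 0" for v v'
    by (rule ev_dv_off_support[OF assms(1,2) 1 assms(4)])
  with 1[OF assms(4)] show ?thesis by (simp add: Lap_def Eul_def ev_ring ev_sum)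
qed

lemma dv_exp: "dv v (fcomp exp f) = fcomp exp f * dv v f"
  by (rule dv_fcomp[OF open_UNIV]) (auto intro!: smooth_exp derivative_eq_intros)

lemma ev_exp: "z \<in> hyp_cylinder \<Longrightarrow> ev (fcomp exp f) z = exp (ev f z)"
  by (rule ev_fcomp[OF open_UNIV]) (simp_all add: smooth_exp)

text \<open>For f = E (u + i v) the left-hand sides are the real and imaginary part of the
  conjugated operator applied to f, in the form that \<open>commutator_inequality\<close>
  estimates.\<close>

lemma conjugated_equation:
  fixes u v \<phi> :: "'n::finite smooth_fun"
  defines "E \<equiv> fcomp exp \<phi>"
  shows "dt (E * u) + symm \<phi> (E * v) - (dt \<phi> * (E * u) + skew \<phi> (E * v)) = E * (dt u + Lap v)"
    and "dt (E * v) - symm \<phi> (E * u) - (dt \<phi> * (E * v) - skew \<phi> (E * u)) = E * (dt v - Lap u)"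
proof -
  have G: "Gam E w = E * Gam \<phi> w" "Gam w E = E * Gam w \<phi>" for w
    by (simp_all add: E_def Gam_def dv_exp sum_distrib_left mult_ac)
  have L: "Lap E = E * (Lap \<phi> + Gam \<phi> \<phi>)"
    by (simp add: E_def Lap_def Gam_def Eul_def dv_exp dv_mult sum.distrib sum_distrib_left algebra_simps)
  have D: "dt E = E * dt \<phi>" by (simp add: E_def dv_exp)
  show "dt (E * u) + symm \<phi> (E * v) - (dt \<phi> * (E * u) + skew \<phi> (E * v)) = E * (dt u + Lap v)"
    "dt (E * v) - symm \<phi> (E * u) - (dt \<phi> * (E * v) - skew \<phi> (E * u)) = E * (dt v - Lap u)"
    by (simp_all add: symm_def skew_def dv_mult Lap_simps Gam_simps G L D Gam_commute algebra_simps)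
qed

lemma schroedinger_components:
  assumes h: "\<And>z. h z = Complex (ev h1 z) (ev h2 z)" and x: "x \<in> hyp_space"
  shows "schroedinger h (x, t) = Complex (ev (dt h1 + Lap h2) (x, t)) (ev (dt h2 - Lap h1) (x, t))"
proof -
  have z: "(x, t) \<in> hyp_cylinder" using x by simp
  have *: "Complex a b = a *\<^sub>R 1 + b *\<^sub>R \<i>" for a b by (simp add: complex_eq_iff)
  have "hyp_laplacian (\<lambda>y. h (y, t)) x = ev (Lap h1) (x, t) *\<^sub>R 1 + ev (Lap h2) (x, t) *\<^sub>R \<i>"
    by (rule hyp_laplacian_ev[OF _ x]) (simp only: h *)
  moreover have "vector_derivative (\<lambda>s. h (x, s)) (at t) = ev (dt h1) (x, t) *\<^sub>R 1 + ev (dt h2) (x, t) *\<^sub>R \<i>"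
  proof (rule vector_derivative_at)
    have d: "((\<lambda>s. ev u (x, s)) has_real_derivative ev (dt u) (x, t)) (at t)" for u
    proof -
      have "((\<lambda>s. (x, s)) has_derivative (\<lambda>k. (0, k))) (at t)"
        by (auto intro!: derivative_eq_intros)
      from has_derivative_compose[OF this ev_has_derivative[OF z]]
      have "((\<lambda>s. ev u (x, s)) has_derivative (\<lambda>k. ev (dv (0, k) u) (x, t))) (at t)" .
      moreover have "(\<lambda>k. ev (dv (0, k) u) (x, t)) = (*) (ev (dt u) (x, t))"
      proof
        show "ev (dv (0, k) u) (x, t) = ev (dt u) (x, t) * k" for k
          using linear_scale[OF has_derivative_linear[OF ev_has_derivative[OF z, of u]], of k "(0, 1)"]
          by simp
      qed
      ultimately show ?thesis unfolding has_field_derivative_def by (rule back_subst)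
    qed
    have "((\<lambda>s. ev h1 (x, s) *\<^sub>R 1 + ev h2 (x, s) *\<^sub>R \<i>) has_vector_derivative
        (ev h1 (x, t) *\<^sub>R 0 + ev (dt h1) (x, t) *\<^sub>R 1) + (ev h2 (x, t) *\<^sub>R 0 + ev (dt h2) (x, t) *\<^sub>R \<i>)) (at t)"
      by (intro has_vector_derivative_add has_vector_derivative_scaleR d has_vector_derivative_const)
    then show "((\<lambda>s. h (x, s)) has_vector_derivative
        ev (dt h1) (x, t) *\<^sub>R 1 + ev (dt h2) (x, t) *\<^sub>R \<i>) (at t)"
      unfolding h * by simp
  qed
  ultimately show ?thesis
    by (simp add: schroedinger_def complex_eq_iff ev_ring)
qed

section \<open>Identification of the weight and the final estimate\<close>

context arcosh_square
begin

context
  fixes R :: real and e :: "real ^ 'n::finite"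
  assumes e: "norm e = 1"
begin

lemma hyp_dist_sq:
  assumes x: "x \<in> hyp_space"
  shows "(hyp_dist x (hyp_point e (- (R * t * (1 - t)))))\<^sup>2 = ev (hF R e) (x, t)"
proof -
  have z: "(x, t) \<in> hyp_cylinder" using x by simp
  define c where "c = cosh_dist e (- (R * t * (1 - t))) x"
  have "c \<ge> 1" unfolding c_def by (rule cosh_dist_ge_1[OF e x])
  have "ev (hF R e) (x, t) = G (cosh (arcosh c))"
    using \<open>c \<ge> 1\<close> by (simp add: ev_hF[OF e z] ev_hZ[OF x] c_def)
  also have "\<dots> = (arcosh c)\<^sup>2" by (rule G_cosh)
  finally show ?thesis by (simp add: hyp_dist_hyp_point[OF e x] c_def)
qed

text \<open>Carries the assumed bound on the bilaplacian, taken at the moving point, over to the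
  ring; the second component of \<open>hyp_laplacian_ev\<close> is set to zero.\<close>

lemma hyp_bilaplacian_dist_sq:
  assumes x: "x \<in> hyp_space"
  shows "hyp_laplacian (hyp_laplacian (\<lambda>y. (hyp_dist y (hyp_point e (- (R * t * (1 - t)))))\<^sup>2)) x
    = ev (Lap (Lap (hF R e))) (x, t)"
proof -
  have "hyp_laplacian (\<lambda>y. (hyp_dist y (hyp_point e (- (R * t * (1 - t)))))\<^sup>2) y
      = ev (Lap (hF R e)) (y, t) *\<^sub>R 1 + ev (Lap 0) (y, t) *\<^sub>R 1" if "y \<in> hyp_space" for y
    by (rule hyp_laplacian_ev[OF _ that]) (simp add: hyp_dist_sq ev_ring)
  then have "hyp_laplacian (hyp_laplacian (\<lambda>y. (hyp_dist y (hyp_point e (- (R * t * (1 - t)))))\<^sup>2)) x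
      = ev (Lap (Lap (hF R e))) (x, t) *\<^sub>R 1 + ev (Lap (Lap 0)) (x, t) *\<^sub>R 1"
    by (rule hyp_laplacian_ev[OF _ x])
  then show ?thesis by (simp add: Lap_simps ev_ring)
qed

end

end

lemma integ_const_mult: "integ (const c * f) = c * integ f"
proof -
  have "ev (vol * (const c * f)) z = c * ev (vol * f) z" for z
    by (cases "z \<in> hyp_cylinder") (simp_all add: ev_simps ev_outside)
  then show ?thesis by (simp add: integ_def)
qed

theorem theorem4p1:
  fixes C \<epsilon> \<mu> R :: real
    and e1 :: "real ^ 'n"
    and P :: "real \<Rightarrow> real ^ 'n"
    and w :: "(real ^ 'n) \<times> real \<Rightarrow> real"
    and h :: "(real ^ 'n) \<times> real \<Rightarrow> complex"
  assumes dim: "CARD('n) \<ge> 2"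
    and C_pos: "C > 0"
    and C_bound: "\<And>p x :: real ^ 'n. p \<in> hyp_space \<Longrightarrow> x \<in> hyp_space \<Longrightarrow>
          \<bar>hyp_laplacian (hyp_laplacian (\<lambda>y. (hyp_dist y p)\<^sup>2)) x\<bar> \<le> C"
    and e1_unit: "riem_norm hyp_metric 0 e1 = 1"
    and R_pos: "R > 0"
    and P_def: "\<And>t. t \<in> {0..1} \<Longrightarrow> P t = hyp_exp 0 (- (R * t * (1 - t)) *\<^sub>R e1)"
    and eps_pos: "\<epsilon> > 0"
    and mu_pos: "\<mu> > 0"
    and h_test: "h \<in> test_functions (hyp_space \<times> {0<..<1})"
    and R_large: "R > 4 * \<mu> * \<epsilon> powr (-1/2) * C"
    and w_def: "\<And>x t. x \<in> hyp_space \<Longrightarrow> t \<in> {0..1} \<Longrightarrow>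
          w (x, t) = exp (\<mu> * (hyp_dist x (P t))\<^sup>2 - (1 + \<epsilon>) * R\<^sup>2 * t * (1 - t) / (16 * \<mu>))"
  shows "R / 4 * sqrt (\<epsilon> / \<mu>) * L2norm spacetime_measure (\<lambda>z. w z *\<^sub>R h z)
       \<le> L2norm spacetime_measure (\<lambda>z. w z *\<^sub>R schroedinger h z)"
proof -
  obtain V G G1 G2 where "arcosh_square V G G1 G2" using arcosh_square_exists by blast
  then interpret arcosh_square V G G1 G2 .
  \<comment> \<open>The metric at the origin is 4 |dx|^2, so a Riemannian unit vector has Euclidean
    length 1/2.\<close>
  define e where "e = 2 *\<^sub>R e1"
  have "(0 :: real ^ 'n) \<in> hyp_space" by (simp add: hyp_space_def)
  from e1_unit[unfolded riem_norm_hyp[OF this]] have e: "norm e = 1" by (simp add: e_def)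
  obtain h1 h2 :: "'n smooth_fun" and S where h: "\<And>z. h z = Complex (ev h1 z) (ev h2 z)"
    and S: "compact S" "S \<subseteq> hyp_space \<times> {0<..<1}"
    and off: "\<And>z. z \<notin> S \<Longrightarrow> ev h1 z = 0" "\<And>z. z \<notin> S \<Longrightarrow> ev h2 z = 0"
    using test_function_components[OF h_test] by blast
  have S': "S \<subseteq> hyp_cylinder" using S(2) by auto
  have supp: "csupp h1" "csupp h2" unfolding csupp_def using S(1) S' off by blast+
  have outside: "(x, t) \<notin> S" if "t \<notin> {0..1}" for x t using S(2) that by auto
  define \<phi> where "\<phi> = phase R e \<mu> \<epsilon>"
  define E where "E = fcomp exp \<phi>"
  define p where "p = E * h1"
  define q where "q = E * h2"
  define N1 where "N1 = E * (dt h1 + Lap h2)"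
  define N2 where "N2 = E * (dt h2 - Lap h1)"
  have w: "w (x, t) = ev E (x, t)" if "x \<in> hyp_space" "t \<in> {0..1}" for x t
  proof -
    have z: "(x, t) \<in> hyp_cylinder" using that by simp
    have "P t = hyp_exp 0 ((- (R * t * (1 - t)) / 2) *\<^sub>R e)"
      using P_def[OF that(2)] by (simp add: e_def)
    then have "P t = hyp_point e (- (R * t * (1 - t)))"
      by (simp only: hyp_exp_eq_hyp_point[OF e])
    then have "(hyp_dist x (P t))\<^sup>2 = ev (hF R e) (x, t)"
      by (simp only: hyp_dist_sq[OF e that(1)])
    then show ?thesis
      unfolding w_def[OF that] E_def ev_exp[OF z] \<phi>_def phase_def[OF e] ev_ring ev_const[OF z] ev_time[OF z]
        ev_ring(6)[OF z]
      by (simp add: field_simps)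
  qed
  \<comment> \<open>Required for every real t, since the integrals run over the whole cylinder;
    \<open>P\<close> is prescribed on [0, 1] only, but \<open>hyp_point\<close> continues its
    path.\<close>
  have bilap: "\<bar>ev (Lap (Lap (hF R e))) (x, t)\<bar> \<le> C" if "x \<in> hyp_space" for x t
    using C_bound[OF hyp_point_in_hyp_space[OF e] that] hyp_bilaplacian_dist_sq[OF e that] by metis
  have C1: "C \<ge> 1"
    using Lap_Lap_hF_origin[OF e dim, of R] bilap[of 0 0] by (simp add: hyp_space_def)
  have L1: "L2norm spacetime_measure (\<lambda>z. w z *\<^sub>R h z) = sqrt (integ (p * p + q * q))"
  proof (rule L2norm_spacetime)
    show "csupp p" "csupp q" unfolding p_def q_def by (intro csupp_mult(2) supp)+
    show "ev p (x, t) = 0 \<and> ev q (x, t) = 0" if "t \<notin> {0..1}" for x t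
      using off[OF outside[OF that]] by (simp add: p_def q_def ev_ring)
    show "w (x, t) *\<^sub>R h (x, t) = Complex (ev p (x, t)) (ev q (x, t))"
      if "x \<in> hyp_space" "t \<in> {0..1}" for x t
      by (simp add: w[OF that] h p_def q_def ev_ring complex_eq_iff)
  qed
  have suppN: "csupp N1" "csupp N2"
    unfolding N1_def N2_def by (intro csupp_mult(2) csupp_add csupp_diff csupp_dv csupp_Lap supp)+
  have L2: "L2norm spacetime_measure (\<lambda>z. w z *\<^sub>R schroedinger h z) = sqrt (integ (N1 * N1 + N2 * N2))"
  proof (rule L2norm_spacetime[OF suppN])
    show "ev N1 (x, t) = 0 \<and> ev N2 (x, t) = 0" if "t \<notin> {0..1}" for x t
      using ev_dv_off_support[OF S(1) S' off(1) outside[OF that]]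
        ev_dv_off_support[OF S(1) S' off(2) outside[OF that]]
        ev_Lap_off_support[OF S(1) S' off(1) outside[OF that]]
        ev_Lap_off_support[OF S(1) S' off(2) outside[OF that]]
      by (simp add: N1_def N2_def ev_ring)
    show "w (x, t) *\<^sub>R schroedinger h (x, t) = Complex (ev N1 (x, t)) (ev N2 (x, t))"
      if "x \<in> hyp_space" "t \<in> {0..1}" for x t
      by (simp add: w[OF that] schroedinger_components[OF h that(1)] N1_def N2_def ev_ring complex_eq_iff)
  qed
  define K where "K = \<epsilon> * R\<^sup>2 / (8 * \<mu>) - \<mu> * C"
  \<comment> \<open>The assumption on R gives \<epsilon> R^2 \<ge> 16 \<mu>^2 C^2, while 16 \<mu>^2
    C is what has to be dominated; C \<ge> 1 bridges the two.\<close>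
  have K: "(R / 4 * sqrt (\<epsilon> / \<mu>))\<^sup>2 \<le> K"
  proof -
    have pw: "\<epsilon> powr (-1/2) = 1 / sqrt \<epsilon>"
      using powr_minus[of \<epsilon> "1/2"] powr_half_sqrt[of \<epsilon>] eps_pos by (simp add: inverse_eq_divide)
    have "4 * \<mu> * C / sqrt \<epsilon> < R" using R_large unfolding pw by simp
    then have "4 * \<mu> * C < R * sqrt \<epsilon>" using eps_pos by (simp add: pos_divide_less_eq)
    then have "(4 * \<mu> * C)\<^sup>2 \<le> (R * sqrt \<epsilon>)\<^sup>2"
      using C_pos mu_pos by (intro power_mono) auto
    then have "16 * \<mu>\<^sup>2 * C\<^sup>2 \<le> \<epsilon> * R\<^sup>2"
      using eps_pos by (simp add: power_mult_distrib mult.commute)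
    moreover have "16 * \<mu>\<^sup>2 * C \<le> 16 * \<mu>\<^sup>2 * C\<^sup>2"
      using C1 by (intro mult_left_mono self_le_power) auto
    ultimately have "16 * \<mu>\<^sup>2 * C \<le> \<epsilon> * R\<^sup>2" by linarith
    moreover have "(R / 4 * sqrt (\<epsilon> / \<mu>))\<^sup>2 = \<epsilon> * R\<^sup>2 / (16 * \<mu>)"
      using eps_pos mu_pos by (simp add: power_mult_distrib power_divide mult.commute)
    moreover have "\<mu> * C \<le> \<epsilon> * R\<^sup>2 / (16 * \<mu>) \<longleftrightarrow> 16 * \<mu>\<^sup>2 * C \<le> \<epsilon> * R\<^sup>2"
      using mu_pos by (simp add: pos_le_divide_eq power2_eq_square mult_ac)
    moreover have "\<epsilon> * R\<^sup>2 / (8 * \<mu>) = 2 * (\<epsilon> * R\<^sup>2 / (16 * \<mu>))" by simp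
    ultimately show ?thesis unfolding K_def by linarith
  qed
  let ?Q = "dt (dt \<phi>) * (p * p + q * q) + 4 * (p * Gam (dt \<phi>) q - q * Gam (dt \<phi>) p)
      + (2 * p * p * Gam \<phi> (Gam \<phi> \<phi>) + 2 * hess2 \<phi> p - p * p * Lap (Lap \<phi>))
      + (2 * q * q * Gam \<phi> (Gam \<phi> \<phi>) + 2 * hess2 \<phi> q - q * q * Lap (Lap \<phi>))"
  have pq: "csupp p" "csupp q" unfolding p_def q_def by (intro csupp_mult(2) supp)+
  have "K * integ (p * p + q * q) = integ (const K * (p * p + q * q))"
    by (simp only: integ_const_mult)
  also have "\<dots> \<le> integ ?Q"
  proof (rule integ_mono)
    show "csupp (const K * (p * p + q * q))" by (intro csupp_mult(2) csupp_add pq)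
    show "csupp ?Q" by (rule commutator_inequality(2)[OF pq])
    fix z :: "(real ^ 'n) \<times> real" assume z: "z \<in> hyp_cylinder"
    have "ev (Lap (Lap (hF R e))) z \<le> C" using bilap[of "fst z" "snd z"] z by auto
    from quadratic_form_bound[OF e z mu_pos R_pos this \<phi>_def, of p q]
    show "ev (const K * (p * p + q * q)) z \<le> ev ?Q z"
      by (simp add: ev_ring(1,2) ev_const[OF z] K_def power2_eq_square)
  qed
  also have "\<dots> \<le> integ (N1 * N1 + N2 * N2)"
    using commutator_inequality(1)[OF pq, of \<phi>]
    unfolding N1_def N2_def E_def conjugated_equation[symmetric] p_def q_def power2_eq_square .
  finally have main: "K * integ (p * p + q * q) \<le> integ (N1 * N1 + N2 * N2)" .
  \<comment> \<open>Nonnegativity of the integral allows K to be replaced by the smaller squared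
    constant.\<close>
  have "integ (p * p + q * q) \<ge> integ (0 :: 'n smooth_fun)"
    by (rule integ_mono) (auto intro!: csupp_zero csupp_add csupp_mult pq simp: ev_ring)
  then have "integ (p * p + q * q) \<ge> 0" by (simp add: integ_def ev_ring)
  then have "(R / 4 * sqrt (\<epsilon> / \<mu>))\<^sup>2 * integ (p * p + q * q) \<le> integ (N1 * N1 + N2 * N2)"
    using mult_right_mono[OF K, of "integ (p * p + q * q)"] main by linarith
  then have "sqrt ((R / 4 * sqrt (\<epsilon> / \<mu>))\<^sup>2 * integ (p * p + q * q)) \<le> sqrt (integ (N1 * N1 + N2 * N2))"
    by (rule real_sqrt_le_mono)
  moreover have "R / 4 * sqrt (\<epsilon> / \<mu>) \<ge> 0" using R_pos eps_pos mu_pos by simp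
  ultimately show ?thesis
    unfolding L1 L2 by (simp add: real_sqrt_mult)
qed

end
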